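(* Let $H$ be a $k$-hypertournament on $n$ vertices, where $2\le k\le n-1$. Then $H$ contains an antidirected hamiltonian path if and only if $H$ is not isomorphic to any of $H_4$, $T_3^c$, $T_5^c$, $T_7^c$.
   Context: A $k$-hypertournament $H$ on $n$ vertices is a pair $(V(H),A(H))$ where $V(H)$ is a set of $n$ vertices and $A(H)$ is a set of $k$-tuples of distinct vertices (arcs) such that for every $k$-subset $S\subseteq V(H)$, $A(H)$ contains exactly one of the $k!$ $k$-tuples whose entries are the elements of $S$. A $2$-hypertournament is a tournament (the arc $(x,y)$ being the directed edge $x\to y$). For an arc $a=(y_1,\dots,y_k)$ and $i<j$, we say $y_i$ precedes $y_j$ in $a$. Two hypertournaments are isomorphic if there is a bijection between their vertex sets mapping the arc set of one onto the arc set of the other. An antidirected path in $H$ is a sequence $x_1a_1x_2a_2\cdots x_{t-1}a_{t-1}x_t$ ($t\ge 2$) of distinct vertices $x_1,\dots,x_t$ and distinct arcs $a_1,\dots,a_{t-1}$, where each arc $a_i$ contains $x_i$ and $x_{i+1}$, such that for every $i\in\{2,\dots,t-1\}$ either ($x_{i-1}$ precedes $x_i$ in $a_{i-1}$ and $x_{i+1}$ precedes $x_i$ in $a_i$) or ($x_i$ precedes $x_{i-1}$ in $a_{i-1}$ and $x_i$ precedes $x_{i+1}$ in $a_i$). An antidirected hamiltonian path is an antidirected path containing every vertex of $H$. The exceptional hypertournaments: $H_4$ is the $3$-hypertournament with vertex set $\{1,2,3,4\}$ and arc set $\{(2,3,4),(4,1,2),(3,4,1),(1,2,3)\}$. $T_3^c$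 is the tournament on vertices $z_1,z_2,z_3$ that is a directed $3$-cycle. $T_5^c$ is the tournament on vertices $z_1,\dots,z_5$ (indices mod $5$) with $z_i\to z_{i+1}$ and $z_i\to z_{i+2}$ for all $i$. $T_7^c$ is the tournament on vertices $z_1,\dots,z_7$ (indices mod $7$) with $z_i\to z_{i+1}$, $z_i\to z_{i+2}$ and $z_i\to z_{i+4}$ for all $i$. *)

theory Defs
  imports Main
begin

text \<open>A \<open>k\<close>-tuple of vertices is a list of length \<open>k\<close>; vertices are drawn from an arbitrary type.\<close>

type_synonym 'a vertices_arcs = "'a set \<times> 'a list set"

abbreviation verts :: "'a vertices_arcs \<Rightarrow> 'a set" where
  "verts H \<equiv> fst H"

abbreviation arcs :: "'a vertices_arcs \<Rightarrow> 'a list set" where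
  "arcs H \<equiv> snd H"

definition hypertournament :: "nat \<Rightarrow> nat \<Rightarrow> 'a vertices_arcs \<Rightarrow> bool" where
  "hypertournament k n H \<longleftrightarrow>
     finite (verts H) \<and> card (verts H) = n \<and>
     (\<forall>a \<in> arcs H. length a = k \<and> distinct a \<and> set a \<subseteq> verts H) \<and>
     (\<forall>S. S \<subseteq> verts H \<and> card S = k \<longrightarrow> (\<exists>!a. a \<in> arcs H \<and> set a = S))"

definition precedes_in :: "'a list \<Rightarrow> 'a \<Rightarrow> 'a \<Rightarrow> bool" where
  "precedes_in a x y \<longleftrightarrow> (\<exists>i j. i < j \<and> j < length a \<and> a ! i = x \<and> a ! j = y)"

definition isomorphic :: "'a vertices_arcs \<Rightarrow> 'b vertices_arcs \<Rightarrow> bool" where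
  "isomorphic H H' \<longleftrightarrow>
     (\<exists>f. bij_betw f (verts H) (verts H') \<and> map f ` arcs H = arcs H')"

text \<open>The path \<open>x\<^sub>1 a\<^sub>1 x\<^sub>2 \<dots> a\<^bsub>t-1\<^esub> x\<^sub>t\<close> is given by its vertex list \<open>xs\<close> and its arc list
  \<open>as\<close>. Lists are indexed from 0, so \<open>as ! i\<close> joins \<open>xs ! i\<close> and \<open>xs ! (i + 1)\<close>, and the
  interior vertices are the \<open>xs ! i\<close> with \<open>0 < i\<close> and \<open>i + 1 < t\<close>.\<close>

definition antidirected_path :: "'a vertices_arcs \<Rightarrow> 'a list \<Rightarrow> 'a list list \<Rightarrow> bool" where
  "antidirected_path H xs as \<longleftrightarrow>
     2 \<le> length xs \<and> length as = length xs - 1 \<and>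
     distinct xs \<and> set xs \<subseteq> verts H \<and>
     distinct as \<and> set as \<subseteq> arcs H \<and>
     (\<forall>i < length as. xs ! i \<in> set (as ! i) \<and> xs ! (i + 1) \<in> set (as ! i)) \<and>
     (\<forall>i. 0 < i \<and> i + 1 < length xs \<longrightarrow>
        (precedes_in (as ! (i - 1)) (xs ! (i - 1)) (xs ! i) \<and>
         precedes_in (as ! i) (xs ! (i + 1)) (xs ! i)) \<or>
        (precedes_in (as ! (i - 1)) (xs ! i) (xs ! (i - 1)) \<and>
         precedes_in (as ! i) (xs ! i) (xs ! (i + 1))))"

definition has_antidirected_hamiltonian_path :: "'a vertices_arcs \<Rightarrow> bool" where
  "has_antidirected_hamiltonian_path H \<longleftrightarrow>
     (\<exists>xs as. antidirected_path H xs as \<and> set xs = verts H)"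

definition H4 :: "nat vertices_arcs" where
  "H4 = ({1, 2, 3, 4}, {[2, 3, 4], [4, 1, 2], [3, 4, 1], [1, 2, 3]})"

text \<open>In the following circulant tournaments the vertex \<open>z\<^sub>i\<close> is the residue of \<open>i\<close> modulo the
  number of vertices.\<close>

definition T3c :: "nat vertices_arcs" where
  "T3c = ({..<3}, {[i, (i + 1) mod 3] | i. i < 3})"

definition T5c :: "nat vertices_arcs" where
  "T5c = ({..<5}, {[i, (i + s) mod 5] | i s. i < 5 \<and> s \<in> {1, 2}})"

definition T7c :: "nat vertices_arcs" where
  "T7c = ({..<7}, {[i, (i + s) mod 7] | i s. i < 7 \<and> s \<in> {1, 2, 4}})"

end

theory Submission
  imports Defs
begin

text \<open>
  Call a vertex an origin if an antidirected hamiltonian path starting with a forward arc starts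
  there, and let the reverse orders supply the backward analogue. To leave \<open>x\<close> through an arc towards
  \<open>y\<close>, it suffices that \<open>y\<close> is a backward origin once \<open>x\<close> and that arc are deleted. So if all but
  few vertices are backward origins in the smaller structure, then every \<open>x\<close> with enough successors
  is an origin; the remaining \<open>x\<close> have so few successors that a second step can be analysed by hand.

  For tournaments this shows, by induction from 9 and 10 vertices on, that a vertex of out-degree at
  least 3 is an origin. For \<open>3\<close>-uniform and for \<open>k\<close>-uniform structures with \<open>k \<ge> 4\<close> it shows, from 5
  vertices on, that of any two vertices one is an origin. The finitely many small cases are
  settled by decision trees found by computer: each tree branches on the relative order of two
  vertices in one arc and exhibits in each leaf a path or one of the exceptional structures.
\<close>

section \<open>Alternating paths\<close>

text \<open>Deleting the first vertex changes the claim: the induction must carry that few vertices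
  fail to start a path, not merely that a path exists. In a tournament two vertices may fail: let
  \<open>y\<close> have no successor, let \<open>y\<close> be the only successor of
  \<open>x\<close>, and let the other seven vertices form T_7^c. Hence triples and out-degree 3, and
  hence the long computation: T_7^c spoils any uniform claim up to 7 vertices, and an argument by
  two deletions needs the consecutive bases 9 and 10.

  With larger arcs, a vertex \<open>y\<close> that is no origin has few successors, so among three
  others two come before it, and this makes \<open>y\<close> a backward origin one vertex down. For
  \<open>k \<ge> 4\<close> the three others can be taken in one arc with \<open>y\<close>. For
  \<open>k = 3\<close> an arc offers only two, so successors are collected over several arcs;
  therefore this case is separate. The other obstacle is \<open>k = n - 1\<close>: discarding a
  vertex with all its arcs would leave a single arc. Therefore arcs may be larger than the sets that
  index them, and the uniformity is allowed to drop.\<close>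

text \<open>The flag \<open>d\<close> is the direction of the first step, so that all results come with their mirror
  images.\<close>

definition prec :: "bool \<Rightarrow> 'a list \<Rightarrow> 'a \<Rightarrow> 'a \<Rightarrow> bool" where
  "prec d a x y \<longleftrightarrow> (if d then precedes_in a x y else precedes_in a y x)"

lemma prec_Not [simp]: "prec (\<not> d) a x y \<longleftrightarrow> prec d a y x"
  by (simp add: prec_def)

lemma prec_mem: "prec d a x y \<Longrightarrow> x \<in> set a \<and> y \<in> set a"
  by (auto simp: prec_def precedes_in_def split: if_splits)

lemma prec_total: assumes "x \<in> set a" "y \<in> set a" "x \<noteq> y" shows "prec d a x y \<or> prec d a y x"
proof -
  obtain i j where ij: "i < length a" "a ! i = x" "j < length a" "a ! j = y"
    using assms by (auto simp: in_set_conv_nth)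
  then have "i < j \<or> j < i" using assms(3) by (cases i j rule: linorder_cases) auto
  then show ?thesis using ij by (auto simp: prec_def precedes_in_def)
qed

lemma prec_trans:
  assumes "distinct a" "prec d a x y" "prec d a y z"
  shows "prec d a x z"
proof -
  have "precedes_in a u w" if uv: "precedes_in a u v" "precedes_in a v w" for u v w
  proof -
    obtain i j where ij: "i < j" "j < length a" "a ! i = u" "a ! j = v"
      using uv(1) by (auto simp: precedes_in_def)
    obtain i' j' where ij': "i' < j'" "j' < length a" "a ! i' = v" "a ! j' = w"
      using uv(2) by (auto simp: precedes_in_def)
    have "j = i'" using nth_eq_iff_index_eq[OF assms(1)] ij ij' by (metis less_trans)
    then show ?thesis using ij ij' unfolding precedes_in_def by (intro exI[of _ i] exI[of _ j']) auto
  qed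
  then show ?thesis using assms(2,3) by (auto simp: prec_def split: if_splits)
qed

lemma prec_irrefl: "distinct a \<Longrightarrow> \<not> prec d a x x"
  by (auto simp: prec_def precedes_in_def nth_eq_iff_index_eq)

lemma prec_asym: "\<lbrakk>distinct a; prec d a x y\<rbrakk> \<Longrightarrow> \<not> prec d a y x"
  using prec_irrefl prec_trans by metis

text \<open>\<open>v\<close> is already visited and \<open>W\<close> remains to be visited. Removing
  each used arc from \<open>A\<close> turns the global demand for distinct arcs into a local one, so
  that one rule application is one deletion in the later inductions.\<close>

inductive alt :: "bool \<Rightarrow> 'a list set \<Rightarrow> 'a \<Rightarrow> 'a set \<Rightarrow> bool" where
  alt_empty: "alt d A v {}"
| alt_step: "\<lbrakk>w \<in> W; a \<in> A; prec d a v w; alt (\<not> d) (A - {a}) w (W - {w})\<rbrakk> \<Longrightarrow> alt d A v W"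

lemma alt_mono: "alt d A v W \<Longrightarrow> A \<subseteq> B \<Longrightarrow> alt d B v W"
proof (induction arbitrary: B rule: alt.induct)
  case (alt_step w W a A d v)
  have "A - {a} \<subseteq> B - {a}" using alt_step.prems by blast
  with alt_step show ?case by (blast intro: alt.alt_step)
qed (rule alt_empty)

definition origin :: "bool \<Rightarrow> 'a list set \<Rightarrow> 'a set \<Rightarrow> 'a \<Rightarrow> bool" where
  "origin d A V x \<longleftrightarrow> alt d A x (V - {x})"

lemma origin_mono: "origin d A V x \<Longrightarrow> A \<subseteq> B \<Longrightarrow> origin d B V x"
  unfolding origin_def by (rule alt_mono)

lemma origin_step:
  assumes "y \<in> V" "x \<noteq> y" "a \<in> A" "prec d a x y" "origin (\<not> d) (A - {a}) (V - {x}) y"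
  shows "origin d A V x"
  unfolding origin_def
  by (rule alt_step[of y _ a]) (use assms in \<open>auto simp: origin_def\<close>)

text \<open>The condition \<open>even i = d\<close> encodes the alternation: arcs at even positions
  are traversed in direction \<open>d\<close>, those at odd positions against it.\<close>

lemma alt_imp_lists:
  assumes "alt d A v W"
  shows "\<exists>xs as. distinct xs \<and> set xs = W \<and> length as = length xs \<and> distinct as \<and> set as \<subseteq> A \<and>
    (\<forall>i < length as. prec (even i = d) (as ! i) ((v # xs) ! i) (xs ! i))"
  using assms
proof (induction rule: alt.induct)
  case (alt_empty d A v)
  show ?case by (intro exI[of _ "[]"]) auto
next
  case (alt_step w W a A d v)
  then obtain xs as where h: "distinct xs" "set xs = W - {w}" "length as = length xs" "distinct as"
    "set as \<subseteq> A - {a}" "\<forall>i < length as. prec (even i = (\<not> d)) (as ! i) ((w # xs) ! i) (xs ! i)"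
    by auto
  have "prec (even i = d) ((a # as) ! i) ((v # w # xs) ! i) ((w # xs) ! i)" if "i < length (a # as)" for i
  proof (cases i)
    case 0
    then show ?thesis using alt_step.hyps(3) by simp
  next
    case (Suc j)
    have "(even i = d) = (even j = (\<not> d))" using Suc by auto
    then show ?thesis using h(6) that Suc by auto
  qed
  then show ?case using h alt_step.hyps
    by (intro exI[of _ "w # xs"] exI[of _ "a # as"]) auto
qed

lemma origin_imp_path:
  assumes "origin d (arcs H) (verts H) v" "v \<in> verts H" "2 \<le> card (verts H)"
  shows "has_antidirected_hamiltonian_path H"
proof -
  obtain xs as where h: "distinct xs" "set xs = verts H - {v}" "length as = length xs" "distinct as"
    "set as \<subseteq> arcs H" and pr: "\<And>i. i < length as \<Longrightarrow> prec (even i = d) (as ! i) ((v # xs) ! i) (xs ! i)"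
    using alt_imp_lists assms(1) unfolding origin_def by metis
  have "distinct (v # xs)" "set (v # xs) = verts H" using h assms(2) by auto
  then have "length (v # xs) = card (verts H)" by (metis distinct_card)
  moreover have "(precedes_in (as ! (i - 1)) ((v # xs) ! (i - 1)) ((v # xs) ! i) \<and>
         precedes_in (as ! i) ((v # xs) ! (i + 1)) ((v # xs) ! i)) \<or>
        (precedes_in (as ! (i - 1)) ((v # xs) ! i) ((v # xs) ! (i - 1)) \<and>
         precedes_in (as ! i) ((v # xs) ! i) ((v # xs) ! (i + 1)))"
    if i: "0 < i" "i + 1 < length (v # xs)" for i
  proof -
    obtain j where j: "i = Suc j" using i(1) by (cases i) auto
    have "prec (even j = d) (as ! j) ((v # xs) ! j) (xs ! j)"
      "prec (even i = d) (as ! i) ((v # xs) ! i) (xs ! i)" using pr[of j] pr[of i] i j h(3) by auto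
    \<comment> \<open>Arcs \<open>j\<close> and \<open>Suc j\<close> are traversed in opposite
      directions, so the vertex between them is the later one in both or the earlier one in
      both.\<close>
    then show ?thesis using j by (cases "even j = d") (auto simp: prec_def)
  qed
  ultimately have "antidirected_path H (v # xs) as"
    using h \<open>distinct (v # xs)\<close> \<open>set (v # xs) = verts H\<close> assms(3) prec_mem[OF pr]
    unfolding antidirected_path_def by auto
  then show ?thesis unfolding has_antidirected_hamiltonian_path_def
    using \<open>set (v # xs) = verts H\<close> by blast
qed

lemma lists_imp_alt:
  assumes "distinct xs" "v \<notin> set xs" "length as = length xs" "distinct as" "set as \<subseteq> A"
    "\<And>i. i < length as \<Longrightarrow> prec (even i = d) (as ! i) ((v # xs) ! i) (xs ! i)"
  shows "alt d A v (set xs)"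
  using assms
proof (induction xs arbitrary: v as d A)
  case Nil
  then show ?case by (simp add: alt_empty)
next
  case (Cons w xs)
  then obtain a bs where as: "as = a # bs" by (cases as) auto
  have "alt (\<not> d) (A - {a}) w (set xs)"
  proof (rule Cons.IH)
    fix i assume "i < length bs"
    then show "prec (even i = (\<not> d)) (bs ! i) ((w # xs) ! i) (xs ! i)"
      using Cons.prems(6)[of "Suc i"] as by (cases "even i"; cases d) auto
  qed (use Cons.prems as in auto)
  moreover have "prec d a v w" using Cons.prems(6)[of 0] as by auto
  moreover have "set (w # xs) - {w} = set xs" "a \<in> A" using Cons.prems as by auto
  ultimately show ?case by (intro alt.alt_step[of w "set (w # xs)" a A d v]) simp_all
qed

text \<open>The condition at inner vertices leaves a single binary choice, the direction of the
  first arc; every later direction is forced.\<close>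

lemma path_imp_origin:
  assumes "has_antidirected_hamiltonian_path H" "\<forall>a \<in> arcs H. distinct a"
  shows "\<exists>d. \<exists>v \<in> verts H. origin d (arcs H) (verts H) v"
proof -
  obtain ys as where p: "antidirected_path H ys as" "set ys = verts H"
    using assms(1) unfolding has_antidirected_hamiltonian_path_def by blast
  then obtain v xs where ys: "ys = v # xs" by (cases ys) (auto simp: antidirected_path_def)
  note P = p(1)[unfolded antidirected_path_def]
  have len: "length as = length xs" "xs \<noteq> []" using P ys by auto
  define d where "d = prec True (as ! 0) (ys ! 0) (ys ! 1)"
  have "prec (even i = d) (as ! i) (ys ! i) (ys ! Suc i)" if "i < length as" for i
    using that
  proof (induction i)
    case 0
    have "ys ! 0 \<in> set (as ! 0)" "ys ! 1 \<in> set (as ! 0)" "ys ! 0 \<noteq> ys ! 1"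
      using P len 0 ys by (auto simp: nth_eq_iff_index_eq)
    then show ?case using prec_total[of "ys ! 0" "as ! 0" "ys ! 1" True]
      by (auto simp: d_def prec_def)
  next
    case (Suc i)
    have a: "as ! i \<in> arcs H" using P Suc.prems by (meson Suc_lessD nth_mem subsetD)
    have IH: "prec (even i = d) (as ! i) (ys ! i) (ys ! Suc i)" using Suc by simp
    have "(prec True (as ! i) (ys ! i) (ys ! Suc i) \<and> prec True (as ! Suc i) (ys ! Suc (Suc i)) (ys ! Suc i)) \<or>
      (prec True (as ! i) (ys ! Suc i) (ys ! i) \<and> prec True (as ! Suc i) (ys ! Suc i) (ys ! Suc (Suc i)))"
      using P[THEN conjunct2, THEN conjunct2, THEN conjunct2, THEN conjunct2, THEN conjunct2,
        THEN conjunct2, THEN conjunct2, rule_format, of "Suc i"] Suc.prems len ys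
      by (auto simp: prec_def)
    \<comment> \<open>Distinct entries exclude both orders in one arc, so only the alternative that
      reverses the direction after arc \<open>i\<close> survives.\<close>
    moreover have "\<not> (prec True (as ! i) (ys ! i) (ys ! Suc i) \<and> prec True (as ! i) (ys ! Suc i) (ys ! i))"
      using prec_asym a assms(2) by metis
    ultimately show ?case using IH
      by (cases "even i = d") (auto simp: prec_def split: if_splits)
  qed
  then have "alt d (arcs H) v (set xs)"
    using P ys len by (intro lists_imp_alt[where as = as]) auto
  moreover have "set xs = verts H - {v}" using P p(2) ys by auto
  ultimately show ?thesis using p(2) ys unfolding origin_def by auto
qed

text \<open>The arc \<open>f S\<close> may contain more than \<open>S\<close>, since arcs keep the vertices that are deleted later.\<close>

definition covers :: "nat \<Rightarrow> 'a set \<Rightarrow> 'a list set \<Rightarrow> ('a set \<Rightarrow> 'a list) \<Rightarrow> bool" where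
  "covers k V A f \<longleftrightarrow> finite V \<and> inj_on f {S. S \<subseteq> V \<and> card S = k} \<and>
     (\<forall>S. S \<subseteq> V \<longrightarrow> card S = k \<longrightarrow> f S \<in> A \<and> distinct (f S) \<and> S \<subseteq> set (f S))"

lemma coversD:
  assumes "covers k V A f" "S \<subseteq> V" "card S = k"
  shows "f S \<in> A" "distinct (f S)" "S \<subseteq> set (f S)"
  using assms by (simp_all add: covers_def)

lemma covers_finite: "covers k V A f \<Longrightarrow> finite V"
  unfolding covers_def by (rule conjunct1)

lemma covers_inj:
  assumes "covers k V A f" "f S = f S'" "S \<subseteq> V" "card S = k" "S' \<subseteq> V" "card S' = k"
  shows "S = S'"
proof -
  have "inj_on f {S. S \<subseteq> V \<and> card S = k}" using assms(1) unfolding covers_def by (elim conjE)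
  then show ?thesis by (rule inj_onD) (use assms(2-) in simp_all)
qed

lemma covers_total:
  assumes "covers k V A f" "S \<subseteq> V" "card S = k" "x \<in> S" "y \<in> S" "x \<noteq> y"
  shows "prec d (f S) x y \<or> prec d (f S) y x"
  by (rule prec_total) (use coversD(3)[OF assms(1-3)] assms(4-6) in blast)+

lemma covers_subset:
  assumes "covers k V A f" "U \<subseteq> V" "\<And>S. \<lbrakk>S \<subseteq> U; card S = k\<rbrakk> \<Longrightarrow> f S \<in> B"
  shows "covers k U B f"
  unfolding covers_def
proof (intro conjI allI impI)
  show "finite U" by (rule finite_subset[OF assms(2) covers_finite[OF assms(1)]])
  show "inj_on f {S. S \<subseteq> U \<and> card S = k}"
    by (rule inj_onI, rule covers_inj[OF assms(1)]) (use assms(2) in blast)+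
  fix S assume S: "S \<subseteq> U" "card S = k"
  then show "f S \<in> B" by (rule assms(3))
  have "S \<subseteq> V" using S assms(2) by blast
  then show "distinct (f S)" "S \<subseteq> set (f S)" using coversD(2,3)[OF assms(1) _ S(2)] by simp_all
qed

text \<open>Index sets inside \<open>V - {x}\<close> differ from \<open>S\<close>, and injectivity
  of \<open>f\<close> carries the difference over to the arcs. Spending one vertex and one arc thus
  leaves a structure of the same kind.\<close>

lemma covers_delete:
  assumes "covers k V A f" "S \<subseteq> V" "card S = k" "x \<in> S"
  shows "covers k (V - {x}) (A - {f S}) f"
proof (rule covers_subset[OF assms(1)])
  fix S' assume S': "S' \<subseteq> V - {x}" "card S' = k"
  then have "f S' \<noteq> f S" using covers_inj[OF assms(1)] assms(2-4) by blast
  moreover have "f S' \<in> A" using coversD(1)[OF assms(1) _ S'(2)] S'(1) by blast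
  ultimately show "f S' \<in> A - {f S}" by simp
qed auto

text \<open>Uniqueness makes the arc a function of its vertex set. That \<open>f\<close> inverts
  \<open>set\<close> on the arcs is what later turns a pattern in \<open>f\<close> into an
  isomorphism.\<close>

lemma hypertournament_covers:
  assumes "hypertournament k n H"
  obtains f where "covers k (verts H) (arcs H) f" "\<forall>a \<in> arcs H. f (set a) = a"
proof -
  have fin: "finite (verts H)" and arc: "\<forall>a \<in> arcs H. length a = k \<and> distinct a \<and> set a \<subseteq> verts H"
    and uniq: "\<forall>S. S \<subseteq> verts H \<and> card S = k \<longrightarrow> (\<exists>!a. a \<in> arcs H \<and> set a = S)"
    using assms unfolding hypertournament_def by - (elim conjE, assumption)+
  define f where "f S = (THE a. a \<in> arcs H \<and> set a = S)" for S
  have f: "f S \<in> arcs H \<and> set (f S) = S" if "S \<subseteq> verts H" "card S = k" for S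
    unfolding f_def by (rule theI'[OF uniq[rule_format]]) (use that in blast)
  have "covers k (verts H) (arcs H) f"
    unfolding covers_def
  proof (intro conjI allI impI)
    show "finite (verts H)" by (rule fin)
    show "inj_on f {S. S \<subseteq> verts H \<and> card S = k}"
    proof (rule inj_onI)
      fix S S' assume *: "S \<in> {S. S \<subseteq> verts H \<and> card S = k}" "S' \<in> {S. S \<subseteq> verts H \<and> card S = k}"
        "f S = f S'"
      have "set (f S) = S" using f[of S] *(1) by blast
      moreover have "set (f S') = S'" using f[of S'] *(2) by blast
      ultimately show "S = S'" using *(3) by metis
    qed
    fix S assume "S \<subseteq> verts H" "card S = k"
    note S = f[OF this]
    then show "f S \<in> arcs H" "S \<subseteq> set (f S)" by blast+
    show "distinct (f S)" using arc S by blast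
  qed
  moreover have "f (set a) = a" if "a \<in> arcs H" for a
  proof -
    have a: "set a \<subseteq> verts H" "card (set a) = k" using arc that distinct_card by (blast, metis)
    then have "\<exists>!b. b \<in> arcs H \<and> set b = set a" using uniq by blast
    then show ?thesis using f[OF a] that by blast
  qed
  ultimately show ?thesis using that by blast
qed

section \<open>Decision trees\<close>

text \<open>The vertices are numbered, a strictly increasing list \<open>L\<close> names the arc on its elements, and the
  literal \<open>(L, x, y)\<close> says that \<open>x\<close> comes before \<open>y\<close> in that arc. \<open>Walk\<close> lists only the vertices of a
  path; suitable arcs are found among the known literals. \<open>Iso p\<close> maps the exceptional structure with
  arcs \<open>ex\<close> to the present one by \<open>i \<mapsto> p ! i\<close>.\<close>

type_synonym literal = "nat list \<times> nat \<times> nat"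

datatype cert =
    Walk "nat list"
  | Split "nat list" nat nat cert cert
  | Trans "nat list" nat nat nat cert
  | Iso "nat list"

fun walk :: "literal list \<Rightarrow> bool \<Rightarrow> nat list list \<Rightarrow> nat \<Rightarrow> nat list \<Rightarrow> bool" where
  "walk \<Gamma> e used x [] \<longleftrightarrow> True"
| "walk \<Gamma> e used x (y # ys) \<longleftrightarrow>
     list_ex (\<lambda>(L, u, v). u = (if e then x else y) \<and> v = (if e then y else x) \<and>
       \<not> List.member used L \<and> walk \<Gamma> (\<not> e) (L # used) y ys) \<Gamma>"

definition spans :: "nat \<Rightarrow> nat list \<Rightarrow> bool" where
  "spans n xs \<longleftrightarrow> length xs = n \<and> distinct xs \<and> list_all (\<lambda>x. x < n) xs"

definition is_label :: "nat \<Rightarrow> nat \<Rightarrow> nat list \<Rightarrow> bool" where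
  "is_label n k L \<longleftrightarrow> length L = k \<and> sorted_wrt (<) L \<and> list_all (\<lambda>x. x < n) L"

text \<open>\<open>st\<close> lists the admissible start vertices, \<open>ex\<close> the arcs of the
  exceptional structure, and \<open>\<Gamma>\<close> the literals known on the current branch. An
  empty \<open>ex\<close> rejects every \<open>Iso\<close> leaf. Walks always begin with a forward
  step; \<open>sat\<close> supplies the mirror image.\<close>

fun check :: "nat \<Rightarrow> nat \<Rightarrow> nat list \<Rightarrow> nat list list \<Rightarrow> literal list \<Rightarrow> cert \<Rightarrow> bool" where
  "check n k st ex \<Gamma> (Walk xs) \<longleftrightarrow>
     spans n xs \<and> List.member st (hd xs) \<and> walk \<Gamma> True [] (hd xs) (tl xs)"
| "check n k st ex \<Gamma> (Split L x y s t) \<longleftrightarrow>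
     is_label n k L \<and> List.member L x \<and> List.member L y \<and> x \<noteq> y \<and>
     check n k st ex ((L, x, y) # \<Gamma>) s \<and> check n k st ex ((L, y, x) # \<Gamma>) t"
| "check n k st ex \<Gamma> (Trans L x y z t) \<longleftrightarrow>
     List.member \<Gamma> (L, x, y) \<and> List.member \<Gamma> (L, y, z) \<and> check n k st ex ((L, x, z) # \<Gamma>) t"
| "check n k st ex \<Gamma> (Iso p) \<longleftrightarrow> spans n p \<and> ex \<noteq> [] \<and>
     list_all (\<lambda>a. list_all (\<lambda>i. i < n) a \<and>
       successively (\<lambda>x y. List.member \<Gamma> (sort (map ((!) p) a), x, y)) (map ((!) p) a)) ex"

text \<open>Only neighbouring entries of each exceptional arc are compared; transitivity recovers
  the whole order. Demanding \<open>ex \<noteq> []\<close> makes the pattern false for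
  \<open>[]\<close>, so a tree checked against \<open>[]\<close> yields an origin outright.\<close>

definition patterned :: "bool \<Rightarrow> nat \<Rightarrow> nat list list \<Rightarrow> 'a set \<Rightarrow> ('a set \<Rightarrow> 'a list) \<Rightarrow> bool" where
  "patterned d n ex V f \<longleftrightarrow> ex \<noteq> [] \<and> (\<exists>h. bij_betw h {..<n} V \<and>
     (\<forall>a \<in> set ex. set a \<subseteq> {..<n} \<and> successively (prec d (f (h ` set a))) (map h a)))"

text \<open>The direction \<open>d\<close> enters only here: for \<open>d = False\<close> all
  literals are read backwards, so a tree checked once serves both directions.\<close>

definition sat :: "bool \<Rightarrow> nat \<Rightarrow> nat \<Rightarrow> ('a set \<Rightarrow> 'a list) \<Rightarrow> (nat \<Rightarrow> 'a) \<Rightarrow> literal \<Rightarrow> bool" where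
  "sat d n k f g = (\<lambda>(L, x, y). is_label n k L \<and> prec d (f (g ` set L)) (g x) (g y))"

lemma label_image:
  assumes "bij_betw g {..<n} V" "is_label n k L"
  shows "g ` set L \<subseteq> V" "card (g ` set L) = k"
proof -
  have L: "set L \<subseteq> {..<n}" "distinct L" "length L = k"
    using assms(2) by (auto simp: is_label_def list_all_iff strict_sorted_iff)
  then show "g ` set L \<subseteq> V" using assms(1) by (auto simp: bij_betw_def)
  have "inj_on g (set L)" using L(1) assms(1) by (meson bij_betw_def inj_on_subset)
  then show "card (g ` set L) = k" using L by (simp add: card_image distinct_card)
qed

text \<open>Strictly increasing lists name each set once. Hence comparing labels, as
  \<open>walk\<close> does with \<open>used\<close>, is enough to keep the arcs of a path
  distinct.\<close>

lemma label_inj: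
  assumes "covers k V A f" "bij_betw g {..<n} V" "is_label n k L" "is_label n k L'"
    "f (g ` set L) = f (g ` set L')"
  shows "L = L'"
proof -
  have "g ` set L = g ` set L'"
    by (rule covers_inj[OF assms(1,5)]) (use label_image[OF assms(2)] assms(3,4) in blast)+
  moreover have "set L \<subseteq> {..<n}" "set L' \<subseteq> {..<n}"
    using assms(3,4) by (auto simp: is_label_def list_all_iff)
  ultimately have "set L = set L'"
    using assms(2) by (metis bij_betw_def inj_on_image_eq_iff)
  then show ?thesis
    using assms(3,4) by (auto simp: is_label_def intro: strict_sorted_equal)
qed

lemma walk_sound:
  assumes cov: "covers k V A f" and g: "bij_betw g {..<n} V" and \<Gamma>: "\<forall>l \<in> set \<Gamma>. sat d n k f g l"
    and "walk \<Gamma> e used x ys" "distinct (x # ys)" "set (x # ys) \<subseteq> {..<n}" "\<forall>L \<in> set used. is_label n k L"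
  shows "alt (e = d) (A - (\<lambda>L. f (g ` set L)) ` set used) (g x) (g ` set ys)"
  using assms(4-)
proof (induction ys arbitrary: e used x)
  case Nil
  then show ?case by (simp add: alt_empty)
next
  case (Cons y ys)
  obtain L where L: "(L, if e then x else y, if e then y else x) \<in> set \<Gamma>" "L \<notin> set used"
    "walk \<Gamma> (\<not> e) (L # used) y ys"
    using Cons.prems(1) by (auto simp: list_ex_iff)
  have lab: "is_label n k L" and pr: "prec (e = d) (f (g ` set L)) (g x) (g y)"
    using \<Gamma> L(1) by (auto simp: sat_def prec_def split: if_splits)
  have "alt ((\<not> e) = d) (A - (\<lambda>L. f (g ` set L)) ` set (L # used)) (g y) (g ` set ys)"
    by (rule Cons.IH[OF L(3)]) (use Cons.prems lab in auto)
  moreover have "((\<not> e) = d) = (\<not> (e = d))" by blast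
  moreover have "A - (\<lambda>L. f (g ` set L)) ` set (L # used) =
    A - (\<lambda>L. f (g ` set L)) ` set used - {f (g ` set L)}" by auto
  moreover have "g ` set ys = g ` set (y # ys) - {g y}"
  proof -
    have "inj_on g {..<n}" using g by (rule bij_betw_imp_inj_on)
    then have "g ` (set (y # ys) - {y}) = g ` set (y # ys) - g ` {y}"
      by (rule inj_on_image_set_diff) (use Cons.prems(3) in auto)
    moreover have "set (y # ys) - {y} = set ys" using Cons.prems(2) by auto
    ultimately show ?thesis by simp
  qed
  ultimately have rest: "alt (\<not> (e = d)) (A - (\<lambda>L. f (g ` set L)) ` set used - {f (g ` set L)}) (g y)
    (g ` set (y # ys) - {g y})" by (simp only:)
  \<comment> \<open>The arc is still available: \<open>L\<close> is not among the used labels, and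
    different labels name different arcs.\<close>
  have "f (g ` set L) \<in> A - (\<lambda>L. f (g ` set L)) ` set used"
    using label_inj[OF cov g lab] L(2) Cons.prems(4) coversD(1)[OF cov label_image[OF g lab]] by blast
  from alt_step[OF _ this pr rest] show ?case by simp
qed

lemma spans_bij:
  assumes "spans n p"
  shows "bij_betw ((!) p) {..<n} {..<n}" "set p = {..<n}"
proof -
  show "set p = {..<n}"
    by (rule card_subset_eq) (use assms in \<open>auto simp: spans_def list_all_iff distinct_card\<close>)
  then show "bij_betw ((!) p) {..<n} {..<n}"
    by (intro bij_betw_nth) (use assms in \<open>auto simp: spans_def\<close>)
qed

lemma check_sound:
  assumes cov: "covers k V A f" and g: "bij_betw g {..<n} V"
    and "check n k st ex \<Gamma> t" "\<forall>l \<in> set \<Gamma>. sat d n k f g l"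
  shows "(\<exists>x \<in> set st. origin d A V (g x)) \<or> patterned d n ex V f"
  using assms(3,4)
proof (induction t arbitrary: \<Gamma>)
  case (Walk xs)
  show ?case
  proof (cases xs)
    \<comment> \<open>This means \<open>n = 0\<close>. The unspecified vertex \<open>hd []\<close>
      is a member of \<open>st\<close>, and over an empty \<open>V\<close> every vertex is trivially
      an origin.\<close>
    case Nil
    then have "V = {}" using Walk(1) bij_betw_imp_surj_on[OF g] by (simp add: spans_def)
    then show ?thesis using Walk by (auto simp: origin_def alt_empty)
  next
    case (Cons x ys)
    have sp: "distinct (x # ys)" "set (x # ys) = {..<n}"
      using Walk(1) Cons spans_bij(2)[of n xs] by (auto simp: spans_def)
    have "alt d A (g x) (g ` set ys)"
      using walk_sound[OF cov g Walk(2), of True "[]" x ys] Walk(1) Cons sp by auto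
    moreover have "set ys = {..<n} - {x}" using sp by auto
    then have "g ` set ys = g ` {..<n} - g ` {x}"
      using inj_on_image_set_diff[OF bij_betw_imp_inj_on[OF g], of "{..<n}" "{x}"] sp by auto
    then have "g ` set ys = V - {g x}" using bij_betw_imp_surj_on[OF g] by simp
    ultimately show ?thesis using Walk(1) Cons by (auto simp: origin_def)
  qed
next
  case (Split L x y s t)
  have lab: "is_label n k L" using Split.prems by simp
  then have "set L \<subseteq> {..<n}" by (auto simp: is_label_def list_all_iff)
  then have "g x \<noteq> g y"
    using Split.prems bij_betw_imp_inj_on[OF g] by (auto dest: inj_onD)
  then have "prec d (f (g ` set L)) (g x) (g y) \<or> prec d (f (g ` set L)) (g y) (g x)"
    using covers_total[OF cov label_image[OF g lab]] Split.prems by auto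
  then show ?case
  proof
    assume "prec d (f (g ` set L)) (g x) (g y)"
    then show ?thesis using Split.prems lab by (intro Split.IH(1)[of "(L, x, y) # \<Gamma>"]) (auto simp: sat_def)
  next
    assume "prec d (f (g ` set L)) (g y) (g x)"
    then show ?thesis using Split.prems lab by (intro Split.IH(2)[of "(L, y, x) # \<Gamma>"]) (auto simp: sat_def)
  qed
next
  case (Trans L x y z t)
  have s: "sat d n k f g (L, x, y)" "sat d n k f g (L, y, z)" using Trans.prems by auto
  then have "distinct (f (g ` set L))" using coversD(2)[OF cov] label_image[OF g] by (auto simp: sat_def)
  then have "sat d n k f g (L, x, z)" using s prec_trans by (fastforce simp: sat_def)
  then show ?case using Trans.prems by (intro Trans.IH[of "(L, x, z) # \<Gamma>"]) auto
next
  case (Iso p)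
  have p: "bij_betw ((!) p) {..<n} {..<n}" using Iso.prems spans_bij by auto
  have "bij_betw (g \<circ> (!) p) {..<n} V" using bij_betw_trans[OF p g] .
  moreover have "set a \<subseteq> {..<n} \<and> successively (prec d (f ((g \<circ> (!) p) ` set a))) (map (g \<circ> (!) p) a)"
    if "a \<in> set ex" for a
  proof
    show "set a \<subseteq> {..<n}" using Iso.prems that by (auto simp: list_all_iff)
    have "successively (\<lambda>x y. (sort (map ((!) p) a), x, y) \<in> set \<Gamma>) (map ((!) p) a)"
      using Iso.prems that by (auto simp: list_all_iff)
    moreover have "set (sort (map ((!) p) a)) = (!) p ` set a" by simp
    ultimately have "successively (\<lambda>x y. prec d (f (g ` (!) p ` set a)) (g x) (g y)) (map ((!) p) a)"
      using Iso.prems(2) by (elim successively_mono) (auto simp: sat_def)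
    then show "successively (prec d (f ((g \<circ> (!) p) ` set a))) (map (g \<circ> (!) p) a)"
      by (simp add: successively_map image_comp comp_def)
  qed
  ultimately show ?case using Iso.prems unfolding patterned_def by auto
qed

section \<open>Tournaments\<close>

definition arcs_on :: "('a set \<Rightarrow> 'a list) \<Rightarrow> nat \<Rightarrow> 'a set \<Rightarrow> 'a list set" where
  "arcs_on f k U = f ` {S. S \<subseteq> U \<and> card S = k}"

lemma covers_arcs_on:
  assumes "covers k V A f" "U \<subseteq> V"
  shows "covers k U (arcs_on f k U) f"
  by (rule covers_subset[OF assms]) (auto simp: arcs_on_def)

text \<open>Leaving \<open>x\<close> discards all arcs indexed by a set containing \<open>x\<close>,
  not only the one that is used. This wastes arcs but keeps the uniformity \<open>k\<close>, which
  suffices for tournaments and for \<open>k = 3\<close>.\<close>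

lemma step_arcs_on:
  assumes cov: "covers k V A f" and S: "S \<subseteq> V" "card S = k" "x \<in> S" "y \<in> S" "x \<noteq> y" "prec d (f S) x y"
    and "origin (\<not> d) (arcs_on f k (V - {x})) (V - {x}) y"
  shows "origin d A V x"
proof (rule origin_step[of y _ _ "f S"])
  show "y \<in> V" "x \<noteq> y" "f S \<in> A" "prec d (f S) x y" using S coversD(1)[OF cov S(1,2)] by blast+
  have "arcs_on f k (V - {x}) \<subseteq> A - {f S}"
    unfolding arcs_on_def by (rule image_subsetI, rule coversD(1)[OF covers_delete[OF cov S(1-3)]]) simp_all
  then show "origin (\<not> d) (A - {f S}) (V - {x}) y" using origin_mono[OF assms(8)] by simp
qed

text \<open>\<open>v\<close> is inserted in front of the first entry that it is related to, or at
  the end. The clause on \<open>hd ys\<close> keeps the induction going: an earlier entry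
  \<open>x\<close> can be put back in front, since it is related both to \<open>v\<close> and to its
  former successor.\<close>

lemma insert_successively:
  assumes "\<And>y. y \<in> set xs \<Longrightarrow> R v y \<or> R y v" "successively R xs"
  shows "\<exists>ys. set ys = insert v (set xs) \<and> length ys = Suc (length xs) \<and> successively R ys \<and>
    (hd ys = v \<or> xs \<noteq> [] \<and> hd ys = hd xs)"
  using assms
proof (induction xs)
  case Nil
  show ?case by (rule exI[of _ "[v]"]) simp
next
  case (Cons x xs)
  show ?case
  proof (cases "R v x")
    case True
    then show ?thesis using Cons.prems by (intro exI[of _ "v # x # xs"]) simp
  next
    case False
    then have "R x v" using Cons.prems(1)[of x] by simp
    obtain ys where ys: "set ys = insert v (set xs)" "length ys = Suc (length xs)" "successively R ys"
      "hd ys = v \<or> xs \<noteq> [] \<and> hd ys = hd xs"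
      using Cons.IH Cons.prems by (auto simp: successively_Cons)
    have "R x (hd ys)" using ys(4) \<open>R x v\<close> Cons.prems(2) by (auto simp: successively_Cons)
    then show ?thesis using ys by (intro exI[of _ "x # ys"]) (auto simp: successively_Cons)
  qed
qed

text \<open>Redei's theorem, by inserting one vertex at a time.\<close>

lemma hamiltonian_path_exists:
  assumes "finite X" "\<And>x y. \<lbrakk>x \<in> X; y \<in> X; x \<noteq> y\<rbrakk> \<Longrightarrow> R x y \<or> R y x"
  shows "\<exists>xs. distinct xs \<and> set xs = X \<and> successively R xs"
  using assms
proof (induction X rule: finite_induct)
  case empty
  show ?case by (rule exI[of _ "[]"]) simp
next
  case (insert v X)
  then obtain xs where xs: "distinct xs" "set xs = X" "successively R xs" by auto
  have "R v y \<or> R y v" if "y \<in> set xs" for y using insert.prems[of v y] insert.hyps xs that by auto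
  then obtain ys where ys: "set ys = insert v X" "length ys = Suc (length xs)" "successively R ys"
    using insert_successively[of xs R v] xs by auto
  have "distinct ys" by (rule card_distinct) (use ys xs insert.hyps distinct_card[of xs] in simp)
  then show ?case using ys by blast
qed

text \<open>Numbering both \<open>X\<close> and \<open>V - X\<close> along hamiltonian paths provides these literals for free.\<close>

definition chain_lits :: "nat \<Rightarrow> nat \<Rightarrow> literal list" where
  "chain_lits n m = map (\<lambda>i. ([i, Suc i], i, Suc i)) (filter (\<lambda>i. Suc i \<noteq> m) [0..<n - 1])"

text \<open>The claim concerns \<open>X\<close> as a set, so its vertices may be numbered
  \<open>0\<close> to \<open>m - 1\<close> in any order; the start list \<open>[0..<m]\<close>
  therefore stands for \<open>X\<close>.\<close>

lemma tournament_check: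
  assumes cov: "covers 2 V A f" and V: "card V = n" and X: "X \<subseteq> V" "card X = m"
    and chk: "check n 2 [0..<m] ex (chain_lits n m) t"
  shows "(\<exists>x \<in> X. origin d A V x) \<or> patterned d n ex V f"
proof -
  let ?R = "\<lambda>x y. prec d (f {x, y}) x y"
  have fin: "finite V" using cov by (rule covers_finite)
  have tot: "?R x y \<or> ?R y x" if "x \<in> V" "y \<in> V" "x \<noteq> y" for x y
    using covers_total[OF cov, of "{x, y}" x y d] that by (simp add: insert_commute)
  obtain xs where xs: "distinct xs" "set xs = X" "successively ?R xs"
  proof -
    have "?R x y \<or> ?R y x" if "x \<in> X" "y \<in> X" "x \<noteq> y" for x y using tot that X(1) by blast
    from hamiltonian_path_exists[where R = ?R, OF finite_subset[OF X(1) fin] this] show ?thesis using that by blast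
  qed
  obtain ys where ys: "distinct ys" "set ys = V - X" "successively ?R ys"
  proof -
    have "?R x y \<or> ?R y x" if "x \<in> V - X" "y \<in> V - X" "x \<noteq> y" for x y using tot that by blast
    from hamiltonian_path_exists[where R = ?R, OF finite_Diff[OF fin] this] show ?thesis using that by blast
  qed
  define g where "g = (!) (xs @ ys)"
  have lx: "length xs = m" using distinct_card[OF xs(1)] xs(2) X(2) by simp
  have dzs: "distinct (xs @ ys)" "set (xs @ ys) = V" using xs ys X(1) by auto
  then have len: "length (xs @ ys) = n" using V distinct_card[of "xs @ ys"] by simp
  have g: "bij_betw g {..<n} V"
    unfolding g_def by (rule bij_betw_nth) (use dzs len in auto)
  have "\<forall>l \<in> set (chain_lits n m). sat d n 2 f g l"
  proof
    fix l assume "l \<in> set (chain_lits n m)"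
    then obtain i where i: "l = ([i, Suc i], i, Suc i)" "Suc i \<noteq> m" "Suc i < n"
      by (auto simp: chain_lits_def)
    have "?R (g i) (g (Suc i))"
    proof (cases "Suc i < m")
      case True
      then show ?thesis using successively_nth[OF xs(3), of i] lx by (simp add: g_def nth_append)
    next
      \<comment> \<open>Since \<open>Suc i \<noteq> m\<close> excludes the junction of the two
        paths, both vertices lie on \<open>ys\<close>.\<close>
      case False
      then have "Suc i - m = Suc (i - m)" "Suc (i - m) < length ys" using i lx len by auto
      then show ?thesis using successively_nth[OF ys(3), of "i - m"] False lx i(2)
        by (simp add: g_def nth_append)
    qed
    then show "sat d n 2 f g l" using i by (simp add: sat_def is_label_def)
  qed
  from check_sound[OF cov g chk this] show ?thesis
  proof
    assume "\<exists>x \<in> set [0..<m]. origin d A V (g x)"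
    then obtain x where "x < m" "origin d A V (g x)" by auto
    moreover have "g x \<in> X" using \<open>x < m\<close> lx xs(2) by (auto simp: g_def nth_append)
    ultimately show ?thesis by blast
  qed simp
qed

section \<open>Tournaments on three to eight vertices\<close>

definition circulant :: "nat \<Rightarrow> nat list \<Rightarrow> nat list list" where
  "circulant n ss = concat (map (\<lambda>i. map (\<lambda>s. [i, (i + s) mod n]) ss) [0..<n])"

text \<open>The numbering already gives the arcs from 0 to 1 and from 1 to 2. The remaining arc
  either allows the path 0, 2, 1 or closes the directed triangle.\<close>

lemma origin_or_T3:
  assumes "covers 2 V A f" "card V = 3"
  shows "(\<exists>x \<in> V. origin d A V x) \<or> patterned d 3 (circulant 3 [1]) V f"
  by (rule tournament_check[OF assms subset_refl assms(2), where t =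
    "Split [0,2] 0 2 (Walk [0,2,1]) (Iso [0,1,2])"]) code_simp

lemma origin_4:
  assumes "covers 2 V A f" "card V = 4"
  shows "\<exists>x \<in> V. origin d A V x"
proof -
  have "(\<exists>x \<in> V. origin d A V x) \<or> patterned d 4 [] V f"
    by (rule tournament_check[OF assms subset_refl assms(2), where t =
      "Split [0,2] 0 2 (Split [1,3] 1 3 (Walk [0,2,1,3]) (Walk [3,1,0,2])) (Split [0,3] 0 3
     (Walk [2,3,0,1]) (Split [1,3] 1 3 (Walk [1,3,2,0]) (Walk [2,0,3,1])))"]) code_simp
  then show ?thesis by (simp add: patterned_def)
qed

lemma origin_or_T5:
  assumes "covers 2 V A f" "card V = 5"
  shows "(\<exists>x \<in> V. origin d A V x) \<or> patterned d 5 (circulant 5 [1, 2]) V f"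
  by (rule tournament_check[OF assms subset_refl assms(2), where t =
    "Split [1,4] 1 4 (Split [0,2] 0 2 (Walk [0,2,1,4,3]) (Split [0,3] 0 3 (Split [2,4] 2 4
     (Walk [0,3,2,4,1]) (Split [0,4] 0 4 (Walk [1,4,0,3,2]) (Split [1,3] 1 3 (Walk [0,3,1,2,4])
     (Iso [0,3,1,4,2])))) (Walk [1,4,3,0,2]))) (Split [0,3] 0 3 (Walk [2,3,0,1,4]) (Split [0,2] 0 2
     (Split [0,4] 0 4 (Walk [1,2,0,4,3]) (Split [2,4] 2 4 (Split [1,3] 1 3 (Iso [0,1,2,3,4])
     (Walk [0,1,3,4,2])) (Walk [1,2,4,0,3]))) (Split [1,3] 1 3 (Split [0,4] 0 4 (Split [2,4] 2 4
     (Walk [0,4,2,3,1]) (Iso [0,4,1,2,3])) (Walk [1,3,2,0,4])) (Walk [2,0,3,1,4]))))"]) code_simp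

lemma origin_6:
  assumes "covers 2 V A f" "card V = 6"
  shows "\<exists>x \<in> V. origin d A V x"
proof -
  have "(\<exists>x \<in> V. origin d A V x) \<or> patterned d 6 [] V f"
    by (rule tournament_check[OF assms subset_refl assms(2), where t =
      "Split [1,4] 1 4 (Split [0,5] 0 5 (Split [1,3] 1 3 (Split [2,4] 2 4 (Split [0,4] 0 4
     (Walk [1,3,2,4,0,5]) (Split [0,2] 0 2 (Walk [3,4,1,2,0,5]) (Walk [1,3,2,0,4,5])))
     (Walk [0,5,4,2,1,3])) (Split [2,4] 2 4 (Walk [2,4,3,1,0,5]) (Walk [3,1,0,5,4,2])))
     (Split [2,5] 2 5 (Split [0,3] 0 3 (Walk [4,5,2,3,0,1]) (Walk [5,0,3,4,1,2]))
     (Walk [3,4,1,2,5,0]))) (Split [2,5] 2 5 (Walk [0,1,4,5,2,3]) (Split [0,3] 0 3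
     (Walk [2,3,0,1,4,5]) (Split [3,5] 3 5 (Split [0,2] 0 2 (Walk [3,5,4,1,0,2])
     (Walk [2,0,3,5,4,1])) (Split [0,4] 0 4 (Split [2,4] 2 4 (Walk [5,3,2,4,0,1])
     (Walk [0,1,4,2,5,3])) (Split [1,5] 1 5 (Walk [3,0,4,5,1,2]) (Walk [2,3,5,1,4,0]))))))"]) code_simp
  then show ?thesis by (simp add: patterned_def)
qed

text \<open>Five is the number that the 9-vertex case can supply: after deleting its predecessor on
  the path, a vertex with at most two successors has at least five predecessors among the other
  seven vertices.\<close>

lemma five_contain_origin_7:
  assumes "covers 2 V A f" "card V = 7" "X \<subseteq> V" "card X = 5"
  shows "(\<exists>x \<in> X. origin d A V x) \<or> patterned d 7 (circulant 7 [1, 2, 4]) V f"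
  by (rule tournament_check[OF assms, where t =
    "Split [1,4] 1 4 (Split [0,2] 0 2 (Split [3,6] 3 6 (Walk [0,2,1,4,3,6,5]) (Split [0,6] 0 6
     (Walk [3,4,1,2,0,6,5]) (Split [0,5] 0 5 (Split [4,5] 4 5 (Split [1,6] 1 6 (Split [2,5] 2 5
     (Split [4,6] 4 6 (Split [3,5] 3 5 (Walk [0,2,1,6,4,5,3]) (Split [1,3] 1 3 (Walk [0,2,1,3,5,6,4])
     (Split [2,6] 2 6 (Walk [0,5,2,6,1,4,3]) (Split [0,3] 0 3 (Walk [0,3,2,5,4,6,1]) (Split [0,4] 0 4
     (Walk [0,4,1,2,6,3,5]) (Split [1,5] 1 5 (Walk [1,5,2,3,6,0,4]) (Split [2,4] 2 4
     (Iso [0,1,2,4,5,6,3]) (Walk [0,1,5,3,6,2,4])))))))) (Walk [0,5,2,3,6,4,1]))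
     (Walk [0,2,5,6,1,4,3])) (Walk [2,3,6,1,0,5,4])) (Split [1,6] 1 6 (Walk [0,2,1,6,5,4,3])
     (Split [2,5] 2 5 (Split [3,5] 3 5 (Split [2,6] 2 6 (Split [4,6] 4 6 (Split [1,3] 1 3
     (Split [0,4] 0 4 (Walk [0,4,1,3,2,6,5]) (Split [1,5] 1 5 (Walk [0,5,1,3,2,6,4]) (Split [0,3] 0 3
     (Walk [0,3,1,4,5,6,2]) (Split [2,4] 2 4 (Walk [0,1,5,4,2,3,6]) (Iso [0,1,2,3,5,4,6])))))
     (Walk [0,1,3,4,5,6,2])) (Walk [0,1,6,4,3,5,2])) (Walk [0,5,3,4,1,2,6])) (Walk [0,2,1,4,5,3,6]))
     (Walk [3,4,5,2,0,1,6])))) (Split [2,6] 2 6 (Split [0,3] 0 3 (Split [4,5] 4 5 (Split [1,5] 1 5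
     (Walk [4,5,1,2,0,3,6]) (Split [4,6] 4 6 (Walk [2,3,0,1,5,6,4]) (Split [2,4] 2 4
     (Walk [0,1,5,6,2,4,3]) (Split [0,4] 0 4 (Walk [1,4,0,3,2,6,5]) (Split [2,5] 2 5 (Split [1,6] 1 6
     (Split [1,3] 1 3 (Walk [0,3,1,6,2,5,4]) (Split [3,5] 3 5 (Iso [0,1,2,6,3,4,5])
     (Walk [0,2,1,4,6,3,5]))) (Walk [0,1,6,3,2,5,4])) (Walk [0,3,6,4,1,2,5]))))))
     (Walk [0,3,2,6,5,4,1])) (Walk [1,4,3,0,5,6,2])) (Walk [3,4,1,2,6,0,5]))))) (Split [0,3] 0 3
     (Split [0,6] 0 6 (Split [2,5] 2 5 (Split [4,5] 4 5 (Split [1,6] 1 6 (Walk [1,6,0,3,2,5,4])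
     (Walk [4,5,2,3,0,1,6])) (Walk [1,4,5,6,0,3,2])) (Walk [0,6,5,2,1,4,3])) (Split [4,6] 4 6
     (Split [1,5] 1 5 (Split [2,5] 2 5 (Walk [3,4,1,5,2,0,6]) (Split [0,5] 0 5 (Split [2,6] 2 6
     (Walk [1,5,0,3,2,6,4]) (Split [3,5] 3 5 (Walk [0,5,3,4,1,2,6]) (Split [0,4] 0 4
     (Walk [1,4,0,3,5,2,6]) (Split [1,6] 1 6 (Walk [0,3,5,2,1,6,4]) (Split [4,5] 4 5 (Split [1,3] 1 3
     (Walk [0,3,1,2,5,6,4]) (Split [3,6] 3 6 (Split [2,4] 2 4 (Iso [0,1,5,2,3,4,6])
     (Walk [0,1,3,6,4,2,5])) (Walk [0,3,6,2,1,5,4]))) (Walk [0,1,6,2,5,4,3]))))))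
     (Walk [3,4,1,2,5,0,6]))) (Walk [2,3,0,1,5,6,4])) (Split [3,5] 3 5 (Split [2,5] 2 5
     (Walk [1,4,3,5,2,0,6]) (Split [1,5] 1 5 (Walk [1,5,3,4,6,0,2]) (Split [2,6] 2 6 (Split [3,6] 3 6
     (Split [0,5] 0 5 (Split [0,4] 0 4 (Walk [0,4,1,2,5,6,3]) (Split [4,5] 4 5 (Split [1,6] 1 6
     (Walk [0,5,3,4,1,6,2]) (Split [2,4] 2 4 (Walk [0,1,5,6,2,4,3]) (Split [1,3] 1 3
     (Iso [0,1,3,4,5,2,6]) (Walk [0,1,3,6,5,2,4])))) (Walk [0,1,5,4,3,6,2]))) (Walk [1,2,5,0,6,4,3]))
     (Walk [0,3,6,4,1,2,5])) (Walk [0,1,5,2,6,4,3])))) (Walk [1,4,6,0,2,3,5])))) (Split [2,6] 2 6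
     (Walk [1,4,3,0,2,6,5]) (Split [0,6] 0 6 (Split [2,5] 2 5 (Split [0,5] 0 5 (Split [1,6] 1 6
     (Walk [2,0,3,4,1,6,5]) (Split [3,6] 3 6 (Walk [1,4,3,6,0,5,2]) (Split [4,5] 4 5
     (Walk [0,1,6,3,2,5,4]) (Split [3,5] 3 5 (Walk [0,5,3,4,1,2,6]) (Split [4,6] 4 6 (Split [0,4] 0 4
     (Walk [0,4,1,2,6,3,5]) (Split [1,3] 1 3 (Walk [0,6,5,4,1,3,2]) (Split [2,4] 2 4
     (Walk [0,1,6,3,2,4,5]) (Split [1,5] 1 5 (Iso [0,1,5,4,6,2,3]) (Walk [0,1,5,3,6,2,4])))))
     (Walk [0,1,6,4,5,3,2])))))) (Split [4,6] 4 6 (Split [2,4] 2 4 (Split [1,3] 1 3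
     (Walk [1,3,2,0,5,6,4]) (Walk [2,4,3,1,0,6,5])) (Walk [1,2,4,6,5,0,3])) (Walk [1,2,6,4,3,0,5])))
     (Walk [0,6,5,2,1,4,3])) (Split [4,5] 4 5 (Split [2,5] 2 5 (Split [1,6] 1 6
     (Walk [2,0,3,4,1,6,5]) (Split [1,5] 1 5 (Walk [2,5,1,4,3,0,6]) (Split [3,5] 3 5
     (Walk [1,2,6,0,3,5,4]) (Split [1,3] 1 3 (Split [0,4] 0 4 (Split [3,6] 3 6 (Split [2,4] 2 4
     (Walk [0,1,5,6,3,4,2]) (Split [4,6] 4 6 (Split [0,5] 0 5 (Iso [0,1,4,2,5,3,6])
     (Walk [1,2,4,6,3,0,5])) (Walk [0,4,6,1,5,3,2]))) (Walk [0,1,6,3,2,5,4])) (Walk [1,3,2,5,4,0,6]))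
     (Walk [3,1,6,0,2,5,4]))))) (Walk [1,4,3,0,6,2,5])) (Walk [1,2,6,0,3,4,5])))))) (Split [3,5] 3 5
     (Split [2,6] 2 6 (Split [4,5] 4 5 (Split [3,6] 3 6 (Walk [0,1,4,5,3,6,2]) (Split [0,6] 0 6
     (Walk [2,6,0,1,4,5,3]) (Split [0,3] 0 3 (Walk [4,1,0,3,2,6,5]) (Split [2,4] 2 4 (Split [1,5] 1 5
     (Split [4,6] 4 6 (Split [1,3] 1 3 (Split [0,5] 0 5 (Walk [0,5,1,3,2,6,4]) (Split [0,4] 0 4
     (Split [1,6] 1 6 (Walk [0,4,2,3,1,6,5]) (Split [0,2] 0 2 (Split [2,5] 2 5 (Walk [0,1,4,5,2,3,6])
     (Iso [0,1,2,3,4,5,6])) (Walk [1,3,2,0,5,6,4]))) (Walk [1,3,2,6,4,0,5]))) (Walk [0,1,3,4,2,6,5]))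
     (Walk [1,5,3,0,6,4,2])) (Walk [0,1,5,6,2,4,3])) (Walk [1,2,4,5,3,0,6]))))) (Split [1,3] 1 3
     (Split [0,4] 0 4 (Walk [0,4,5,6,2,3,1]) (Split [0,5] 0 5 (Split [4,6] 4 6 (Walk [2,6,4,1,0,5,3])
     (Split [3,6] 3 6 (Walk [2,6,3,5,0,1,4]) (Split [1,5] 1 5 (Split [0,2] 0 2 (Walk [0,2,1,3,6,4,5])
     (Split [1,6] 1 6 (Walk [3,5,1,6,2,0,4]) (Split [2,5] 2 5 (Walk [0,1,6,4,3,5,2]) (Split [2,4] 2 4
     (Walk [0,1,6,3,2,4,5]) (Split [0,3] 0 3 (Walk [0,3,1,2,5,4,6]) (Split [0,6] 0 6
     (Iso [0,1,5,2,6,3,4]) (Walk [1,2,5,4,3,0,6]))))))) (Walk [0,1,5,4,6,3,2]))))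
     (Walk [1,3,2,6,5,0,4]))) (Walk [0,1,3,4,5,6,2]))) (Split [4,6] 4 6 (Split [0,3] 0 3
     (Walk [2,3,0,1,4,6,5]) (Split [2,5] 2 5 (Split [3,6] 3 6 (Walk [0,1,4,6,3,5,2]) (Split [0,5] 0 5
     (Walk [4,1,0,5,2,3,6]) (Split [2,4] 2 4 (Split [1,6] 1 6 (Walk [1,6,5,0,3,4,2]) (Split [4,5] 4 5
     (Walk [0,1,4,5,2,3,6]) (Walk [0,1,6,3,2,4,5]))) (Walk [1,2,4,6,5,0,3])))) (Split [0,4] 0 4
     (Split [1,5] 1 5 (Walk [0,4,3,5,1,2,6]) (Walk [3,4,0,1,5,2,6])) (Walk [1,2,5,6,4,0,3]))))
     (Split [0,5] 0 5 (Walk [0,5,3,4,6,2,1]) (Split [1,5] 1 5 (Split [0,4] 0 4 (Walk [0,4,3,5,1,2,6])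
     (Split [0,2] 0 2 (Walk [0,2,1,5,3,4,6]) (Split [2,5] 2 5 (Split [1,6] 1 6 (Split [0,6] 0 6
     (Split [2,4] 2 4 (Walk [0,6,1,5,2,4,3]) (Split [3,6] 3 6 (Walk [0,6,3,5,1,2,4]) (Split [0,3] 0 3
     (Split [4,5] 4 5 (Walk [0,1,4,5,2,3,6]) (Split [1,3] 1 3 (Walk [0,3,1,2,6,4,5])
     (Iso [0,1,6,2,3,5,4]))) (Walk [1,2,6,4,3,0,5])))) (Walk [1,5,2,0,6,4,3]))
     (Walk [0,1,6,4,3,5,2])) (Split [1,3] 1 3 (Split [3,6] 3 6 (Split [0,6] 0 6 (Split [2,4] 2 4
     (Split [1,6] 1 6 (Walk [0,6,1,5,3,4,2]) (Split [0,3] 0 3 (Split [4,5] 4 5 (Iso [0,1,3,5,6,2,4])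
     (Walk [0,1,6,2,5,4,3])) (Walk [1,2,5,0,3,4,6]))) (Walk [0,1,4,2,5,6,3])) (Walk [1,2,5,0,6,4,3]))
     (Walk [1,3,6,2,5,0,4])) (Walk [0,1,3,4,6,2,5]))))) (Split [0,2] 0 2 (Walk [3,4,6,2,0,1,5])
     (Split [3,6] 3 6 (Split [2,4] 2 4 (Walk [0,1,5,6,3,4,2]) (Split [2,5] 2 5 (Split [1,6] 1 6
     (Split [4,5] 4 5 (Split [0,6] 0 6 (Walk [0,6,1,2,4,5,3]) (Split [1,3] 1 3 (Split [0,4] 0 4
     (Split [0,3] 0 3 (Iso [0,1,3,6,4,2,5]) (Walk [1,2,4,5,3,0,6])) (Walk [1,2,4,0,5,6,3]))
     (Walk [0,1,3,5,4,2,6]))) (Walk [1,6,3,4,5,0,2])) (Walk [0,1,6,4,3,5,2]))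
     (Walk [0,1,4,2,5,6,3]))) (Walk [4,1,5,0,2,3,6]))))))) (Split [4,6] 4 6 (Walk [0,1,4,6,5,3,2])
     (Split [0,6] 0 6 (Walk [2,3,5,6,0,1,4]) (Split [2,6] 2 6 (Split [0,3] 0 3 (Walk [2,6,5,3,0,1,4])
     (Split [0,4] 0 4 (Split [1,5] 1 5 (Split [2,5] 2 5 (Split [3,6] 3 6 (Walk [0,4,3,6,2,5,1])
     (Walk [0,4,6,3,2,5,1])) (Split [3,6] 3 6 (Walk [0,4,3,6,5,2,1]) (Walk [0,4,6,3,5,2,1])))
     (Walk [2,3,5,1,0,4,6])) (Split [1,5] 1 5 (Split [2,5] 2 5 (Split [3,6] 3 6
     (Walk [1,5,2,6,3,0,4]) (Walk [1,5,2,3,6,0,4])) (Split [3,6] 3 6 (Walk [1,2,5,6,3,0,4])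
     (Walk [1,2,5,3,6,0,4]))) (Walk [2,3,5,1,4,0,6])))) (Split [1,5] 1 5 (Split [0,5] 0 5
     (Walk [0,5,1,2,6,4,3]) (Split [0,3] 0 3 (Split [2,5] 2 5 (Split [4,5] 4 5 (Split [0,4] 0 4
     (Walk [1,2,6,4,0,3,5]) (Split [1,6] 1 6 (Split [3,6] 3 6 (Split [0,2] 0 2 (Split [2,4] 2 4
     (Split [1,3] 1 3 (Walk [0,3,1,5,2,4,6]) (Iso [0,1,2,5,3,6,4])) (Walk [0,2,4,5,1,6,3]))
     (Walk [1,5,2,0,6,4,3])) (Walk [0,1,4,5,2,3,6])) (Walk [0,3,2,5,4,1,6]))) (Walk [0,3,5,4,6,2,1]))
     (Walk [1,2,5,0,6,4,3])) (Walk [1,2,6,4,3,0,5]))) (Split [0,2] 0 2 (Walk [3,4,6,2,0,1,5])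
     (Walk [4,1,5,3,2,0,6])))))))"]) code_simp

text \<open>Eight vertices lie beyond the last exception, so no exceptional leaf is allowed. Three
  vertices are what a vertex of out-degree 3 offers as second vertices of a path.\<close>

lemma three_contain_origin_8:
  assumes "covers 2 V A f" "card V = 8" "X \<subseteq> V" "card X = 3"
  shows "\<exists>x \<in> X. origin d A V x"
proof -
  have "(\<exists>x \<in> X. origin d A V x) \<or> patterned d 8 [] V f"
    by (rule tournament_check[OF assms, where t =
      "Split [3,6] 3 6 (Split [2,7] 2 7 (Split [1,5] 1 5 (Split [0,4] 0 4 (Split [2,5] 2 5
     (Split [1,6] 1 6 (Walk [0,4,3,6,1,5,2,7]) (Split [1,3] 1 3 (Split [3,5] 3 5
     (Walk [0,1,6,7,2,5,3,4]) (Split [4,6] 4 6 (Split [0,3] 0 3 (Split [2,6] 2 6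
     (Walk [0,3,1,5,4,6,2,7]) (Split [2,4] 2 4 (Split [1,7] 1 7 (Walk [0,3,1,7,2,5,4,6])
     (Split [5,7] 5 7 (Walk [1,2,6,7,5,3,0,4]) (Walk [0,1,7,5,2,4,3,6]))) (Walk [0,3,1,5,4,2,6,7])))
     (Split [0,6] 0 6 (Split [1,7] 1 7 (Walk [0,6,4,5,2,7,1,3]) (Split [3,7] 3 7
     (Walk [1,5,2,7,3,4,0,6]) (Walk [2,5,4,6,0,1,7,3]))) (Walk [1,5,2,7,6,0,3,4])))
     (Walk [0,4,6,7,2,5,1,3]))) (Walk [0,4,3,1,6,7,2,5]))) (Split [1,7] 1 7 (Walk [0,4,3,6,5,2,1,7])
     (Split [5,7] 5 7 (Walk [2,7,5,6,3,4,0,1]) (Split [2,6] 2 6 (Walk [2,6,3,4,0,1,7,5])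
     (Split [3,7] 3 7 (Walk [0,4,3,7,6,2,1,5]) (Split [3,5] 3 5 (Walk [0,4,3,5,1,2,6,7])
     (Split [4,6] 4 6 (Split [2,4] 2 4 (Walk [2,4,0,1,7,3,5,6]) (Walk [0,1,7,3,5,2,4,6]))
     (Walk [0,1,7,3,5,2,6,4])))))))) (Split [0,6] 0 6 (Split [4,7] 4 7 (Split [2,3] 2 3
     (Split [0,3] 0 3 (Walk [1,5,4,7,2,3,0,6]) (Split [2,5] 2 5 (Walk [1,5,2,7,4,0,3,6])
     (Walk [1,2,5,6,3,0,4,7]))) (Walk [0,6,3,2,1,5,4,7])) (Split [5,7] 5 7 (Split [1,4] 1 4
     (Split [2,5] 2 5 (Walk [0,6,3,4,1,5,2,7]) (Walk [0,6,3,4,1,2,5,7])) (Split [2,4] 2 4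
     (Split [1,3] 1 3 (Split [0,3] 0 3 (Walk [1,3,0,6,5,7,2,4]) (Walk [2,7,5,6,3,0,4,1]))
     (Walk [0,1,3,4,2,7,5,6])) (Split [0,3] 0 3 (Split [2,3] 2 3 (Split [1,3] 1 3 (Split [4,6] 4 6
     (Walk [0,1,4,6,5,7,2,3]) (Split [2,5] 2 5 (Walk [0,3,1,5,2,7,6,4]) (Walk [0,3,1,2,5,7,6,4])))
     (Walk [2,7,5,6,0,1,3,4])) (Walk [0,1,4,2,3,6,5,7])) (Walk [1,2,4,0,3,6,5,7]))))
     (Walk [0,6,3,4,7,5,1,2]))) (Split [2,3] 2 3 (Walk [1,5,4,0,6,7,2,3]) (Split [1,3] 1 3
     (Walk [2,7,6,0,4,5,1,3]) (Split [4,6] 4 6 (Split [0,7] 0 7 (Walk [2,7,0,1,3,6,4,5])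
     (Split [5,7] 5 7 (Split [2,4] 2 4 (Walk [0,1,3,4,2,7,5,6]) (Walk [0,1,3,2,4,6,5,7]))
     (Walk [1,2,3,6,4,0,7,5]))) (Split [0,5] 0 5 (Walk [0,5,1,2,3,4,6,7]) (Split [2,5] 2 5
     (Walk [0,1,3,4,6,7,2,5]) (Split [4,7] 4 7 (Walk [1,2,3,6,5,0,4,7]) (Split [1,7] 1 7
     (Walk [1,7,6,0,5,2,3,4]) (Walk [0,1,7,4,3,2,5,6])))))))))) (Split [2,4] 2 4
     (Walk [0,1,5,6,3,4,2,7]) (Split [0,7] 0 7 (Walk [2,7,0,1,5,6,3,4]) (Split [4,7] 4 7
     (Split [2,3] 2 3 (Split [0,3] 0 3 (Split [4,6] 4 6 (Walk [0,1,5,6,4,7,2,3]) (Split [3,5] 3 5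
     (Split [1,6] 1 6 (Split [0,2] 0 2 (Walk [0,2,1,6,3,5,4,7]) (Walk [1,6,3,5,4,7,2,0]))
     (Walk [2,3,0,1,6,7,4,5])) (Walk [0,1,5,3,2,7,6,4]))) (Split [5,7] 5 7 (Walk [1,2,4,7,5,6,3,0])
     (Walk [1,2,4,5,7,0,3,6]))) (Walk [0,1,5,6,3,2,4,7])) (Split [0,2] 0 2 (Split [5,7] 5 7
     (Split [0,4] 0 4 (Walk [1,2,0,4,3,6,5,7]) (Split [1,4] 1 4 (Walk [0,2,1,4,3,6,5,7])
     (Split [3,7] 3 7 (Walk [0,2,4,1,5,6,3,7]) (Split [2,3] 2 3 (Walk [2,3,7,0,4,1,5,6])
     (Walk [0,1,4,2,3,6,5,7]))))) (Split [0,5] 0 5 (Walk [1,2,0,5,7,4,3,6]) (Split [2,5] 2 5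
     (Split [1,6] 1 6 (Walk [0,2,1,6,3,4,7,5]) (Split [0,6] 0 6 (Walk [1,2,0,6,3,4,7,5])
     (Split [2,6] 2 6 (Walk [2,6,3,4,7,0,5,1]) (Split [3,5] 3 5 (Walk [0,1,6,7,2,5,3,4])
     (Split [2,3] 2 3 (Walk [2,3,5,1,6,0,7,4]) (Walk [0,1,6,2,3,4,7,5]))))))
     (Walk [1,2,5,0,7,4,3,6])))) (Walk [2,0,7,4,3,6,5,1])))))) (Split [0,5] 0 5 (Split [4,7] 4 7
     (Split [2,6] 2 6 (Split [1,3] 1 3 (Split [2,3] 2 3 (Split [0,6] 0 6 (Walk [1,3,2,6,0,5,4,7])
     (Split [1,7] 1 7 (Walk [0,5,4,7,1,3,2,6]) (Split [2,5] 2 5 (Walk [1,3,2,5,4,7,6,0])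
     (Walk [0,1,7,2,5,6,3,4])))) (Split [1,7] 1 7 (Walk [0,5,4,7,1,2,3,6]) (Split [4,6] 4 6
     (Walk [0,1,7,2,3,6,4,5]) (Split [1,5] 1 5 (Walk [0,5,1,2,3,4,6,7]) (Split [5,7] 5 7
     (Walk [0,1,5,7,6,4,3,2]) (Split [1,6] 1 6 (Walk [0,5,7,2,1,6,3,4])
     (Walk [0,1,6,4,3,2,7,5]))))))) (Walk [2,6,3,1,0,5,4,7])) (Split [1,3] 1 3
     (Walk [0,5,4,7,6,2,1,3]) (Split [0,3] 0 3 (Walk [1,2,6,7,4,5,0,3]) (Split [5,7] 5 7
     (Split [2,4] 2 4 (Split [0,4] 0 4 (Walk [2,4,0,1,3,6,5,7]) (Split [2,5] 2 5 (Split [1,6] 1 6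
     (Split [0,6] 0 6 (Walk [2,4,3,1,0,6,5,7]) (Walk [2,5,4,7,6,0,3,1])) (Walk [0,5,2,4,3,1,6,7]))
     (Walk [1,2,5,6,3,0,4,7]))) (Walk [0,1,3,6,5,7,4,2])) (Split [4,6] 4 6 (Walk [0,1,3,6,4,5,7,2])
     (Walk [0,1,3,4,6,2,7,5])))))) (Split [1,5] 1 5 (Walk [0,5,1,2,7,4,3,6])
     (Walk [0,1,5,6,3,4,7,2]))) (Split [0,7] 0 7 (Split [4,7] 4 7 (Split [2,5] 2 5 (Split [1,3] 1 3
     (Split [2,3] 2 3 (Split [1,6] 1 6 (Walk [0,7,4,5,2,3,1,6]) (Walk [0,1,6,7,4,5,2,3]))
     (Split [1,5] 1 5 (Walk [0,7,4,5,1,2,3,6]) (Split [2,4] 2 4 (Walk [2,4,3,6,5,1,0,7])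
     (Walk [0,1,5,6,3,2,4,7])))) (Walk [2,5,4,7,0,1,3,6])) (Split [1,7] 1 7 (Walk [0,7,1,2,5,6,3,4])
     (Walk [0,1,7,2,5,6,3,4]))) (Walk [1,2,7,4,3,6,5,0])) (Walk [1,2,7,0,5,6,3,4]))))
     (Split [2,5] 2 5 (Split [1,4] 1 4 (Split [0,3] 0 3 (Split [2,4] 2 4 (Split [1,7] 1 7
     (Walk [0,3,6,7,1,4,2,5]) (Split [4,7] 4 7 (Walk [2,5,4,7,6,3,0,1]) (Split [3,5] 3 5
     (Split [0,6] 0 6 (Walk [2,5,3,4,7,1,0,6]) (Split [3,7] 3 7 (Walk [1,4,2,5,3,7,6,0])
     (Split [1,5] 1 5 (Walk [1,5,2,4,7,3,6,0]) (Walk [2,4,7,3,0,1,5,6]))))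
     (Walk [2,4,7,1,0,3,5,6])))) (Split [1,7] 1 7 (Walk [0,3,6,7,1,2,4,5]) (Split [4,7] 4 7
     (Walk [2,5,4,7,6,3,0,1]) (Split [2,6] 2 6 (Split [3,5] 3 5 (Walk [0,1,7,4,3,5,2,6])
     (Walk [2,6,5,3,0,1,7,4])) (Split [5,7] 5 7 (Split [3,5] 3 5 (Split [3,7] 3 7 (Split [0,6] 0 6
     (Walk [0,6,5,7,3,4,1,2]) (Walk [1,2,4,5,3,7,6,0])) (Walk [0,1,7,3,6,2,4,5]))
     (Walk [0,3,5,7,6,2,1,4])) (Walk [0,1,7,5,4,2,6,3])))))) (Split [0,5] 0 5 (Split [2,4] 2 4
     (Split [1,3] 1 3 (Walk [0,5,2,4,1,3,6,7]) (Split [1,6] 1 6 (Split [0,6] 0 6 (Split [3,7] 3 7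
     (Walk [1,6,0,5,2,4,3,7]) (Split [5,7] 5 7 (Walk [2,4,3,1,0,6,5,7]) (Walk [0,6,1,4,2,5,7,3])))
     (Split [1,5] 1 5 (Walk [1,5,2,4,3,0,6,7]) (Split [5,7] 5 7 (Walk [2,4,3,0,6,7,5,1])
     (Split [0,7] 0 7 (Walk [1,4,2,5,0,7,6,3]) (Walk [1,4,2,5,7,0,6,3])))))
     (Walk [0,5,2,4,3,1,6,7]))) (Split [1,3] 1 3 (Walk [0,5,4,2,1,3,6,7]) (Split [4,6] 4 6
     (Split [1,7] 1 7 (Walk [0,5,4,2,1,7,6,3]) (Split [3,7] 3 7 (Split [2,6] 2 6
     (Walk [2,6,4,5,0,1,3,7]) (Walk [0,1,3,7,6,2,4,5])) (Split [2,6] 2 6 (Walk [2,6,4,5,0,1,7,3])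
     (Walk [0,1,7,3,6,2,4,5])))) (Walk [2,5,0,1,3,4,6,7])))) (Split [2,6] 2 6 (Split [1,7] 1 7
     (Walk [2,6,5,0,3,4,1,7]) (Split [4,7] 4 7 (Split [1,6] 1 6 (Split [5,7] 5 7
     (Walk [2,6,1,4,3,0,5,7]) (Split [0,7] 0 7 (Split [1,3] 1 3 (Walk [0,7,4,5,2,6,1,3])
     (Split [0,6] 0 6 (Walk [0,6,2,5,7,1,3,4]) (Walk [2,5,4,7,6,0,3,1]))) (Walk [1,4,3,0,7,5,2,6])))
     (Split [2,3] 2 3 (Walk [0,1,6,3,2,5,4,7]) (Split [4,6] 4 6 (Walk [1,2,3,0,5,6,4,7])
     (Split [5,7] 5 7 (Walk [1,2,3,0,5,7,6,4]) (Walk [2,5,7,1,6,4,3,0])))))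
     (Walk [2,6,5,0,3,4,7,1]))) (Split [5,7] 5 7 (Walk [1,2,6,7,5,0,3,4]) (Split [2,7] 2 7
     (Split [1,7] 1 7 (Walk [2,7,1,4,3,0,5,6]) (Split [2,4] 2 4 (Split [1,6] 1 6
     (Walk [1,6,5,0,3,4,2,7]) (Split [3,5] 3 5 (Walk [0,1,6,7,2,4,3,5]) (Walk [1,4,2,7,6,3,5,0])))
     (Walk [0,1,7,5,4,2,6,3]))) (Split [4,7] 4 7 (Split [3,5] 3 5 (Walk [1,2,6,7,4,5,3,0])
     (Split [0,4] 0 4 (Split [3,7] 3 7 (Split [2,4] 2 4 (Split [1,5] 1 5 (Walk [0,4,1,5,7,2,6,3])
     (Walk [2,4,0,1,5,3,6,7])) (Walk [1,2,4,7,3,0,5,6])) (Walk [0,4,1,2,6,3,7,5]))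
     (Walk [1,2,6,3,5,0,4,7]))) (Walk [1,2,7,4,3,0,5,6]))))))) (Split [0,3] 0 3
     (Walk [2,5,4,1,0,3,6,7]) (Split [2,3] 2 3 (Walk [0,1,4,5,2,3,6,7]) (Split [0,7] 0 7
     (Walk [2,5,4,1,0,7,6,3]) (Split [2,7] 2 7 (Walk [0,1,4,5,2,7,6,3]) (Split [4,7] 4 7
     (Split [0,5] 0 5 (Walk [2,5,0,1,4,7,6,3]) (Split [1,6] 1 6 (Walk [1,6,5,0,7,2,3,4])
     (Split [3,7] 3 7 (Walk [2,5,4,1,6,7,3,0]) (Walk [2,5,4,1,6,3,7,0])))) (Split [0,5] 0 5
     (Split [1,6] 1 6 (Split [4,6] 4 6 (Split [3,7] 3 7 (Walk [0,5,4,6,1,2,3,7])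
     (Walk [0,5,4,6,1,2,7,3])) (Split [1,3] 1 3 (Split [0,2] 0 2 (Walk [1,3,6,4,7,2,0,5])
     (Walk [1,3,6,4,7,0,2,5])) (Walk [2,5,0,1,3,4,6,7]))) (Split [3,7] 3 7 (Walk [0,5,4,1,6,7,3,2])
     (Walk [0,5,4,1,6,3,7,2]))) (Walk [1,2,3,4,7,0,5,6])))))))) (Split [4,7] 4 7 (Split [0,5] 0 5
     (Split [2,3] 2 3 (Walk [2,3,6,7,4,5,0,1]) (Split [1,3] 1 3 (Walk [0,5,4,7,6,3,1,2])
     (Split [4,6] 4 6 (Walk [0,1,3,2,5,6,4,7]) (Split [1,5] 1 5 (Walk [0,5,1,2,3,4,6,7])
     (Walk [0,1,5,2,3,4,6,7]))))) (Split [0,4] 0 4 (Split [0,3] 0 3 (Split [1,5] 1 5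
     (Walk [0,3,6,7,4,5,1,2]) (Split [2,4] 2 4 (Split [1,4] 1 4 (Split [3,7] 3 7 (Split [2,6] 2 6
     (Walk [0,1,5,6,2,4,3,7]) (Walk [0,1,5,2,6,7,3,4])) (Split [5,7] 5 7 (Walk [0,3,6,7,5,2,1,4])
     (Split [2,6] 2 6 (Split [1,6] 1 6 (Walk [1,6,2,4,0,3,7,5]) (Walk [2,4,0,1,6,3,7,5]))
     (Walk [0,4,1,2,6,3,7,5])))) (Walk [0,3,6,7,4,1,5,2])) (Walk [0,1,5,2,4,7,6,3])))
     (Split [4,6] 4 6 (Split [2,3] 2 3 (Split [3,7] 3 7 (Walk [1,2,5,0,3,7,4,6]) (Split [1,4] 1 4
     (Split [2,6] 2 6 (Split [1,7] 1 7 (Walk [2,6,5,0,3,4,1,7]) (Walk [0,1,7,3,2,6,4,5]))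
     (Walk [1,4,3,0,5,2,6,7])) (Split [0,7] 0 7 (Walk [2,3,6,7,0,1,4,5]) (Walk [2,3,7,0,5,6,4,1]))))
     (Walk [1,2,3,0,5,6,4,7])) (Walk [1,2,5,0,3,4,6,7]))) (Walk [1,2,5,0,4,7,6,3]))) (Split [3,7] 3 7
     (Split [0,6] 0 6 (Split [1,7] 1 7 (Walk [0,6,5,2,1,7,3,4]) (Split [2,3] 2 3 (Split [3,5] 3 5
     (Split [2,6] 2 6 (Walk [2,6,0,1,7,4,3,5]) (Split [1,4] 1 4 (Walk [0,6,5,2,1,4,3,7])
     (Walk [0,1,4,5,3,7,6,2]))) (Walk [2,3,5,6,0,1,7,4])) (Walk [0,1,7,4,3,2,5,6]))) (Split [0,5] 0 5
     (Split [2,4] 2 4 (Split [1,6] 1 6 (Split [1,5] 1 5 (Split [2,6] 2 6 (Walk [0,5,1,6,2,4,3,7])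
     (Walk [0,5,1,2,6,7,3,4])) (Split [2,6] 2 6 (Walk [0,1,5,6,2,4,3,7]) (Walk [0,1,5,2,6,7,3,4])))
     (Walk [2,4,3,7,6,1,0,5])) (Split [1,3] 1 3 (Walk [0,5,4,2,1,3,6,7]) (Split [2,6] 2 6
     (Split [4,6] 4 6 (Walk [2,6,4,5,0,1,3,7]) (Split [2,7] 2 7 (Walk [2,7,6,4,3,1,0,5])
     (Walk [0,1,3,4,7,2,5,6]))) (Walk [0,1,3,7,6,2,4,5])))) (Walk [1,2,5,0,6,7,3,4])))
     (Split [0,6] 0 6 (Split [1,3] 1 3 (Walk [0,6,5,2,1,3,7,4]) (Split [2,7] 2 7 (Split [5,7] 5 7
     (Walk [2,7,5,6,0,1,3,4]) (Split [2,6] 2 6 (Walk [2,6,0,1,3,4,7,5]) (Split [1,4] 1 4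
     (Walk [0,6,5,2,1,4,7,3]) (Walk [0,1,4,5,7,3,6,2])))) (Walk [0,1,3,4,7,2,5,6]))) (Split [0,5] 0 5
     (Split [2,4] 2 4 (Split [1,6] 1 6 (Split [1,5] 1 5 (Split [2,6] 2 6 (Walk [0,5,1,6,2,4,7,3])
     (Walk [0,5,1,2,6,3,7,4])) (Split [2,6] 2 6 (Walk [0,1,5,6,2,4,7,3]) (Walk [0,1,5,2,6,3,7,4])))
     (Walk [2,4,7,3,6,1,0,5])) (Split [1,7] 1 7 (Walk [0,5,4,2,1,7,6,3]) (Split [2,6] 2 6
     (Split [4,6] 4 6 (Walk [2,6,4,5,0,1,7,3]) (Split [2,3] 2 3 (Walk [2,3,6,4,7,1,0,5])
     (Walk [0,1,7,4,3,2,5,6]))) (Walk [0,1,7,3,6,2,4,5])))) (Walk [1,2,5,0,6,3,7,4]))))))"]) code_simp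
  then show ?thesis by (simp add: patterned_def)
qed


section \<open>Tournaments on at least nine vertices\<close>

definition out :: "bool \<Rightarrow> 'a set \<Rightarrow> ('a set \<Rightarrow> 'a list) \<Rightarrow> 'a \<Rightarrow> 'a set" where
  "out d V f x = {y \<in> V - {x}. prec d (f {x, y}) x y}"

lemma finite_out: "covers 2 V A f \<Longrightarrow> finite (out d V f x)"
  using covers_finite by (fastforce simp: out_def)

lemma card_out:
  assumes "covers 2 V A f" "x \<in> V"
  shows "card V - 1 \<le> card (out d V f x) + card (out (\<not> d) V f x)"
proof -
  have "V - {x} \<subseteq> out d V f x \<union> out (\<not> d) V f x"
    using covers_total[OF assms(1), of "{x, _}" x _ d] assms(2) by (auto simp: out_def)
  then have "card (V - {x}) \<le> card (out d V f x \<union> out (\<not> d) V f x)"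
    by (intro card_mono finite_UnI finite_out[OF assms(1)])
  also have "\<dots> \<le> card (out d V f x) + card (out (\<not> d) V f x)" by (rule card_Un_le)
  finally show ?thesis using assms(2) by simp
qed

lemma tournament_step:
  assumes "covers 2 V A f" "x \<in> V" "y \<in> out d V f x"
    "origin (\<not> d) (arcs_on f 2 (V - {x})) (V - {x}) y"
  shows "origin d A V x"
  by (rule step_arcs_on[OF assms(1), of "{x, y}" _ y]) (use assms in \<open>auto simp: out_def\<close>)

text \<open>The path begins \<open>x\<close>, \<open>y\<close>, \<open>w\<close> with
  \<open>y\<close> entered from both sides. Two deletions restore the direction
  \<open>d\<close>.\<close>

lemma tournament_two_steps:
  assumes "covers 2 V A f" "x \<in> V" "y \<in> out d V f x" "w \<in> out (\<not> d) (V - {x}) f y"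
    "origin d (arcs_on f 2 (V - {x} - {y})) (V - {x} - {y}) w"
  shows "origin d A V x"
proof (rule tournament_step[OF assms(1-3)])
  have "covers 2 (V - {x}) (arcs_on f 2 (V - {x})) f" by (rule covers_arcs_on[OF assms(1)]) simp
  then show "origin (\<not> d) (arcs_on f 2 (V - {x})) (V - {x}) y"
    by (rule tournament_step[OF _ _ assms(4)]) (use assms(3,5) in \<open>auto simp: out_def\<close>)
qed

text \<open>Of three successors of \<open>x\<close>, one is an origin in the reverse direction among
  the eight remaining vertices.\<close>

lemma large_out_imp_origin_9:
  assumes cov: "covers 2 V A f" and "card V = 9" "x \<in> V" "3 \<le> card (out d V f x)"
  shows "origin d A V x"
proof -
  obtain X where X: "X \<subseteq> out d V f x" "card X = 3" using assms(4) by (rule obtain_subset_with_card_n)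
  have cov': "covers 2 (V - {x}) (arcs_on f 2 (V - {x})) f" by (rule covers_arcs_on[OF cov]) simp
  obtain y where "y \<in> X" "origin (\<not> d) (arcs_on f 2 (V - {x})) (V - {x}) y"
    using three_contain_origin_8[OF cov', of X] X assms(2,3) by (auto simp: out_def)
  then show ?thesis using tournament_step[OF cov assms(3)] X(1) by blast
qed

text \<open>T_7^c is regular: the shifts 1, 2, 4 lead from every vertex to three different ones. A
  vertex with at most two successors therefore rules out this exception.\<close>

lemma patterned_T7_out:
  assumes cov: "covers 2 V A f" and "patterned d 7 (circulant 7 [1, 2, 4]) V f" "z \<in> V"
  shows "3 \<le> card (out d V f z)"
proof -
  obtain h where h: "bij_betw h {..<7} V"
    and pr: "\<And>a. a \<in> set (circulant 7 [1, 2, 4]) \<Longrightarrow> successively (prec d (f (h ` set a))) (map h a)"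
    using assms(2) by (auto simp: patterned_def)
  obtain i where i: "i < 7" "z = h i" using h assms(3) by (auto simp: bij_betw_def)
  then have i7: "i \<in> {0, 1, 2, 3, 4, 5, 6}" by auto
  have inj: "inj_on h {..<7}" using h by (rule bij_betw_imp_inj_on)
  have o: "h ((i + s) mod 7) \<in> out d V f z" if "s \<in> {1, 2, 4}" for s
  proof -
    have "[i, (i + s) mod 7] \<in> set (circulant 7 [1, 2, 4])"
      using that i(1) by (auto simp: circulant_def)
    from pr[OF this] have "prec d (f {h i, h ((i + s) mod 7)}) (h i) (h ((i + s) mod 7))" by simp
    moreover have "h ((i + s) mod 7) \<in> V" using h by (auto simp: bij_betw_def)
    moreover have "(i + s) mod 7 \<noteq> i" using that i7 by (elim insertE emptyE) simp_all
    then have "h ((i + s) mod 7) \<noteq> h i" using inj i(1) by (auto dest: inj_onD)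
    ultimately show ?thesis using i(2) by (simp add: out_def)
  qed
  have "card ((\<lambda>s. h ((i + s) mod 7)) ` {1, 2, 4}) = card {1, 2, 4 :: nat}"
  proof (rule card_image, rule inj_onI)
    fix s t assume st: "s \<in> {1, 2, 4}" "t \<in> {1, 2, 4}" "h ((i + s) mod 7) = h ((i + t) mod 7)"
    then have "(i + s) mod 7 = (i + t) mod 7" using inj by (auto dest: inj_onD)
    then show "s = t" using st(1,2) i7 by (elim insertE emptyE) simp_all
  qed
  moreover have "card ((\<lambda>s. h ((i + s) mod 7)) ` {1, 2, 4}) \<le> card (out d V f z)"
    by (rule card_mono[OF finite_out[OF cov]]) (use o in blast)
  ultimately show ?thesis by simp
qed

text \<open>If all three fail, each has at most two successors. Two of them serve as the first two
  vertices of a path; the third is there to exclude that the seven vertices left form T_7^c. Two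
  vertices would not suffice.\<close>

lemma three_contain_origin_9:
  assumes cov: "covers 2 V A f" and V: "card V = 9" and X: "X \<subseteq> V" "card X = 3"
  shows "\<exists>x \<in> X. origin d A V x"
proof (rule ccontr)
  assume no: "\<not> ?thesis"
  have small: "card (out d V f x) \<le> 2" if "x \<in> X" for x
    using large_out_imp_origin_9[OF cov V, of x d] no that X(1) by fastforce
  obtain u v z where uvz: "X = {u, v, z}" "u \<noteq> v" "u \<noteq> z" "v \<noteq> z" using X(2) by (auto simp: card_3_iff)
  have "prec d (f {u, v}) u v \<or> prec d (f {u, v}) v u"
    by (rule covers_total[OF cov]) (use uvz X in auto)
  then obtain x y where xy: "{x, y} = {u, v}" "y \<in> out d V f x"
    using uvz X(1) by (auto simp: out_def insert_commute)
  then have xyz: "x \<in> X" "y \<in> X" "z \<in> X" "x \<noteq> y" "z \<noteq> x" "z \<noteq> y"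
    using uvz by (auto simp: doubleton_eq_iff)
  let ?V = "V - {x} - {y}"
  have cov1: "covers 2 (V - {x}) (arcs_on f 2 (V - {x})) f" by (rule covers_arcs_on[OF cov]) simp
  have cov2: "covers 2 ?V (arcs_on f 2 ?V) f" by (rule covers_arcs_on[OF cov]) auto
  have fin: "finite V" using cov by (rule covers_finite)
  have "x \<in> V" "y \<in> V - {x}" using xyz X(1) by auto
  then have card2: "card ?V = 7" using V by simp
  have "card (out d (V - {x}) f y) \<le> card (out d V f y)"
    by (rule card_mono[OF finite_out[OF cov]]) (auto simp: out_def)
  moreover have "card (V - {x}) - 1 \<le> card (out d (V - {x}) f y) + card (out (\<not> d) (V - {x}) f y)"
    by (rule card_out[OF cov1]) (use xyz X(1) in auto)
  \<comment> \<open>\<open>y\<close> has seven neighbours in \<open>V - {x}\<close>, at most two of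
    them in direction \<open>d\<close>.\<close>
  ultimately have "5 \<le> card (out (\<not> d) (V - {x}) f y)"
    using small[OF xyz(2)] V xyz(1) X(1) by (simp add: subset_iff)
  then obtain Y where Y: "Y \<subseteq> out (\<not> d) (V - {x}) f y" "card Y = 5"
    by (rule obtain_subset_with_card_n)
  have "Y \<subseteq> ?V" using Y(1) by (auto simp: out_def)
  from five_contain_origin_7[OF cov2 card2 this Y(2), of d] show False
  proof
    assume "\<exists>w \<in> Y. origin d (arcs_on f 2 ?V) ?V w"
    then have "origin d A V x" using tournament_two_steps[OF cov _ xy(2)] xyz(1) X(1) Y(1) by blast
    then show False using no xyz(1) by blast
  next
    \<comment> \<open>Here the third vertex is used: \<open>z\<close> lies in \<open>?V\<close> and
      has too few successors for T_7^c.\<close>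
    assume "patterned d 7 (circulant 7 [1, 2, 4]) ?V f"
    then have "3 \<le> card (out d ?V f z)" by (rule patterned_T7_out[OF cov2]) (use xyz X(1) in auto)
    also have "\<dots> \<le> card (out d V f z)"
      by (rule card_mono[OF finite_out[OF cov]]) (auto simp: out_def)
    finally show False using small[OF xyz(3)] by simp
  qed
qed

text \<open>If a successor of \<open>x\<close> has three neighbours in the reverse direction, one
  deletion suffices. Otherwise all three successors of \<open>x\<close> have few such neighbours,
  hence many in direction \<open>d\<close>, and two deletions lead to one of them. These two
  deletions must leave at least nine vertices, so 10 has to be a base case besides 9.\<close>

lemma large_out_imp_origin:
  assumes "covers 2 V A f" "9 \<le> card V" "x \<in> V" "3 \<le> card (out d V f x)"
  shows "origin d A V x"
  using assms
proof (induction "card V" arbitrary: V A x d rule: less_induct)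
  case less
  note cov = less.prems(1)
  have fin: "finite V" using cov by (rule covers_finite)
  obtain Y where Y: "Y \<subseteq> out d V f x" "card Y = 3" using less.prems(4) by (rule obtain_subset_with_card_n)
  have YV: "Y \<subseteq> V - {x}" using Y(1) by (auto simp: out_def)
  have cov1: "covers 2 (V - {x}) (arcs_on f 2 (V - {x})) f" by (rule covers_arcs_on[OF cov]) simp
  have card1: "card (V - {x}) = card V - 1" using less.prems(3) by simp
  consider "card V = 9" | "card V = 10" | "11 \<le> card V" using less.prems(2) by linarith
  then show ?case
  proof cases
    case 1
    then show ?thesis using large_out_imp_origin_9[OF cov] less.prems by blast
  next
    case 2
    \<comment> \<open>Nine vertices remain, and there the claim about triples needs no degree
      condition on \<open>Y\<close>.\<close>
    have "\<exists>y \<in> Y. origin (\<not> d) (arcs_on f 2 (V - {x})) (V - {x}) y"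
      by (rule three_contain_origin_9[OF cov1 _ YV Y(2)]) (use 2 card1 in simp)
    then show ?thesis using tournament_step[OF cov less.prems(3)] Y(1) by blast
  next
    case 3
    show ?thesis
    proof (cases "\<exists>y \<in> Y. 3 \<le> card (out (\<not> d) (V - {x}) f y)")
      case True
      then obtain y where y: "y \<in> Y" "3 \<le> card (out (\<not> d) (V - {x}) f y)" by blast
      have "origin (\<not> d) (arcs_on f 2 (V - {x})) (V - {x}) y"
        by (rule less.hyps[OF _ cov1]) (use 3 card1 y YV in auto)
      then show ?thesis using tournament_step[OF cov less.prems(3)] Y(1) y(1) by blast
    next
      case False
      obtain u v where uv: "u \<in> Y" "v \<in> Y" "u \<noteq> v" using Y(2) by (auto simp: card_3_iff)
      have "prec d (f {u, v}) u v \<or> prec d (f {u, v}) v u"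
        by (rule covers_total[OF cov1]) (use uv YV in auto)
      then obtain y w where yw: "{y, w} = {u, v}" "w \<in> out (\<not> d) (V - {x}) f y"
      proof
        assume "prec d (f {u, v}) u v"
        then show ?thesis using that[of v u] uv YV by (auto simp: out_def insert_commute)
      next
        assume "prec d (f {u, v}) v u"
        then show ?thesis using that[of u v] uv YV by (auto simp: out_def insert_commute)
      qed
      then have yw': "y \<in> Y" "w \<in> Y" "y \<noteq> w" using uv by (auto simp: doubleton_eq_iff)
      let ?V = "V - {x} - {y}"
      have cov2: "covers 2 ?V (arcs_on f 2 ?V) f" by (rule covers_arcs_on[OF cov]) auto
      have "y \<in> V - {x}" using yw' YV by blast
      then have card2: "card ?V = card V - 2" using card1 by simp
      \<comment> \<open>At least nine vertices remain, so \<open>w\<close> has at least eight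
        neighbours, at most two of them in the reverse direction; this leaves more than the three
        required.\<close>
      have "card ?V - 1 \<le> card (out d ?V f w) + card (out (\<not> d) ?V f w)"
        by (rule card_out[OF cov2]) (use yw' YV in auto)
      moreover have "card (out (\<not> d) ?V f w) \<le> card (out (\<not> d) (V - {x}) f w)"
        by (rule card_mono[OF finite_out[OF cov1]]) (auto simp: out_def)
      moreover have "card (out (\<not> d) (V - {x}) f w) \<le> 2" using False yw'(2) by fastforce
      ultimately have "3 \<le> card (out d ?V f w)" using 3 card2 by linarith
      then have "origin d (arcs_on f 2 ?V) ?V w"
        by (intro less.hyps[OF _ cov2]) (use 3 card2 yw' YV in auto)
      then show ?thesis using tournament_two_steps[OF cov less.prems(3) _ yw(2)] Y(1) yw'(1) by blast
    qed
  qed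
qed

section \<open>Arcs with at least three vertices\<close>

lemma enumerated_check:
  assumes "covers k V A f" "distinct vs" "set vs = V" "length vs = n"
    "check n k st ex \<Gamma> t" "\<And>l. l \<in> set \<Gamma> \<Longrightarrow> sat d n k f ((!) vs) l"
  shows "(\<exists>x \<in> set st. origin d A V (vs ! x)) \<or> patterned d n ex V f"
proof (rule check_sound[OF assms(1) _ assms(5)])
  show "bij_betw ((!) vs) {..<n} V" by (rule bij_betw_nth) (use assms in auto)
qed (use assms(6) in blast)

text \<open>Used to turn "at most one successor" into two predecessors among three given
  vertices.\<close>

lemma two_outside_of_three:
  assumes "card X = 3" "\<And>p q. \<lbrakk>p \<in> X; q \<in> X; P p; P q\<rbrakk> \<Longrightarrow> p = q"
  obtains p q where "p \<in> X" "q \<in> X" "p \<noteq> q" "\<not> P p" "\<not> P q"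
proof -
  obtain a b c where X: "X = {a, b, c}" "a \<noteq> b" "a \<noteq> c" "b \<noteq> c" using assms(1) by (auto simp: card_3_iff)
  then have "\<not> (P a \<and> P b)" "\<not> (P a \<and> P c)" "\<not> (P b \<and> P c)" using assms(2) by blast+
  then consider "\<not> P a" "\<not> P b" | "\<not> P a" "\<not> P c" | "\<not> P b" "\<not> P c" by blast
  then show ?thesis using that X by cases auto
qed

section \<open>Five vertices with arcs on three or four of them\<close>

lemma two_contain_origin_3_5_aux:
  assumes "covers 3 V A f" "distinct [x, y, u, v, w]" "set [x, y, u, v, w] = V"
    and "prec d (f {x, y, u}) x y"
  shows "origin d A V x \<or> origin d A V y"
proof -
  \<comment> \<open>\<open>x\<close> and \<open>y\<close> have numbers 0 and 1; the start list
    leaves open which of them is the origin. The single initial literal is the assumption on the arc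
    indexed by \<open>{x, y, u}\<close>, to be had by exchanging \<open>x\<close> and
    \<open>y\<close> if necessary.\<close>
  have chk: "check 5 3 [0, 1] [] [([0, 1, 2], 0, 1)]
    (Split [0,2,3] 2 3 (Split [0,3,4] 3 4 (Split [1,2,3] 1 2 (Split [0,1,4] 1 4 (Split [0,1,2] 0 2
     (Walk [0,2,1,4,3]) (Split [0,1,3] 0 3 (Split [1,3,4] 1 4 (Split [0,2,4] 2 4 (Walk [0,3,2,4,1])
     (Split [1,2,4] 2 4 (Walk [0,3,2,4,1]) (Split [2,3,4] 3 4 (Split [0,3,4] 0 3 (Trans [0,3,4] 0 3 4
     (Walk [1,4,0,3,2])) (Walk [1,4,3,0,2])) (Walk [0,3,4,2,1])))) (Trans [0,1,2] 2 0 1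
     (Walk [0,3,2,1,4]))) (Walk [1,4,3,0,2]))) (Split [1,3,4] 3 4 (Split [2,3,4] 3 4
     (Split [0,2,4] 2 4 (Split [1,2,3] 1 3 (Split [0,1,3] 1 3 (Split [0,1,4] 0 4 (Walk [0,4,2,3,1])
     (Split [0,1,2] 0 2 (Split [1,2,4] 1 2 (Split [0,2,4] 0 2 (Trans [0,2,4] 0 2 4
     (Walk [1,2,0,4,3])) (Walk [1,3,2,0,4])) (Walk [0,1,2,4,3])) (Walk [1,3,2,0,4])))
     (Walk [0,1,3,4,2])) (Walk [0,1,3,4,2])) (Split [0,1,4] 0 4 (Split [1,2,4] 1 2 (Split [0,1,2] 1 2
     (Trans [0,1,2] 0 1 2 (Walk [1,2,0,4,3])) (Split [0,1,3] 1 3 (Split [2,3,4] 2 3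
     (Trans [0,1,4] 0 4 1 (Trans [2,3,4] 2 3 4 (Walk [0,1,2,4,3]))) (Walk [0,1,4,2,3]))
     (Walk [0,4,3,1,2]))) (Split [0,1,3] 1 3 (Split [2,3,4] 2 3 (Trans [2,3,4] 2 3 4
     (Walk [0,1,2,4,3])) (Walk [0,1,4,2,3])) (Walk [0,4,3,1,2]))) (Split [0,3,4] 0 3
     (Split [1,2,4] 1 2 (Split [0,1,3] 1 3 (Walk [0,3,1,2,4]) (Split [0,1,2] 1 2 (Trans [0,1,2] 0 1 2
     (Walk [0,2,4,1,3])) (Walk [0,3,2,1,4]))) (Walk [0,3,2,1,4])) (Walk [1,2,4,0,3]))))
     (Walk [0,1,4,3,2])) (Walk [0,1,4,3,2]))) (Split [1,3,4] 3 4 (Split [2,3,4] 3 4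
     (Split [0,2,4] 2 4 (Walk [0,1,2,4,3]) (Split [1,2,4] 2 4 (Walk [0,1,2,4,3]) (Split [2,3,4] 2 4
     (Walk [0,1,2,4,3]) (Split [0,1,4] 1 4 (Split [0,2,4] 0 2 (Trans [2,3,4] 3 4 2
     (Walk [0,2,3,4,1])) (Split [0,1,2] 0 2 (Trans [2,3,4] 3 4 2 (Walk [0,2,3,4,1]))
     (Split [0,1,3] 1 3 (Trans [0,2,4] 4 2 0 (Walk [1,3,2,0,4])) (Trans [2,3,4] 3 4 2
     (Walk [0,1,3,2,4]))))) (Trans [2,3,4] 3 4 2 (Walk [0,1,4,2,3])))))) (Walk [0,1,2,3,4]))
     (Walk [0,1,2,3,4]))) (Split [1,3,4] 1 4 (Split [1,2,4] 1 2 (Split [0,1,4] 1 4 (Split [1,2,3] 1 2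
     (Split [0,2,4] 2 4 (Split [0,1,3] 0 3 (Walk [0,3,2,4,1]) (Split [0,1,2] 0 2 (Split [2,3,4] 3 4
     (Walk [0,2,1,4,3]) (Split [0,2,3] 0 2 (Trans [0,2,3] 0 2 3 (Walk [1,2,0,3,4]))
     (Walk [1,4,2,0,3]))) (Walk [1,4,2,0,3]))) (Split [0,1,3] 0 3 (Walk [0,3,4,2,1])
     (Split [0,3,4] 0 4 (Split [0,1,4] 0 4 (Trans [0,3,4] 0 4 3 (Walk [1,4,0,3,2]))
     (Walk [1,2,4,0,3])) (Walk [1,2,4,0,3])))) (Walk [0,1,2,3,4])) (Walk [0,1,4,3,2]))
     (Walk [0,1,2,3,4])) (Walk [0,1,4,3,2]))) (Split [0,2,4] 2 4 (Split [1,2,3] 1 3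
     (Split [0,1,4] 1 4 (Split [0,1,3] 0 3 (Walk [0,3,1,4,2]) (Split [0,1,2] 0 2 (Split [0,3,4] 3 4
     (Walk [0,2,3,4,1]) (Split [1,3,4] 3 4 (Walk [0,2,3,4,1]) (Split [1,2,4] 2 4 (Split [2,3,4] 2 4
     (Split [0,3,4] 0 3 (Walk [0,3,1,4,2]) (Split [0,2,4] 0 2 (Trans [0,2,4] 0 2 4
     (Walk [1,4,0,2,3])) (Trans [0,3,4] 4 3 0 (Walk [1,3,4,0,2])))) (Walk [0,2,4,3,1]))
     (Walk [0,2,4,3,1])))) (Walk [1,4,2,0,3]))) (Split [1,2,4] 2 4 (Split [2,3,4] 2 4
     (Split [0,3,4] 3 4 (Split [1,2,3] 1 2 (Split [1,2,4] 1 2 (Split [0,1,2] 0 2 (Trans [1,2,4] 1 2 4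
     (Walk [0,2,1,4,3])) (Split [0,1,4] 0 1 (Trans [0,1,2] 2 0 1 (Walk [0,1,2,4,3]))
     (Walk [1,0,2,4,3]))) (Walk [0,1,2,4,3])) (Walk [0,1,2,4,3])) (Split [0,1,4] 0 4
     (Split [0,1,3] 1 3 (Split [1,3,4] 1 3 (Split [1,2,3] 2 3 (Walk [0,1,4,3,2]) (Split [2,3,4] 2 3
     (Walk [0,1,4,3,2]) (Trans [2,3,4] 3 2 4 (Trans [1,2,3] 1 3 2 (Walk [0,4,3,2,1])))))
     (Split [0,1,2] 1 2 (Trans [0,1,2] 0 1 2 (Walk [0,2,3,1,4])) (Walk [0,4,2,1,3])))
     (Split [0,1,2] 1 2 (Trans [0,1,2] 0 1 2 (Walk [0,2,3,1,4])) (Walk [0,4,2,1,3])))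
     (Split [0,2,4] 0 2 (Split [1,3,4] 1 3 (Split [1,2,4] 1 2 (Walk [0,2,1,3,4]) (Split [0,1,3] 1 3
     (Split [1,3,4] 3 4 (Walk [0,1,2,4,3]) (Split [0,2,3] 0 2 (Split [1,2,3] 1 2 (Walk [0,2,1,3,4])
     (Trans [1,2,3] 2 1 3 (Walk [0,1,2,3,4]))) (Walk [1,3,4,0,2]))) (Walk [0,2,3,1,4])))
     (Walk [0,2,3,1,4])) (Walk [1,3,4,0,2])))) (Walk [0,1,4,2,3])) (Walk [0,1,4,2,3])))
     (Split [1,2,4] 2 4 (Split [2,3,4] 2 4 (Split [0,3,4] 3 4 (Walk [0,1,3,4,2]) (Split [1,3,4] 3 4
     (Walk [0,1,3,4,2]) (Split [2,3,4] 3 4 (Walk [0,1,3,4,2]) (Split [0,1,4] 1 4 (Split [0,3,4] 0 3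
     (Trans [2,3,4] 2 4 3 (Walk [0,3,2,4,1])) (Split [0,1,3] 0 3 (Trans [2,3,4] 2 4 3
     (Walk [0,3,2,4,1])) (Split [1,2,4] 1 2 (Trans [0,3,4] 4 3 0 (Walk [1,2,3,0,4]))
     (Trans [2,3,4] 2 4 3 (Walk [0,1,2,3,4]))))) (Trans [2,3,4] 2 4 3 (Walk [0,1,4,3,2]))))))
     (Walk [0,1,3,2,4])) (Walk [0,1,3,2,4]))) (Split [1,2,4] 1 4 (Split [1,3,4] 1 3
     (Split [0,1,4] 1 4 (Split [0,1,3] 1 3 (Split [0,3,4] 3 4 (Split [0,1,2] 0 2 (Walk [0,2,3,4,1])
     (Split [0,2,3] 0 3 (Split [0,1,3] 0 3 (Trans [0,2,3] 0 3 2 (Walk [1,3,0,2,4]))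
     (Walk [1,4,3,0,2])) (Walk [1,4,3,0,2]))) (Split [0,1,2] 0 2 (Walk [0,2,4,3,1])
     (Split [0,2,4] 0 4 (Split [0,1,4] 0 4 (Trans [0,2,4] 0 4 2 (Walk [1,4,0,2,3]))
     (Walk [1,3,4,0,2])) (Walk [1,3,4,0,2])))) (Walk [0,1,3,2,4])) (Walk [0,1,4,2,3]))
     (Walk [0,1,3,2,4])) (Walk [0,1,4,2,3]))))"
    by code_simp
  have "(\<exists>i \<in> set [0, 1]. origin d A V ([x, y, u, v, w] ! i)) \<or> patterned d 5 [] V f"
    by (rule enumerated_check[OF assms(1-3) _ chk])
      (use assms in \<open>auto simp: sat_def is_label_def\<close>)
  then show ?thesis by (simp add: patterned_def)
qed

text \<open>Two successors \<open>p\<close>, \<open>q\<close> of \<open>x\<close> come with third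
  vertices \<open>a\<close>, \<open>b\<close> of the arcs in which \<open>x\<close> precedes them.
  Up to exchanging \<open>p\<close> with \<open>q\<close> and \<open>u\<close> with
  \<open>v\<close>, the pair \<open>(a, b)\<close> is \<open>(q, p)\<close>, \<open>(q, u)\<close>,
  \<open>(u, u)\<close> or \<open>(u, v)\<close>; this lemma and the next three treat these in
  turn.\<close>

lemma two_out_3_5_aux1:
  assumes "covers 3 V A f" "distinct [x, p, q, u, v]" "set [x, p, q, u, v] = V"
    and "prec d (f {x, p, q}) x p" and "prec d (f {x, p, q}) x q"
  shows "origin d A V x"
proof -
  have chk: "check 5 3 [0] [] [([0, 1, 2], 0, 1), ([0, 1, 2], 0, 2)]
    (Split [0,3,4] 3 4 (Split [1,2,3] 1 2 (Split [0,1,4] 1 4 (Walk [0,2,1,4,3]) (Split [0,2,4] 2 4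
     (Split [0,1,3] 1 3 (Split [2,3,4] 3 4 (Split [1,2,4] 1 2 (Split [1,3,4] 3 4 (Split [0,2,3] 2 3
     (Split [1,2,3] 1 3 (Split [1,3,4] 1 3 (Trans [1,3,4] 1 3 4 (Walk [0,2,1,4,3]))
     (Walk [0,1,3,4,2])) (Walk [0,1,3,4,2])) (Split [1,3,4] 1 4 (Walk [0,2,1,4,3])
     (Trans [1,3,4] 3 4 1 (Walk [0,1,3,4,2])))) (Walk [0,2,1,3,4])) (Walk [0,1,2,4,3]))
     (Walk [0,2,1,3,4])) (Walk [0,1,3,4,2])) (Split [0,1,3] 1 3 (Split [1,3,4] 1 3 (Split [2,3,4] 3 4
     (Split [1,3,4] 1 4 (Walk [0,2,1,4,3]) (Trans [1,3,4] 4 1 3 (Walk [0,2,1,3,4])))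
     (Walk [0,2,1,3,4])) (Walk [0,2,4,1,3])) (Walk [0,2,4,1,3])))) (Split [0,2,4] 2 4
     (Walk [0,1,2,4,3]) (Split [0,1,4] 1 4 (Split [0,2,3] 2 3 (Split [1,3,4] 3 4 (Split [1,2,4] 1 2
     (Walk [0,2,1,4,3]) (Split [2,3,4] 3 4 (Split [0,1,3] 1 3 (Split [1,2,3] 2 3 (Split [2,3,4] 2 3
     (Trans [2,3,4] 2 3 4 (Walk [0,1,2,4,3])) (Walk [0,2,3,4,1])) (Walk [0,2,3,4,1]))
     (Split [2,3,4] 2 4 (Walk [0,1,2,4,3]) (Trans [2,3,4] 3 4 2 (Walk [0,1,3,2,4]))))
     (Walk [0,1,2,3,4]))) (Walk [0,1,2,3,4])) (Walk [0,2,3,4,1])) (Split [0,2,3] 2 3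
     (Split [2,3,4] 2 3 (Split [1,3,4] 3 4 (Split [2,3,4] 2 4 (Walk [0,1,2,4,3]) (Trans [2,3,4] 4 2 3
     (Walk [0,1,2,3,4]))) (Walk [0,1,2,3,4])) (Walk [0,1,4,2,3])) (Walk [0,1,4,2,3])))))
     (Split [1,2,4] 1 2 (Split [0,1,3] 1 3 (Walk [0,2,1,3,4]) (Split [0,2,3] 2 3 (Split [0,1,4] 1 4
     (Split [2,3,4] 3 4 (Walk [0,2,1,4,3]) (Split [1,2,3] 1 2 (Split [1,3,4] 3 4 (Walk [0,2,1,4,3])
     (Split [0,2,4] 2 4 (Split [1,2,4] 1 4 (Split [1,3,4] 1 4 (Trans [1,3,4] 1 4 3
     (Walk [0,2,1,3,4])) (Walk [0,1,4,3,2])) (Walk [0,1,4,3,2])) (Split [1,3,4] 1 3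
     (Walk [0,2,1,3,4]) (Trans [1,3,4] 4 3 1 (Walk [0,1,4,3,2]))))) (Walk [0,1,2,3,4])))
     (Walk [0,1,4,3,2])) (Split [0,1,4] 1 4 (Split [1,3,4] 1 4 (Split [2,3,4] 3 4 (Walk [0,2,1,4,3])
     (Split [1,3,4] 1 3 (Walk [0,2,1,3,4]) (Trans [1,3,4] 3 1 4 (Walk [0,2,1,4,3]))))
     (Walk [0,2,3,1,4])) (Walk [0,2,3,1,4])))) (Split [0,2,3] 2 3 (Walk [0,1,2,3,4])
     (Split [0,1,3] 1 3 (Split [0,2,4] 2 4 (Split [1,3,4] 3 4 (Walk [0,1,2,4,3]) (Split [1,2,3] 1 2
     (Walk [0,2,1,3,4]) (Split [2,3,4] 3 4 (Walk [0,1,2,4,3]) (Split [0,1,4] 1 4 (Split [1,2,4] 2 4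
     (Split [2,3,4] 2 4 (Trans [2,3,4] 2 4 3 (Walk [0,1,2,3,4])) (Walk [0,2,4,3,1]))
     (Walk [0,2,4,3,1])) (Split [2,3,4] 2 3 (Walk [0,1,2,3,4]) (Trans [2,3,4] 4 3 2
     (Walk [0,1,4,2,3]))))))) (Walk [0,2,4,3,1])) (Split [0,2,4] 2 4 (Split [2,3,4] 2 4
     (Split [1,3,4] 3 4 (Walk [0,1,2,4,3]) (Split [2,3,4] 2 3 (Walk [0,1,2,3,4]) (Trans [2,3,4] 3 2 4
     (Walk [0,1,2,4,3])))) (Walk [0,1,3,2,4])) (Walk [0,1,3,2,4]))))))"
    by code_simp
  have "(\<exists>i \<in> set [0]. origin d A V ([x, p, q, u, v] ! i)) \<or> patterned d 5 [] V f"
    by (rule enumerated_check[OF assms(1-3) _ chk])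
      (use assms in \<open>auto simp: sat_def is_label_def\<close>)
  then show ?thesis by (simp add: patterned_def)
qed

lemma two_out_3_5_aux2:
  assumes "covers 3 V A f" "distinct [x, p, q, u, v]" "set [x, p, q, u, v] = V"
    and "prec d (f {x, p, q}) x p" and "prec d (f {x, q, u}) x q"
  shows "origin d A V x"
proof -
  have chk: "check 5 3 [0] [] [([0, 1, 2], 0, 1), ([0, 2, 3], 0, 2)]
    (Split [0,3,4] 3 4 (Split [1,2,3] 1 2 (Split [0,1,4] 1 4 (Walk [0,2,1,4,3]) (Split [0,2,4] 2 4
     (Split [0,1,3] 1 3 (Split [2,3,4] 3 4 (Split [1,2,4] 1 2 (Split [1,3,4] 3 4 (Split [0,2,3] 2 3
     (Split [2,3,4] 2 4 (Split [1,2,3] 1 3 (Split [1,3,4] 1 3 (Trans [1,3,4] 1 3 4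
     (Walk [0,2,1,4,3])) (Walk [0,1,3,4,2])) (Walk [0,1,3,4,2])) (Trans [0,2,3] 0 2 3
     (Walk [0,3,1,2,4]))) (Split [1,3,4] 1 4 (Walk [0,2,1,4,3]) (Trans [1,3,4] 3 4 1
     (Walk [0,1,3,4,2])))) (Walk [0,2,1,3,4])) (Walk [0,1,2,4,3])) (Walk [0,2,1,3,4]))
     (Walk [0,1,3,4,2])) (Split [0,1,3] 1 3 (Split [1,3,4] 1 3 (Split [2,3,4] 3 4 (Split [1,3,4] 1 4
     (Walk [0,2,1,4,3]) (Trans [1,3,4] 4 1 3 (Walk [0,2,1,3,4]))) (Walk [0,2,1,3,4]))
     (Walk [0,2,4,1,3])) (Walk [0,2,4,1,3])))) (Split [0,2,4] 2 4 (Walk [0,1,2,4,3])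
     (Split [0,1,4] 1 4 (Split [2,3,4] 2 3 (Split [1,3,4] 3 4 (Split [1,2,4] 1 2 (Walk [0,2,1,4,3])
     (Split [1,2,3] 2 3 (Split [2,3,4] 3 4 (Trans [2,3,4] 2 3 4 (Walk [0,1,2,4,3]))
     (Walk [0,1,2,3,4])) (Walk [0,2,3,4,1]))) (Walk [0,1,2,3,4])) (Walk [0,2,3,4,1]))
     (Split [1,2,4] 2 4 (Walk [0,1,2,4,3]) (Split [0,2,3] 2 3 (Split [2,3,4] 2 3 (Trans [0,2,3] 0 2 3
     (Walk [0,3,2,1,4])) (Walk [0,1,4,2,3])) (Walk [0,1,4,2,3])))))) (Split [1,2,4] 1 2
     (Split [0,1,3] 1 3 (Walk [0,2,1,3,4]) (Split [1,2,3] 1 3 (Walk [0,2,1,3,4]) (Split [0,2,4] 2 4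
     (Split [2,3,4] 3 4 (Walk [0,1,3,4,2]) (Split [0,2,3] 2 3 (Split [0,1,4] 1 4 (Split [1,2,3] 1 2
     (Split [1,3,4] 3 4 (Walk [0,1,3,4,2]) (Split [1,3,4] 1 4 (Trans [1,3,4] 1 4 3
     (Walk [0,2,1,3,4])) (Walk [0,1,4,3,2]))) (Walk [0,1,2,3,4])) (Walk [0,1,4,3,2]))
     (Split [1,3,4] 1 3 (Walk [0,2,1,3,4]) (Split [2,3,4] 2 4 (Split [1,3,4] 3 4 (Walk [0,1,3,4,2])
     (Trans [1,3,4] 4 3 1 (Trans [2,3,4] 2 4 3 (Walk [0,1,4,3,2])))) (Walk [0,1,3,2,4])))))
     (Split [1,3,4] 1 3 (Walk [0,2,1,3,4]) (Split [2,3,4] 2 3 (Split [0,2,3] 2 3 (Trans [0,2,3] 0 2 3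
     (Walk [0,3,4,2,1])) (Walk [0,1,3,2,4])) (Walk [0,1,3,2,4])))))) (Split [1,2,3] 2 3
     (Walk [0,1,2,3,4]) (Split [0,1,3] 1 3 (Split [0,2,4] 2 4 (Split [1,3,4] 3 4 (Walk [0,1,2,4,3])
     (Split [1,2,3] 1 2 (Walk [0,2,1,3,4]) (Split [2,3,4] 2 3 (Walk [0,1,2,3,4]) (Split [2,3,4] 3 4
     (Walk [0,1,2,4,3]) (Trans [2,3,4] 4 3 2 (Walk [0,2,4,3,1])))))) (Walk [0,2,4,3,1]))
     (Split [0,2,4] 2 4 (Split [2,3,4] 2 4 (Split [1,3,4] 3 4 (Walk [0,1,2,4,3]) (Split [2,3,4] 2 3
     (Walk [0,1,2,3,4]) (Trans [2,3,4] 3 2 4 (Walk [0,1,2,4,3])))) (Walk [0,1,3,2,4]))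
     (Walk [0,1,3,2,4]))))))"
    by code_simp
  have "(\<exists>i \<in> set [0]. origin d A V ([x, p, q, u, v] ! i)) \<or> patterned d 5 [] V f"
    by (rule enumerated_check[OF assms(1-3) _ chk])
      (use assms in \<open>auto simp: sat_def is_label_def\<close>)
  then show ?thesis by (simp add: patterned_def)
qed

lemma two_out_3_5_aux3:
  assumes "covers 3 V A f" "distinct [x, p, q, u, v]" "set [x, p, q, u, v] = V"
    and "prec d (f {x, p, u}) x p" and "prec d (f {x, q, u}) x q"
  shows "origin d A V x"
proof -
  have chk: "check 5 3 [0] [] [([0, 1, 3], 0, 1), ([0, 2, 3], 0, 2)]
    (Split [0,3,4] 3 4 (Split [0,1,2] 1 2 (Split [0,1,4] 1 4 (Walk [0,2,1,4,3]) (Split [0,2,4] 2 4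
     (Split [1,2,3] 1 3 (Split [2,3,4] 3 4 (Split [1,2,3] 1 2 (Split [1,2,4] 1 2 (Split [1,3,4] 3 4
     (Split [1,3,4] 1 4 (Walk [0,2,1,4,3]) (Trans [1,3,4] 3 4 1 (Walk [0,1,3,4,2])))
     (Walk [0,2,1,3,4])) (Walk [0,1,2,4,3])) (Walk [0,1,2,4,3])) (Walk [0,2,1,3,4]))
     (Walk [0,1,3,4,2])) (Split [1,2,3] 1 3 (Split [0,1,3] 1 3 (Trans [0,1,3] 0 1 3
     (Walk [0,3,1,2,4])) (Walk [0,2,4,1,3])) (Walk [0,2,4,1,3])))) (Split [0,2,4] 2 4
     (Walk [0,1,2,4,3]) (Split [0,1,4] 1 4 (Split [1,2,3] 2 3 (Split [1,3,4] 3 4 (Split [1,2,3] 1 2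
     (Walk [0,2,1,4,3]) (Split [1,2,4] 1 2 (Walk [0,2,1,4,3]) (Split [2,3,4] 3 4 (Split [2,3,4] 2 4
     (Walk [0,1,2,4,3]) (Trans [2,3,4] 3 4 2 (Walk [0,2,3,4,1]))) (Walk [0,1,2,3,4]))))
     (Walk [0,1,2,3,4])) (Walk [0,2,3,4,1])) (Split [1,2,3] 2 3 (Split [0,2,3] 2 3
     (Trans [0,2,3] 0 2 3 (Walk [0,3,2,1,4])) (Walk [0,1,4,2,3])) (Walk [0,1,4,2,3])))))
     (Split [0,1,2] 1 2 (Split [1,2,3] 1 3 (Walk [0,2,1,3,4]) (Split [2,3,4] 2 3 (Split [0,1,4] 1 4
     (Split [1,3,4] 3 4 (Walk [0,2,1,4,3]) (Split [1,2,4] 1 2 (Split [2,3,4] 3 4 (Walk [0,2,1,4,3])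
     (Split [1,2,3] 1 2 (Split [1,3,4] 1 3 (Walk [0,2,1,3,4]) (Trans [1,3,4] 4 3 1
     (Walk [0,1,4,3,2]))) (Walk [0,1,2,3,4]))) (Walk [0,1,2,3,4]))) (Walk [0,1,4,3,2]))
     (Split [1,2,4] 1 4 (Split [0,1,4] 1 4 (Split [1,3,4] 3 4 (Walk [0,2,1,4,3]) (Split [2,3,4] 3 4
     (Walk [0,2,1,4,3]) (Split [1,3,4] 1 3 (Walk [0,2,1,3,4]) (Trans [1,3,4] 4 3 1
     (Walk [0,2,3,1,4]))))) (Walk [0,2,3,1,4])) (Walk [0,2,3,1,4])))) (Split [1,2,3] 2 3
     (Walk [0,1,2,3,4]) (Split [1,3,4] 1 3 (Split [0,2,4] 2 4 (Split [2,3,4] 3 4 (Walk [0,1,2,4,3])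
     (Split [1,2,4] 1 2 (Walk [0,2,1,3,4]) (Split [1,3,4] 3 4 (Walk [0,1,2,4,3]) (Split [1,2,3] 1 2
     (Walk [0,2,1,3,4]) (Split [2,3,4] 2 3 (Walk [0,1,2,3,4]) (Trans [2,3,4] 4 3 2
     (Walk [0,2,4,3,1]))))))) (Walk [0,2,4,3,1])) (Split [1,2,4] 2 4 (Split [0,2,4] 2 4
     (Split [2,3,4] 3 4 (Walk [0,1,2,4,3]) (Split [1,3,4] 3 4 (Walk [0,1,2,4,3]) (Split [2,3,4] 2 3
     (Walk [0,1,2,3,4]) (Trans [2,3,4] 4 3 2 (Walk [0,1,3,2,4]))))) (Walk [0,1,3,2,4]))
     (Walk [0,1,3,2,4]))))))"
    by code_simp
  have "(\<exists>i \<in> set [0]. origin d A V ([x, p, q, u, v] ! i)) \<or> patterned d 5 [] V f"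
    by (rule enumerated_check[OF assms(1-3) _ chk])
      (use assms in \<open>auto simp: sat_def is_label_def\<close>)
  then show ?thesis by (simp add: patterned_def)
qed

lemma two_out_3_5_aux4:
  assumes "covers 3 V A f" "distinct [x, p, q, u, v]" "set [x, p, q, u, v] = V"
    and "prec d (f {x, p, u}) x p" and "prec d (f {x, q, v}) x q"
  shows "origin d A V x"
proof -
  have chk: "check 5 3 [0] [] [([0, 1, 3], 0, 1), ([0, 2, 4], 0, 2)]
    (Split [0,3,4] 3 4 (Split [0,1,2] 1 2 (Split [0,1,4] 1 4 (Walk [0,2,1,4,3]) (Split [1,2,4] 1 4
     (Walk [0,2,1,4,3]) (Split [0,2,3] 2 3 (Split [2,3,4] 3 4 (Split [1,3,4] 1 4 (Walk [0,2,1,4,3])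
     (Split [1,2,4] 2 4 (Split [1,3,4] 3 4 (Trans [1,3,4] 3 4 1 (Walk [0,1,3,4,2]))
     (Trans [1,2,4] 2 4 1 (Walk [0,1,2,3,4]))) (Split [1,2,3] 1 3 (Split [0,1,3] 1 3
     (Trans [0,1,3] 0 1 3 (Walk [0,3,1,2,4])) (Walk [0,2,4,1,3])) (Walk [0,2,4,1,3]))))
     (Walk [0,1,4,3,2])) (Split [1,3,4] 1 4 (Walk [0,2,1,4,3]) (Split [2,3,4] 2 4 (Split [0,2,4] 2 4
     (Trans [0,2,4] 0 2 4 (Walk [0,4,3,2,1])) (Walk [0,1,4,2,3])) (Walk [0,1,4,2,3]))))))
     (Split [1,2,4] 2 4 (Walk [0,1,2,4,3]) (Split [0,1,4] 1 4 (Split [0,2,3] 2 3 (Split [1,3,4] 3 4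
     (Split [1,2,3] 1 2 (Walk [0,2,1,4,3]) (Split [1,2,4] 1 2 (Walk [0,2,1,4,3]) (Split [2,3,4] 2 4
     (Walk [0,1,2,4,3]) (Split [1,2,3] 2 3 (Split [2,3,4] 3 4 (Trans [2,3,4] 3 4 2
     (Walk [0,2,3,4,1])) (Walk [0,1,2,3,4])) (Trans [1,2,4] 4 2 1 (Walk [0,1,4,2,3]))))))
     (Walk [0,1,2,3,4])) (Walk [0,2,3,4,1])) (Split [1,2,3] 2 3 (Split [0,2,3] 2 3 (Split [1,3,4] 3 4
     (Split [2,3,4] 2 4 (Walk [0,1,2,4,3]) (Split [2,3,4] 3 4 (Trans [2,3,4] 3 4 2
     (Walk [0,1,4,2,3])) (Walk [0,1,2,3,4]))) (Walk [0,1,2,3,4])) (Walk [0,1,4,2,3]))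
     (Walk [0,1,4,2,3]))))) (Split [0,1,2] 1 2 (Split [1,2,3] 1 3 (Walk [0,2,1,3,4])
     (Split [0,2,3] 2 3 (Split [0,1,4] 1 4 (Split [2,3,4] 3 4 (Walk [0,2,1,4,3]) (Split [1,2,4] 1 2
     (Split [1,2,3] 1 2 (Split [1,3,4] 1 3 (Walk [0,2,1,3,4]) (Split [1,2,4] 1 4 (Split [1,3,4] 3 4
     (Walk [0,2,1,4,3]) (Trans [1,3,4] 4 3 1 (Walk [0,1,4,3,2]))) (Trans [1,2,3] 3 1 2
     (Trans [1,2,4] 4 1 2 (Walk [0,1,3,2,4]))))) (Walk [0,1,2,3,4])) (Walk [0,1,2,3,4])))
     (Walk [0,1,4,3,2])) (Split [1,2,4] 1 4 (Split [0,1,4] 1 4 (Split [2,3,4] 3 4 (Walk [0,2,1,4,3])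
     (Split [1,3,4] 1 3 (Walk [0,2,1,3,4]) (Split [1,3,4] 3 4 (Walk [0,2,1,4,3]) (Trans [1,3,4] 4 3 1
     (Walk [0,2,3,1,4]))))) (Walk [0,2,3,1,4])) (Walk [0,2,3,1,4])))) (Split [0,2,3] 2 3
     (Walk [0,1,2,3,4]) (Split [1,2,3] 2 3 (Walk [0,1,2,3,4]) (Split [0,1,4] 1 4 (Split [1,3,4] 3 4
     (Walk [0,2,3,4,1]) (Split [2,3,4] 2 3 (Walk [0,1,2,3,4]) (Split [1,2,3] 1 3 (Split [2,3,4] 3 4
     (Trans [1,2,3] 1 3 2 (Walk [0,2,1,4,3])) (Trans [2,3,4] 4 3 2 (Walk [0,2,4,3,1])))
     (Split [1,2,4] 2 4 (Split [0,2,4] 2 4 (Trans [0,2,4] 0 2 4 (Walk [0,4,2,1,3]))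
     (Walk [0,1,3,2,4])) (Walk [0,1,3,2,4]))))) (Split [2,3,4] 2 3 (Walk [0,1,2,3,4])
     (Split [1,3,4] 1 3 (Split [0,1,3] 1 3 (Trans [0,1,3] 0 1 3 (Walk [0,3,4,1,2]))
     (Walk [0,2,3,1,4])) (Walk [0,2,3,1,4]))))))))"
    by code_simp
  have "(\<exists>i \<in> set [0]. origin d A V ([x, p, q, u, v] ! i)) \<or> patterned d 5 [] V f"
    by (rule enumerated_check[OF assms(1-3) _ chk])
      (use assms in \<open>auto simp: sat_def is_label_def\<close>)
  then show ?thesis by (simp add: patterned_def)
qed

text \<open>There are only five index sets and a path takes four arcs, so almost every arc is needed
  and the tree has to watch which one is left over.\<close>

lemma two_contain_origin_4_5_aux:
  assumes "covers 4 V A f" "distinct [x, y, u, v, w]" "set [x, y, u, v, w] = V"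
    and "prec d (f {x, y, u, v}) x y"
  shows "origin d A V x \<or> origin d A V y"
proof -
  have chk: "check 5 4 [0, 1] [] [([0, 1, 2, 3], 0, 1)]
    (Split [0,1,2,4] 2 4 (Split [0,2,3,4] 3 4 (Split [1,2,3,4] 1 3 (Split [0,1,2,3] 2 3
     (Split [0,1,3,4] 0 4 (Walk [0,4,2,3,1]) (Split [0,1,3,4] 1 3 (Split [0,2,3,4] 0 4
     (Walk [0,4,2,3,1]) (Split [0,1,2,4] 0 2 (Split [0,2,3,4] 2 4 (Trans [0,1,2,4] 0 2 4
     (Walk [0,4,2,3,1])) (Split [0,1,3,4] 3 4 (Trans [0,1,2,4] 0 2 4 (Trans [0,1,3,4] 1 3 4
     (Walk [0,4,1,3,2]))) (Walk [0,2,4,3,1]))) (Walk [1,3,2,0,4]))) (Walk [0,1,3,4,2])))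
     (Split [1,2,3,4] 1 2 (Split [0,1,2,4] 0 4 (Walk [0,4,3,2,1]) (Split [0,1,3,4] 0 4
     (Walk [0,4,3,2,1]) (Split [0,1,2,3] 0 3 (Split [0,1,3,4] 3 4 (Trans [0,1,3,4] 3 4 0
     (Walk [1,2,3,0,4])) (Split [0,2,3,4] 2 4 (Split [0,2,3,4] 0 3 (Trans [0,1,2,3] 0 3 2
     (Walk [1,2,0,3,4])) (Walk [1,2,3,0,4])) (Trans [0,1,2,3] 0 3 2 (Walk [0,2,4,3,1]))))
     (Split [0,2,3,4] 2 3 (Trans [0,1,2,4] 2 4 0 (Walk [1,3,2,0,4])) (Walk [1,2,3,0,4])))))
     (Walk [0,1,2,4,3]))) (Walk [0,1,3,4,2])) (Split [1,2,3,4] 2 3 (Split [0,1,3,4] 1 4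
     (Split [0,1,2,3] 0 3 (Walk [0,3,2,4,1]) (Split [0,2,3,4] 0 3 (Walk [0,3,2,4,1])
     (Split [0,1,2,3] 0 2 (Split [0,1,2,4] 1 2 (Split [0,2,3,4] 0 2 (Split [1,2,3,4] 3 4
     (Walk [0,2,1,4,3]) (Split [0,1,3,4] 0 4 (Trans [0,1,2,4] 1 2 4 (Trans [0,2,3,4] 3 0 2
     (Walk [1,4,0,2,3]))) (Trans [0,1,2,3] 3 0 2 (Walk [1,2,3,0,4])))) (Walk [1,4,2,0,3]))
     (Walk [0,1,2,3,4])) (Walk [1,4,2,0,3])))) (Walk [0,1,4,3,2])) (Split [0,2,3,4] 2 4
     (Split [0,1,3,4] 3 4 (Split [1,2,3,4] 1 3 (Split [0,1,3,4] 0 4 (Trans [0,2,3,4] 2 4 3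
     (Walk [0,4,2,3,1])) (Split [0,1,2,3] 0 2 (Split [0,1,2,4] 1 2 (Walk [0,2,1,3,4])
     (Walk [0,1,2,4,3])) (Trans [0,2,3,4] 2 4 3 (Walk [1,3,2,0,4])))) (Walk [0,1,3,4,2]))
     (Split [1,2,3,4] 1 4 (Split [0,1,3,4] 0 3 (Trans [0,2,3,4] 2 4 3 (Walk [0,3,2,4,1]))
     (Split [0,1,2,3] 0 3 (Trans [0,2,3,4] 2 4 3 (Walk [0,3,2,4,1])) (Split [0,1,2,4] 1 2
     (Trans [0,1,3,4] 4 3 0 (Walk [1,2,3,0,4])) (Trans [0,2,3,4] 2 4 3 (Walk [0,1,2,3,4])))))
     (Trans [0,2,3,4] 2 4 3 (Walk [0,1,4,3,2])))) (Split [0,1,3,4] 1 3 (Split [0,1,2,3] 0 3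
     (Split [1,2,3,4] 2 4 (Split [0,1,2,4] 1 4 (Walk [0,3,1,4,2]) (Walk [0,1,4,2,3]))
     (Split [0,1,2,4] 1 2 (Walk [0,3,1,2,4]) (Split [1,2,3,4] 1 4 (Trans [1,2,3,4] 1 4 2
     (Walk [0,3,1,2,4])) (Walk [0,3,4,1,2])))) (Split [0,1,3,4] 0 1 (Trans [0,1,2,3] 3 0 1
     (Walk [0,1,3,2,4])) (Walk [1,0,3,2,4]))) (Walk [0,1,3,2,4]))))) (Split [0,2,3,4] 2 3
     (Split [0,1,3,4] 3 4 (Split [0,1,2,4] 1 2 (Split [1,2,3,4] 3 4 (Split [0,1,2,3] 0 2
     (Split [0,2,3,4] 3 4 (Split [1,2,3,4] 1 2 (Split [0,1,3,4] 0 4 (Walk [1,2,0,4,3])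
     (Split [0,2,3,4] 0 4 (Walk [1,2,0,4,3]) (Trans [0,2,3,4] 3 4 0 (Walk [1,2,4,0,3]))))
     (Trans [0,2,3,4] 2 3 4 (Walk [0,1,2,4,3]))) (Split [0,1,3,4] 1 3 (Walk [0,2,1,3,4])
     (Split [1,2,3,4] 1 4 (Walk [0,2,1,4,3]) (Walk [0,2,4,1,3])))) (Split [0,2,3,4] 2 4
     (Split [0,1,2,4] 0 1 (Trans [0,1,2,3] 2 0 1 (Walk [0,1,2,4,3])) (Walk [1,0,2,4,3]))
     (Split [1,2,3,4] 2 3 (Split [0,1,2,4] 0 1 (Trans [0,1,2,3] 2 0 1 (Trans [0,2,3,4] 4 2 3
     (Walk [0,1,2,3,4]))) (Trans [0,2,3,4] 4 2 3 (Walk [1,0,2,3,4]))) (Split [0,1,2,4] 1 4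
     (Split [0,1,3,4] 0 3 (Split [1,2,3,4] 2 4 (Walk [0,3,2,4,1]) (Trans [0,2,3,4] 4 2 3
     (Walk [0,3,4,2,1]))) (Walk [1,4,3,0,2])) (Walk [0,1,4,2,3]))))) (Split [0,1,2,3] 0 2
     (Split [0,1,3,4] 1 3 (Walk [0,2,1,3,4]) (Split [0,1,2,4] 1 4 (Split [1,2,3,4] 2 3
     (Split [1,2,3,4] 1 4 (Walk [0,2,1,4,3]) (Walk [0,2,4,1,3])) (Walk [0,1,3,2,4]))
     (Walk [0,1,4,3,2]))) (Split [0,1,2,4] 0 1 (Trans [0,1,2,3] 2 0 1 (Walk [0,1,2,3,4]))
     (Walk [1,0,2,3,4])))) (Split [1,2,3,4] 3 4 (Split [0,2,3,4] 2 4 (Walk [0,1,2,4,3])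
     (Split [1,2,3,4] 2 3 (Trans [0,2,3,4] 4 2 3 (Walk [0,1,2,3,4])) (Trans [0,1,2,4] 4 2 1
     (Walk [0,1,4,2,3])))) (Walk [0,1,2,3,4]))) (Split [1,2,3,4] 1 2 (Split [0,1,2,3] 0 3
     (Walk [0,3,4,2,1]) (Split [0,2,3,4] 0 3 (Walk [0,3,4,2,1]) (Split [1,2,3,4] 2 3
     (Split [0,1,2,3] 0 2 (Trans [1,2,3,4] 1 2 3 (Walk [0,2,4,3,1])) (Split [0,1,2,4] 0 1
     (Trans [0,1,2,3] 2 0 1 (Walk [0,1,2,3,4])) (Walk [1,0,2,3,4]))) (Split [0,1,3,4] 0 1
     (Trans [0,1,2,3] 3 0 1 (Walk [0,1,3,2,4])) (Walk [1,0,3,2,4]))))) (Walk [0,1,2,3,4])))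
     (Split [0,1,3,4] 1 3 (Split [1,2,3,4] 3 4 (Split [0,1,3,4] 1 4 (Split [0,1,2,3] 0 2
     (Walk [0,2,3,4,1]) (Split [0,1,2,4] 0 2 (Walk [0,2,3,4,1]) (Split [0,1,2,3] 0 3
     (Split [0,2,3,4] 0 3 (Trans [0,2,3,4] 0 3 2 (Walk [1,3,0,2,4])) (Walk [1,4,3,0,2]))
     (Walk [1,4,3,0,2])))) (Walk [0,1,4,2,3])) (Split [0,1,2,3] 0 2 (Walk [0,2,4,3,1])
     (Split [0,2,3,4] 0 2 (Walk [0,2,4,3,1]) (Split [0,1,2,4] 0 4 (Split [0,2,3,4] 2 4
     (Split [0,1,2,3] 2 3 (Walk [0,4,2,3,1]) (Split [1,2,3,4] 1 2 (Trans [0,2,3,4] 3 2 4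
     (Walk [0,4,3,2,1])) (Trans [0,1,2,3] 3 2 0 (Trans [0,1,2,3] 3 0 1 (Walk [0,4,2,1,3])))))
     (Trans [0,1,2,4] 0 4 2 (Walk [0,2,4,3,1]))) (Walk [1,3,4,0,2]))))) (Walk [0,1,3,2,4]))))"
    by code_simp
  have "(\<exists>i \<in> set [0, 1]. origin d A V ([x, y, u, v, w] ! i)) \<or> patterned d 5 [] V f"
    by (rule enumerated_check[OF assms(1-3) _ chk])
      (use assms in \<open>auto simp: sat_def is_label_def\<close>)
  then show ?thesis by (simp add: patterned_def)
qed

lemma two_successors_4_5_aux:
  assumes "covers 4 V A f" "distinct [x, p, q, u, v]" "set [x, p, q, u, v] = V"
    and "prec d (f {x, p, q, u}) x p" and "prec d (f {x, p, q, u}) x q"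
  shows "origin d A V x"
proof -
  have chk: "check 5 4 [0] [] [([0, 1, 2, 3], 0, 1), ([0, 1, 2, 3], 0, 2)]
    (Split [0,2,3,4] 2 3 (Split [0,1,3,4] 3 4 (Split [0,1,2,4] 1 2 (Split [0,2,3,4] 3 4
     (Split [1,2,3,4] 1 2 (Split [0,1,2,4] 1 4 (Walk [0,2,1,4,3]) (Split [0,1,3,4] 1 4
     (Walk [0,2,1,4,3]) (Split [1,2,3,4] 3 4 (Trans [0,1,3,4] 3 4 1 (Trans [0,2,3,4] 2 3 4
     (Walk [0,1,3,4,2]))) (Walk [0,1,4,3,2])))) (Trans [0,2,3,4] 2 3 4 (Walk [0,1,2,4,3])))
     (Split [1,2,3,4] 1 3 (Walk [0,2,1,3,4]) (Split [0,2,3,4] 2 4 (Walk [0,1,3,4,2])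
     (Split [0,1,3,4] 1 3 (Walk [0,2,1,3,4]) (Split [1,2,3,4] 1 4 (Walk [0,2,1,4,3])
     (Walk [0,2,4,1,3])))))) (Split [1,2,3,4] 3 4 (Split [0,2,3,4] 2 4 (Walk [0,1,2,4,3])
     (Split [1,2,3,4] 2 3 (Trans [0,2,3,4] 4 2 3 (Walk [0,1,2,3,4])) (Split [0,1,2,4] 1 4
     (Walk [0,2,3,4,1]) (Walk [0,1,4,2,3])))) (Walk [0,1,2,3,4]))) (Split [0,1,2,4] 1 2
     (Split [1,2,3,4] 1 4 (Split [0,2,3,4] 3 4 (Walk [0,2,1,4,3]) (Split [1,2,3,4] 1 2
     (Split [0,1,3,4] 1 3 (Walk [0,2,1,3,4]) (Split [1,2,3,4] 2 3 (Trans [0,1,3,4] 4 3 1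
     (Walk [0,1,4,3,2])) (Split [0,1,2,4] 2 4 (Split [1,2,3,4] 3 4 (Walk [0,1,3,4,2])
     (Trans [0,1,3,4] 4 3 1 (Walk [0,1,4,3,2]))) (Walk [0,1,3,2,4])))) (Walk [0,1,2,3,4])))
     (Walk [0,1,4,3,2])) (Walk [0,1,2,3,4]))) (Split [0,1,2,4] 1 4 (Split [0,1,3,4] 3 4
     (Walk [0,2,3,4,1]) (Split [1,2,3,4] 1 3 (Split [0,2,3,4] 2 4 (Split [0,1,2,4] 1 2
     (Walk [0,2,1,3,4]) (Split [1,2,3,4] 2 3 (Walk [0,1,2,3,4]) (Trans [1,2,3,4] 1 3 2
     (Trans [0,2,3,4] 3 2 4 (Walk [0,2,1,4,3]))))) (Walk [0,2,4,3,1])) (Split [0,1,3,4] 1 4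
     (Split [1,2,3,4] 3 4 (Walk [0,2,3,4,1]) (Split [0,1,2,4] 2 4 (Split [0,2,3,4] 3 4
     (Walk [0,1,3,4,2]) (Trans [0,2,3,4] 4 3 2 (Trans [0,1,3,4] 1 4 3 (Walk [0,2,4,3,1]))))
     (Walk [0,1,3,2,4]))) (Walk [0,2,3,1,4])))) (Split [0,1,3,4] 1 3 (Split [1,2,3,4] 1 3
     (Split [1,2,3,4] 2 4 (Split [0,1,3,4] 3 4 (Split [0,1,2,4] 1 2 (Split [0,2,3,4] 3 4
     (Trans [0,1,3,4] 1 3 4 (Walk [0,2,1,4,3])) (Walk [0,2,1,3,4])) (Walk [0,1,2,4,3]))
     (Split [0,1,2,4] 1 2 (Walk [0,2,1,3,4]) (Split [0,2,3,4] 3 4 (Walk [0,1,2,4,3])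
     (Trans [0,2,3,4] 4 3 2 (Walk [0,2,4,3,1]))))) (Walk [0,1,4,2,3])) (Walk [0,2,3,1,4]))
     (Walk [0,2,3,1,4]))))"
    by code_simp
  have "(\<exists>i \<in> set [0]. origin d A V ([x, p, q, u, v] ! i)) \<or> patterned d 5 [] V f"
    by (rule enumerated_check[OF assms(1-3) _ chk])
      (use assms in \<open>auto simp: sat_def is_label_def\<close>)
  then show ?thesis by (simp add: patterned_def)
qed

lemma two_contain_origin_3_5:
  assumes cov: "covers 3 V A f" and "card V = 5" "x \<in> V" "y \<in> V" "x \<noteq> y"
  shows "origin d A V x \<or> origin d A V y"
proof -
  have "card (V - {x} - {y}) = 3" using assms by simp
  then obtain u v w where uvw: "V - {x} - {y} = {u, v, w}" "u \<noteq> v" "u \<noteq> w" "v \<noteq> w" by (auto simp: card_3_iff)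
  have V: "set [x, y, u, v, w] = V" using uvw(1) assms(3,4) by auto
  have dist: "distinct [x, y, u, v, w]" using uvw assms(5) by auto
  have "prec d (f {x, y, u}) x y \<or> prec d (f {x, y, u}) y x"
    by (rule covers_total[OF cov]) (use V dist in auto)
  then show ?thesis
  proof
    assume "prec d (f {x, y, u}) x y"
    then show ?thesis using two_contain_origin_3_5_aux[OF cov dist V] by blast
  next
    assume "prec d (f {x, y, u}) y x"
    then have "prec d (f {y, x, u}) y x" by (simp add: insert_commute)
    moreover have "distinct [y, x, u, v, w]" "set [y, x, u, v, w] = V" using dist V by auto
    ultimately show ?thesis using two_contain_origin_3_5_aux[OF cov] by blast
  qed
qed

section \<open>Induction for arcs indexed by triples\<close>

text \<open>One arc suffices for a step, so a successor counts as soon as some arc orders the pair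
  this way. A vertex may thus be a successor in both directions.\<close>

definition out3 :: "bool \<Rightarrow> 'a set \<Rightarrow> ('a set \<Rightarrow> 'a list) \<Rightarrow> 'a \<Rightarrow> 'a set" where
  "out3 d V f x = {y \<in> V - {x}. \<exists>z \<in> V - {x, y}. prec d (f {x, y, z}) x y}"

lemma two_out_imp_origin_3_5:
  assumes cov: "covers 3 V A f" and "card V = 5" "x \<in> V" "p \<in> out3 d V f x" "q \<in> out3 d V f x" "p \<noteq> q"
  shows "origin d A V x"
proof -
  have pq: "p \<in> V" "q \<in> V" "p \<noteq> x" "q \<noteq> x" using assms by (auto simp: out3_def)
  then have "card (V - {x} - {p} - {q}) = 2" using assms by simp
  then obtain u v where uv: "V - {x} - {p} - {q} = {u, v}" "u \<noteq> v" by (auto simp: card_2_iff)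
  have V: "V = {x, p, q, u, v}" using uv(1) assms(3) pq by auto
  have dist: "distinct [x, p, q, u, v]" using uv pq assms(6) by auto
  have V': "set [x, p, q, u, v] = V" "set [x, p, q, v, u] = V" "set [x, q, p, u, v] = V"
    "set [x, q, p, v, u] = V" using V by auto
  have dist': "distinct [x, p, q, v, u]" "distinct [x, q, p, u, v]" "distinct [x, q, p, v, u]"
    using dist by auto
  obtain a where a: "a \<in> {q, u, v}" "prec d (f {x, p, a}) x p"
    using assms(4) dist unfolding out3_def V by auto
  obtain b where b: "b \<in> {p, u, v}" "prec d (f {x, q, b}) x q"
    using assms(5) dist unfolding out3_def V by auto
  note aux1 = two_out_3_5_aux1[OF cov] and aux2 = two_out_3_5_aux2[OF cov]
    and aux3 = two_out_3_5_aux3[OF cov] and aux4 = two_out_3_5_aux4[OF cov]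
  have swap: "{x, q, p} = {x, p, q}" by auto
  consider "a = q" "b = p" | "a = q" "b = u" | "a = q" "b = v" | "a = u" "b = p" | "a = v" "b = p"
    | "a = u" "b = u" | "a = v" "b = v" | "a = u" "b = v" | "a = v" "b = u" using a(1) b(1) by auto
  then show ?thesis
  proof cases
    case 1 then show ?thesis using aux1[OF dist V'(1)] a(2) b(2) swap by simp
  next
    case 2 then show ?thesis using aux2[OF dist V'(1)] a(2) b(2) by simp
  next
    case 3 then show ?thesis using aux2[OF dist'(1) V'(2)] a(2) b(2) by simp
  next
    case 4 then show ?thesis using aux2[OF dist'(2) V'(3)] a(2) b(2) by simp
  next
    case 5 then show ?thesis using aux2[OF dist'(3) V'(4)] a(2) b(2) by simp
  next
    case 6 then show ?thesis using aux3[OF dist V'(1)] a(2) b(2) by simp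
  next
    case 7 then show ?thesis using aux3[OF dist'(1) V'(2)] a(2) b(2) by simp
  next
    case 8 then show ?thesis using aux4[OF dist V'(1)] a(2) b(2) by simp
  next
    case 9 then show ?thesis using aux4[OF dist'(1) V'(2)] a(2) b(2) by simp
  qed
qed

text \<open>The two claims feed each other. Two successors give an origin because one of them is a
  reverse origin one vertex down, by the second claim there. The second claim follows from the first
  one on \<open>V - {x}\<close>, applied to \<open>y\<close> in the reverse direction.\<close>

lemma three_uniform:
  assumes "covers 3 V A f" "5 \<le> card V"
  shows "(\<forall>x \<in> V. \<forall>p \<in> out3 d V f x. \<forall>q \<in> out3 d V f x. p \<noteq> q \<longrightarrow> origin d A V x) \<and>
    (\<forall>x \<in> V. \<forall>y \<in> V. x \<noteq> y \<longrightarrow> origin d A V x \<or> origin d A V y)"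
  using assms
proof (induction "card V" arbitrary: V A d rule: less_induct)
  case less
  note cov = less.prems(1)
  show ?case
  proof (cases "card V = 5")
    case True
    then show ?thesis using two_out_imp_origin_3_5[OF cov] two_contain_origin_3_5[OF cov] by blast
  next
    case False
    have fin: "finite V" using cov by (rule covers_finite)
    have cov1: "covers 3 (V - {x}) (arcs_on f 3 (V - {x})) f" for x by (rule covers_arcs_on[OF cov]) simp
    have card1: "card (V - {x}) < card V" "5 \<le> card (V - {x})" if "x \<in> V" for x
      using that False less.prems(2) fin by (simp_all add: card_gt_0_iff)
    have step: "origin d A V x" if "x \<in> V" "y \<in> out3 d V f x"
      "origin (\<not> d) (arcs_on f 3 (V - {x})) (V - {x}) y" for x y
    proof -
      obtain z where z: "y \<in> V - {x}" "z \<in> V - {x, y}" "prec d (f {x, y, z}) x y"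
        using \<open>y \<in> out3 d V f x\<close> by (auto simp: out3_def)
      show ?thesis
        by (rule step_arcs_on[OF cov, of "{x, y, z}" x y]) (use z that in auto)
    qed
    have B: "origin d A V x" if "x \<in> V" "p \<in> out3 d V f x" "q \<in> out3 d V f x" "p \<noteq> q" for x p q
    proof -
      have "p \<in> V - {x}" "q \<in> V - {x}" using that by (auto simp: out3_def)
      then have "origin (\<not> d) (arcs_on f 3 (V - {x})) (V - {x}) p \<or> origin (\<not> d) (arcs_on f 3 (V - {x})) (V - {x}) q"
        using less.hyps[OF card1(1)[OF \<open>x \<in> V\<close>] cov1 card1(2)[OF \<open>x \<in> V\<close>], of "\<not> d"] \<open>p \<noteq> q\<close> by blast
      then show ?thesis using step that by blast
    qed
    have S: "origin d A V x \<or> origin d A V y" if xy: "x \<in> V" "y \<in> V" "x \<noteq> y" and pr: "y \<in> out3 d V f x" for x y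
    proof (rule ccontr)
      assume no: "\<not> ?thesis"
      have one: "p = q" if "p \<in> out3 d V f y" "q \<in> out3 d V f y" for p q
        using B[OF xy(2) that] no by blast
      let ?V = "V - {x}"
      have "3 \<le> card (V - {x} - {y})" using card1(2)[OF xy(1)] xy by simp
      then obtain W where W: "W \<subseteq> V - {x} - {y}" "card W = 3" by (rule obtain_subset_with_card_n)
      \<comment> \<open>\<open>w'\<close> is chosen inside \<open>W\<close>, so the arc indexed by
        \<open>{y, w, w'}\<close> survives the deletion of \<open>x\<close>. If it puts
        \<open>w\<close> before \<open>y\<close> in direction \<open>d\<close>, this is still
        visible in \<open>?V\<close>.\<close>
      have dich: "w \<in> out3 d V f y \<or> w \<in> out3 (\<not> d) ?V f y" if "w \<in> W" for w
      proof -
        obtain w' where w': "w' \<in> W" "w' \<noteq> w" using W(2) \<open>w \<in> W\<close> by (auto simp: card_3_iff)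
        have "w \<noteq> y" "w' \<noteq> y" using W(1) w' that by auto
        then have "prec d (f {y, w, w'}) y w \<or> prec d (f {y, w, w'}) w y"
          by (intro covers_total[OF cov]) (use W(1) w' that xy in auto)
        then show ?thesis using W(1) w' that xy by (auto simp: out3_def)
      qed
      \<comment> \<open>\<open>y\<close> has at most one successor, so two vertices of
        \<open>W\<close> come before it and make it a reverse origin of \<open>?V\<close>; then
        \<open>x\<close> can be left towards \<open>y\<close>.\<close>
      obtain p q where "p \<in> W" "q \<in> W" and pq: "p \<noteq> q" and "p \<notin> out3 d V f y" "q \<notin> out3 d V f y"
        by (rule two_outside_of_three[OF W(2), of "\<lambda>w. w \<in> out3 d V f y"]) (use one in auto)
      then have pq': "p \<in> out3 (\<not> d) ?V f y" "q \<in> out3 (\<not> d) ?V f y" using dich by auto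
      have "origin (\<not> d) (arcs_on f 3 ?V) ?V y"
        using less.hyps[OF card1(1)[OF xy(1)] cov1 card1(2)[OF xy(1)], of "\<not> d"] pq pq' xy by blast
      then show False using step[OF xy(1) pr] no by blast
    qed
    have "origin d A V x \<or> origin d A V y" if xy: "x \<in> V" "y \<in> V" "x \<noteq> y" for x y
    proof -
      have "card (V - {x} - {y}) \<noteq> 0" using card1(2)[OF xy(1)] xy by simp
      then have "V - {x} - {y} \<noteq> {}" by (metis card.empty)
      then obtain z where z: "z \<in> V - {x} - {y}" by blast
      have "prec d (f {x, y, z}) x y \<or> prec d (f {x, y, z}) y x"
        by (rule covers_total[OF cov]) (use z xy in auto)
      then have "y \<in> out3 d V f x \<or> x \<in> out3 d V f y"
        using z xy by (auto simp: out3_def insert_commute)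
      then show ?thesis using S xy by blast
    qed
    then show ?thesis using B by blast
  qed
qed

section \<open>Induction for arcs indexed by sets of at least four vertices\<close>

lemma two_contain_origin_4_5:
  assumes cov: "covers 4 V A f" and "card V = 5" "x \<in> V" "y \<in> V" "x \<noteq> y"
  shows "origin d A V x \<or> origin d A V y"
proof -
  have "card (V - {x} - {y}) = 3" using assms by simp
  then obtain u v w where uvw: "V - {x} - {y} = {u, v, w}" "u \<noteq> v" "u \<noteq> w" "v \<noteq> w" by (auto simp: card_3_iff)
  have V: "set [x, y, u, v, w] = V" using uvw(1) assms(3,4) by auto
  have dist: "distinct [x, y, u, v, w]" using uvw assms(5) by auto
  have "prec d (f {x, y, u, v}) x y \<or> prec d (f {x, y, u, v}) y x"
    by (rule covers_total[OF cov]) (use V dist in auto)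
  then show ?thesis
  proof
    assume "prec d (f {x, y, u, v}) x y"
    then show ?thesis using two_contain_origin_4_5_aux[OF cov dist V] by blast
  next
    assume "prec d (f {x, y, u, v}) y x"
    then have "prec d (f {y, x, u, v}) y x" by (simp add: insert_commute)
    moreover have "distinct [y, x, u, v, w]" "set [y, x, u, v, w] = V" using dist V by auto
    ultimately show ?thesis using two_contain_origin_4_5_aux[OF cov] by blast
  qed
qed

lemma two_successors_imp_origin_4_5:
  assumes cov: "covers 4 V A f" and "card V = 5" "S \<subseteq> V" "card S = 4"
    "x \<in> S" "p \<in> S" "q \<in> S" "distinct [x, p, q]" "prec d (f S) x p" "prec d (f S) x q"
  shows "origin d A V x"
proof -
  have "p \<in> S - {x}" "q \<in> S - {x} - {p}" using assms by auto
  then have "card (S - {x} - {p} - {q}) = 1" using assms(4,5) by simp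
  then obtain u where u: "S - {x} - {p} - {q} = {u}" by (rule card_1_singletonE)
  have "finite V" using cov by (rule covers_finite)
  then have "card (V - S) = 1" using assms(2-4) by (simp add: card_Diff_subset finite_subset)
  then obtain v where v: "V - S = {v}" by (rule card_1_singletonE)
  have S: "S = {x, p, q, u}" using u assms(5-7) by auto
  then have "set [x, p, q, u, v] = V" using v assms(3) by auto
  moreover have "distinct [x, p, q, u, v]" using u v S assms(8) by auto
  ultimately show ?thesis using two_successors_4_5_aux[OF cov] assms(9,10) S by blast
qed

text \<open>If \<open>k + 1 < card V\<close>, the arcs avoiding \<open>x\<close> survive. If \<open>k + 1 = card V\<close>, every arc but the one
  spent on leaving \<open>x\<close> is kept and \<open>x\<close> is ignored in it; the index set of the spent arc is taken
  over by the arc on \<open>V - {x}\<close>, so uniformity drops to \<open>k - 1\<close>.\<close>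

lemma covers_delete_arc:
  assumes cov: "covers k V A f" and k: "4 \<le> k" "k < card V" "6 \<le> card V"
    and S: "S \<subseteq> V" "card S = k" "x \<in> S"
  obtains k' f' where "4 \<le> k'" "k' < card (V - {x})" "covers k' (V - {x}) (A - {f S}) f'"
    "\<And>T. \<lbrakk>T \<subseteq> V - {x}; card T = k'\<rbrakk> \<Longrightarrow> \<exists>T'. T \<subseteq> T' \<and> T' \<subseteq> V \<and> card T' = k \<and> f' T = f T'"
proof (cases "k + 1 < card V")
  case True
  have "x \<in> V" using S by blast
  then have "k < card (V - {x})" using True by simp
  moreover have "\<exists>T'. T \<subseteq> T' \<and> T' \<subseteq> V \<and> card T' = k \<and> f T = f T'" if "T \<subseteq> V - {x}" "card T = k" for T
    using that by blast
  ultimately show ?thesis using that[OF k(1) _ covers_delete[OF cov S]] by blast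
next
  case False
  have fin: "finite V" using cov by (rule covers_finite)
  have xV: "x \<in> V" using S by blast
  have cV: "card V = Suc k" using False k(2) by simp
  have "card (V - S) = 1" using fin S cV by (simp add: card_Diff_subset finite_subset)
  then obtain u where u: "V - S = {u}" by (rule card_1_singletonE)
  then have uV: "u \<in> V" "u \<noteq> x" and SV: "S = V - {u}" using S by auto
  \<comment> \<open>\<open>insert x T\<close> would be the spent index set \<open>S\<close> exactly
    for \<open>T = V - {x} - {u}\<close>. That set is redirected to \<open>V - {x}\<close>, the only
    \<open>k\<close>-set without \<open>x\<close>.\<close>
  define \<phi> where "\<phi> T = (if T = V - {x} - {u} then V - {x} else insert x T)" for T
  have \<phi>: "T \<subseteq> \<phi> T \<and> \<phi> T \<subseteq> V \<and> card (\<phi> T) = k \<and> \<phi> T \<noteq> S" if T: "T \<subseteq> V - {x}" "card T = k - 1" for T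
  proof (cases "T = V - {x} - {u}")
    case True
    then show ?thesis using cV xV S(3) by (auto simp: \<phi>_def)
  next
    case False
    have "finite T" "x \<notin> T" using T(1) fin finite_subset by auto
    then have "card (insert x T) = k" using T(2) k(1) by simp
    moreover have "insert x T \<noteq> S"
    proof
      assume "insert x T = S"
      then have "T = S - {x}" using \<open>x \<notin> T\<close> by blast
      then show False using False SV by blast
    qed
    ultimately show ?thesis using False T(1) xV by (auto simp: \<phi>_def)
  qed
  have \<phi>_inj: "T = T'" if T: "T \<subseteq> V - {x}" "T' \<subseteq> V - {x}" "\<phi> T = \<phi> T'" for T T'
  proof -
    \<comment> \<open>Whether \<open>x\<close> lies in the image tells the redirected set from all
      others.\<close>
    have mem: "x \<in> \<phi> T \<longleftrightarrow> T \<noteq> V - {x} - {u}" "x \<in> \<phi> T' \<longleftrightarrow> T' \<noteq> V - {x} - {u}"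
      by (simp_all add: \<phi>_def)
    show ?thesis
    proof (cases "T = V - {x} - {u}")
      case True
      then show ?thesis using mem T(3) by metis
    next
      case False
      then have "T' \<noteq> V - {x} - {u}" using mem T(3) by metis
      then have "insert x T = insert x T'" using False T(3) by (simp add: \<phi>_def)
      then show ?thesis using T(1,2) by blast
    qed
  qed
  have "covers (k - 1) (V - {x}) (A - {f S}) (f \<circ> \<phi>)"
    unfolding covers_def
  proof (intro conjI allI impI)
    show "finite (V - {x})" using fin by simp
    show "inj_on (f \<circ> \<phi>) {T. T \<subseteq> V - {x} \<and> card T = k - 1}"
    proof (rule inj_onI)
      fix T T' assume T: "T \<in> {T. T \<subseteq> V - {x} \<and> card T = k - 1}" "T' \<in> {T. T \<subseteq> V - {x} \<and> card T = k - 1}"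
        "(f \<circ> \<phi>) T = (f \<circ> \<phi>) T'"
      have "\<phi> T = \<phi> T'" by (rule covers_inj[OF cov]) (use T \<phi>[of T] \<phi>[of T'] in auto)
      then show "T = T'" using \<phi>_inj T by blast
    qed
    fix T assume T: "T \<subseteq> V - {x}" "card T = k - 1"
    note p = \<phi>[OF T]
    have "f (\<phi> T) \<noteq> f S" using covers_inj[OF cov _ _ _ S(1,2)] p by blast
    then show "(f \<circ> \<phi>) T \<in> A - {f S}" using coversD(1)[OF cov] p by simp
    show "distinct ((f \<circ> \<phi>) T)" using coversD(2)[OF cov] p by simp
    show "T \<subseteq> set ((f \<circ> \<phi>) T)" using coversD(3)[OF cov, of "\<phi> T"] p by auto
  qed
  \<comment> \<open>From \<open>card V = Suc k\<close> and \<open>6 \<le> card V\<close> one gets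
    \<open>5 \<le> k\<close>, so the lowered uniformity stays in the range of the induction.\<close>
  moreover have "4 \<le> k - 1" "k - 1 < card (V - {x})" using cV k xV by auto
  moreover have "\<exists>T'. T \<subseteq> T' \<and> T' \<subseteq> V \<and> card T' = k \<and> (f \<circ> \<phi>) T = f T'"
    if "T \<subseteq> V - {x}" "card T = k - 1" for T using \<phi>[OF that] by (intro exI[of _ "\<phi> T"]) simp
  ultimately show ?thesis using that by blast
qed

text \<open>As for triples, the claims are proved together, but here both successors lie in one arc.
  \<open>k\<close> and \<open>f\<close> vary in the induction because a deletion may replace them;
  whatever happens, five vertices leave only \<open>k = 4\<close> as base.\<close>

lemma large_uniform:
  assumes "covers k V A f" "4 \<le> k" "k < card V"
  shows "(\<forall>S x p q. S \<subseteq> V \<longrightarrow> card S = k \<longrightarrow> x \<in> S \<longrightarrow> p \<in> S \<longrightarrow> q \<in> S \<longrightarrow> distinct [x, p, q] \<longrightarrow>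
      prec d (f S) x p \<longrightarrow> prec d (f S) x q \<longrightarrow> origin d A V x) \<and>
    (\<forall>x \<in> V. \<forall>y \<in> V. x \<noteq> y \<longrightarrow> origin d A V x \<or> origin d A V y)"
  using assms
proof (induction "card V" arbitrary: k V A f d rule: less_induct)
  case less
  note cov = less.prems(1)
  have fin: "finite V" using cov by (rule covers_finite)
  show ?case
  proof (cases "card V = 5")
    case True
    then have "k = 4" using less.prems by simp
    then show ?thesis using two_successors_imp_origin_4_5[OF cov[unfolded \<open>k = 4\<close>] True]
      two_contain_origin_4_5[OF cov[unfolded \<open>k = 4\<close>] True] by blast
  next
    case False
    then have card6: "6 \<le> card V" using less.prems by simp
    have smaller: "card (V - {x}) < card V" if "x \<in> V" for x using fin that by (rule card_Diff1_less)
    have C: "origin d A V x" if S: "S \<subseteq> V" "card S = k" "x \<in> S" "p \<in> S" "q \<in> S" "distinct [x, p, q]"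
      "prec d (f S) x p" "prec d (f S) x q" for S x p q
    proof -
      obtain k' f' where k': "4 \<le> k'" "k' < card (V - {x})" "covers k' (V - {x}) (A - {f S}) f'"
        by (rule covers_delete_arc[OF cov less.prems(2,3) card6 S(1-3)])
      have xV: "x \<in> V" and "p \<in> V - {x}" "q \<in> V - {x}" "p \<noteq> q" using S by auto
      then have "origin (\<not> d) (A - {f S}) (V - {x}) p \<or> origin (\<not> d) (A - {f S}) (V - {x}) q"
        using less.hyps[OF smaller[OF xV] k'(3,1,2), of "\<not> d"] by blast
      then show ?thesis
        using origin_step[of p V x "f S" A d] origin_step[of q V x "f S" A d] S coversD(1)[OF cov S(1,2)] by auto
    qed
    have S: "origin d A V x \<or> origin d A V y"
      if xy: "x \<in> V" "y \<in> V" "x \<noteq> y" and S: "S \<subseteq> V" "card S = k" "x \<in> S" "y \<in> S" "prec d (f S) x y" for x y S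
    proof (rule ccontr)
      assume no: "\<not> ?thesis"
      obtain k' f' where k': "4 \<le> k'" "k' < card (V - {x})" "covers k' (V - {x}) (A - {f S}) f'"
        "\<And>T. \<lbrakk>T \<subseteq> V - {x}; card T = k'\<rbrakk> \<Longrightarrow> \<exists>T'. T \<subseteq> T' \<and> T' \<subseteq> V \<and> card T' = k \<and> f' T = f T'"
        using covers_delete_arc[OF cov less.prems(2,3) card6 S(1-3)] by metis
      have "k' - 1 \<le> card (V - {x} - {y})" using k'(2) xy by simp
      then obtain W where W: "W \<subseteq> V - {x} - {y}" "card W = k' - 1" by (rule obtain_subset_with_card_n)
      have finW: "finite W" using W(1) fin finite_subset by blast
      \<comment> \<open>\<open>?T\<close> avoids \<open>x\<close>, so its arc exists after the
        deletion. It is also an arc \<open>f T'\<close> of the structure on \<open>V\<close>, where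
        \<open>C\<close> limits how many vertices may follow \<open>y\<close>.\<close>
      let ?T = "insert y W"
      have "y \<notin> W" using W(1) by blast
      then have T: "?T \<subseteq> V - {x}" "card ?T = k'" using W xy finW k'(1) by auto
      obtain T' where T': "?T \<subseteq> T'" "T' \<subseteq> V" "card T' = k" "f' ?T = f T'" using k'(4)[OF T] by blast
      have one: "p = q" if "p \<in> W" "q \<in> W" "prec d (f T') y p" "prec d (f T') y q" for p q
        using C[OF T'(2,3), of y p q] that T'(1) W(1) no by auto
      \<comment> \<open>The bound \<open>4 \<le> k'\<close> pays off here: at least three vertices
        share the arc with \<open>y\<close>, and at most one follows it, so two precede it.\<close>
      have "3 \<le> card W" using W(2) k'(1) by simp
      then obtain X where X: "X \<subseteq> W" "card X = 3" by (rule obtain_subset_with_card_n)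
      obtain p q where pq: "p \<in> X" "q \<in> X" "p \<noteq> q" "\<not> prec d (f T') y p" "\<not> prec d (f T') y q"
        by (rule two_outside_of_three[OF X(2), of "\<lambda>w. prec d (f T') y w"])
          (use one subsetD[OF X(1)] in blast)+
      have neg: "prec (\<not> d) (f' ?T) y w" if "w \<in> X" "\<not> prec d (f T') y w" for w
      proof -
        have "prec d (f T') y w \<or> prec d (f T') w y"
          by (rule covers_total[OF cov T'(2,3)]) (use T'(1) that X(1) W(1) in auto)
        then show ?thesis using that(2) T'(4) by simp
      qed
      have "distinct [y, p, q]" "p \<in> ?T" "q \<in> ?T" using pq X(1) W(1) by auto
      then have "origin (\<not> d) (A - {f S}) (V - {x}) y"
        using less.hyps[OF smaller[OF xy(1)] k'(3,1,2), of "\<not> d", THEN conjunct1, rule_format, OF T, of y p q]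
          neg[of p] neg[of q] pq by blast
      then have "origin d A V x"
        by (intro origin_step[of y V x "f S" A d]) (use xy S coversD(1)[OF cov S(1,2)] in auto)
      then show False using no by blast
    qed
    have "origin d A V x \<or> origin d A V y" if xy: "x \<in> V" "y \<in> V" "x \<noteq> y" for x y
    proof -
      have "k - 2 \<le> card (V - {x} - {y})" using less.prems(3) xy by simp
      then obtain W where W: "W \<subseteq> V - {x} - {y}" "card W = k - 2" by (rule obtain_subset_with_card_n)
      have finW: "finite W" using W(1) fin finite_subset by blast
      let ?S = "insert x (insert y W)"
      have "x \<notin> insert y W" "y \<notin> W" using W(1) xy by auto
      then have "card ?S = k" using W(2) finW less.prems(2) by simp
      moreover have "?S \<subseteq> V" using W(1) xy by auto
      moreover have "prec d (f ?S) x y \<or> prec d (f ?S) y x"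
        by (rule covers_total[OF cov]) (use calculation xy in auto)
      ultimately show ?thesis using S[of x y ?S] S[of y x ?S] xy by blast
    qed
    then show ?thesis using C by blast
  qed
qed

section \<open>The exceptional hypertournaments\<close>

text \<open>The arcs of \<open>H4\<close> with every vertex lowered by one, since decision trees
  number from 0.\<close>

definition H4_arcs :: "nat list list" where
  "H4_arcs = [[1, 2, 3], [3, 0, 1], [2, 3, 0], [0, 1, 2]]"

lemma origin_or_H4:
  assumes "covers 3 V A f" "card V = 4"
  shows "(\<exists>x \<in> V. origin d A V x) \<or> patterned d 4 H4_arcs V f"
proof -
  have chk: "check 4 3 [0, 1, 2, 3] H4_arcs []
    (Split [0,1,2] 0 1 (Split [1,2,3] 2 3 (Split [0,1,3] 0 3 (Walk [2,3,0,1]) (Split [0,2,3] 0 2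
     (Split [0,1,3] 1 3 (Split [0,1,2] 0 2 (Split [0,2,3] 0 3 (Walk [1,3,0,2]) (Split [0,1,2] 1 2
     (Walk [0,2,1,3]) (Split [1,2,3] 1 2 (Walk [0,2,1,3]) (Split [1,2,3] 1 3 (Iso [0,2,1,3])
     (Trans [0,2,3] 3 0 2 (Walk [0,1,3,2])))))) (Trans [0,1,3] 1 3 0 (Walk [1,0,2,3])))
     (Walk [3,1,0,2])) (Split [0,1,3] 1 3 (Trans [0,1,3] 1 3 0 (Walk [1,0,2,3])) (Split [0,2,3] 0 3
     (Walk [2,3,0,1]) (Split [0,1,2] 1 2 (Split [1,2,3] 1 2 (Split [0,1,3] 0 1 (Split [0,2,3] 2 3
     (Iso [0,1,2,3]) (Walk [0,1,3,2])) (Walk [1,0,2,3])) (Walk [2,1,3,0])) (Walk [2,1,3,0]))))))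
     (Split [0,1,3] 1 3 (Split [1,2,3] 1 2 (Split [0,2,3] 0 3 (Walk [0,3,1,2]) (Split [0,1,3] 0 1
     (Split [0,1,2] 0 2 (Walk [0,2,1,3]) (Split [0,2,3] 2 3 (Trans [0,1,2] 2 0 1 (Walk [0,1,2,3]))
     (Split [0,2,3] 0 2 (Walk [0,2,1,3]) (Split [1,2,3] 1 3 (Iso [0,1,3,2]) (Walk [0,1,3,2])))))
     (Walk [1,0,3,2]))) (Split [0,2,3] 2 3 (Walk [0,1,2,3]) (Trans [1,2,3] 3 2 1 (Walk [0,1,3,2]))))
     (Walk [0,1,3,2]))) (Split [0,2,3] 2 3 (Split [0,1,3] 1 3 (Walk [2,3,1,0]) (Split [1,2,3] 1 2
     (Split [0,1,3] 0 3 (Split [0,1,2] 1 2 (Split [1,2,3] 1 3 (Walk [0,3,1,2]) (Split [0,1,2] 0 2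
     (Trans [1,2,3] 3 1 2 (Walk [0,2,3,1])) (Split [0,2,3] 0 2 (Trans [1,2,3] 3 1 2 (Walk [0,2,3,1]))
     (Split [0,2,3] 0 3 (Iso [0,3,1,2]) (Trans [1,2,3] 3 1 2 (Walk [1,0,3,2]))))))
     (Trans [0,1,3] 0 3 1 (Walk [0,1,2,3]))) (Walk [3,0,1,2])) (Split [0,1,3] 0 3
     (Trans [0,1,3] 0 3 1 (Walk [0,1,2,3])) (Split [1,2,3] 1 3 (Walk [2,3,1,0]) (Split [0,1,2] 0 2
     (Split [0,2,3] 0 2 (Split [0,1,3] 0 1 (Walk [0,1,2,3]) (Split [1,2,3] 2 3 (Iso [0,2,3,1])
     (Walk [0,2,3,1]))) (Walk [2,0,3,1])) (Walk [2,0,3,1])))))) (Split [0,1,3] 0 3 (Split [0,2,3] 0 2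
     (Split [1,2,3] 1 3 (Walk [1,3,0,2]) (Split [0,1,3] 0 1 (Walk [0,1,3,2]) (Split [0,1,2] 1 2
     (Trans [0,1,3] 1 0 3 (Walk [0,2,1,3])) (Split [1,2,3] 2 3 (Walk [0,3,2,1]) (Split [1,2,3] 1 2
     (Trans [0,1,3] 1 0 3 (Walk [0,2,1,3])) (Split [0,2,3] 0 3 (Iso [0,3,2,1]) (Walk [1,0,3,2])))))))
     (Split [1,2,3] 2 3 (Walk [1,0,2,3]) (Trans [0,2,3] 3 2 0 (Walk [1,0,3,2])))) (Walk [1,0,3,2]))))"
    by code_simp
  obtain vs where vs: "set vs = V" "distinct vs"
    using finite_distinct_list[OF covers_finite[OF assms(1)]] by blast
  then have len: "length vs = 4" using distinct_card[of vs] assms(2) by simp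
  have "(\<exists>i \<in> set [0, 1, 2, 3]. origin d A V (vs ! i)) \<or> patterned d 4 H4_arcs V f"
    by (rule enumerated_check[OF assms(1) vs(2,1) len chk]) simp
  moreover have "vs ! i \<in> V" if "i \<in> set [0, 1, 2, 3]" for i using that vs(1) len by (intro subsetD[OF equalityD1[OF vs(1)]] nth_mem) auto
  ultimately show ?thesis by blast
qed

text \<open>The direction is quantified because of the large case, where the neighbours of an
  arbitrary vertex decide it. The small cases all give a forward origin or a pattern.\<close>

lemma origin_exists_2:
  assumes cov: "covers 2 V A f" and "3 \<le> card V"
  shows "(\<exists>d. \<exists>x \<in> V. origin d A V x) \<or> patterned True 3 (circulant 3 [1]) V f \<or>
    patterned True 5 (circulant 5 [1, 2]) V f \<or> patterned True 7 (circulant 7 [1, 2, 4]) V f"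
proof -
  consider "card V = 3" | "card V = 4" | "card V = 5" | "card V = 6" | "card V = 7" | "card V = 8" | "9 \<le> card V"
    using assms(2) by linarith
  then show ?thesis
  proof cases
    case 1
    then show ?thesis using origin_or_T3[OF cov, of True] by blast
  next
    case 2
    then show ?thesis using origin_4[OF cov, of True] by blast
  next
    case 3
    then show ?thesis using origin_or_T5[OF cov, of True] by blast
  next
    case 4
    then show ?thesis using origin_6[OF cov, of True] by blast
  next
    case 5
    then obtain X where "X \<subseteq> V" "card X = 5" using obtain_subset_with_card_n[of 5 V] by auto
    then show ?thesis using five_contain_origin_7[OF cov 5, of X True] by blast
  next
    case 6
    then obtain X where "X \<subseteq> V" "card X = 3" using obtain_subset_with_card_n[of 3 V] by auto
    then show ?thesis using three_contain_origin_8[OF cov 6, of X True] by blast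
  next
    case 7
    then obtain x where x: "x \<in> V" by fastforce
    \<comment> \<open>The neighbours of \<open>x\<close> split into two classes, so one class has at
      least three members.\<close>
    have "8 \<le> card (out True V f x) + card (out False V f x)" using card_out[OF cov x, of True] 7 by simp
    then have "3 \<le> card (out True V f x) \<or> 3 \<le> card (out False V f x)" by linarith
    then show ?thesis using large_out_imp_origin[OF cov 7 x] x by blast
  qed
qed

section \<open>From patterns to isomorphisms\<close>

lemma sorted_wrt_unique:
  assumes "sorted_wrt R xs" "sorted_wrt R ys" "set xs = set ys" "\<And>x y. R x y \<Longrightarrow> \<not> R y x"
  shows "xs = ys"
  using assms(1-3)
proof (induction xs arbitrary: ys)
  case Nil
  then show ?case by simp
next
  case (Cons x xs)
  then obtain y ys' where ys: "ys = y # ys'" by (cases ys) auto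
  have "x = y"
  proof (rule ccontr)
    assume "x \<noteq> y"
    then have "R x y" "R y x" using Cons.prems ys by (auto simp: set_eq_iff)
    then show False using assms(4) by blast
  qed
  moreover have "\<not> R x x" "\<not> R y y" using assms(4) by blast+
  then have "x \<notin> set xs" "y \<notin> set ys'" using Cons.prems(1,2) ys by auto
  then have "set xs = set ys'" using Cons.prems(3) ys \<open>x = y\<close> by auto
  ultimately show ?case using Cons ys by auto
qed

text \<open>By transitivity the comparisons of neighbours make \<open>c\<close> sorted by precedence
  in \<open>b\<close>, as is \<open>b\<close> itself, and an asymmetric order sorts a set in only
  one way.\<close>

lemma successively_prec_eq:
  assumes "distinct b" "successively (prec True b) c" "set c = set b"
  shows "c = b"
proof (rule sorted_wrt_unique)
  have "transp (prec True b)" using prec_trans[OF assms(1)] by (auto intro: transpI)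
  then show "sorted_wrt (prec True b) c" using assms(2) by (simp add: successively_conv_sorted_wrt)
  show "sorted_wrt (prec True b) b"
    unfolding sorted_wrt_iff_nth_less by (auto simp: prec_def precedes_in_def)
  show "\<not> prec True b y x" if "prec True b x y" for x y using prec_asym[OF assms(1) that] .
qed (fact assms(3))

text \<open>Each exceptional arc is carried by \<open>h\<close> to the arc of \<open>H\<close> on
  the same vertices, since the orders agree. Because \<open>ex\<close> meets every
  \<open>k\<close>-set of numbers, no arc of \<open>H\<close> is missed; the isomorphism is the
  inverse of \<open>h\<close>.\<close>

lemma patterned_imp_isomorphic:
  assumes H: "hypertournament k n H" and f: "\<forall>a \<in> arcs H. f (set a) = a"
    and pat: "patterned True m ex (verts H) f"
    and ex: "\<And>a. a \<in> set ex \<Longrightarrow> card (set a) = k"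
      "\<And>S. \<lbrakk>S \<subseteq> {..<m}; card S = k\<rbrakk> \<Longrightarrow> \<exists>a \<in> set ex. set a = S"
  shows "isomorphic H ({..<m}, set ex)"
proof -
  obtain h where h: "bij_betw h {..<m} (verts H)"
    and pr: "\<And>a. a \<in> set ex \<Longrightarrow> set a \<subseteq> {..<m} \<and> successively (prec True (f (h ` set a))) (map h a)"
    using pat unfolding patterned_def by blast
  have inj: "inj_on h {..<m}" using h by (rule bij_betw_imp_inj_on)
  have arc: "\<forall>a \<in> arcs H. length a = k \<and> distinct a \<and> set a \<subseteq> verts H"
    and uniq: "\<forall>S. S \<subseteq> verts H \<and> card S = k \<longrightarrow> (\<exists>!a. a \<in> arcs H \<and> set a = S)"
    using H unfolding hypertournament_def by - (elim conjE, assumption)+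
  have img: "map h a \<in> arcs H" if "a \<in> set ex" for a
  proof -
    have "set a \<subseteq> {..<m}" using pr that by blast
    then have "h ` set a \<subseteq> verts H" "card (h ` set a) = k"
      using h ex(1)[OF that] inj_on_subset[OF inj] by (auto simp: bij_betw_def card_image)
    then have "\<exists>!b. b \<in> arcs H \<and> set b = h ` set a" by (intro uniq[rule_format] conjI)
    then obtain b where b: "b \<in> arcs H" "set b = h ` set a" by (elim ex1E conjE)
    have "map h a = b"
    proof (rule successively_prec_eq)
      show "distinct b" using arc b by blast
      show "successively (prec True b) (map h a)" using pr[OF that] f[rule_format, OF b(1)] b(2) by simp
    qed (use b in simp)
    then show ?thesis using b by simp
  qed
  define g where "g = inv_into {..<m} h"
  have g: "bij_betw g (verts H) {..<m}" unfolding g_def using h by (rule bij_betw_inv_into)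
  have gh: "map g (map h a) = a" if "a \<in> set ex" for a
    using pr[OF that] inj by (auto simp: g_def inv_into_f_f intro!: map_idI)
  have "map g ` arcs H = set ex"
  proof
    show "set ex \<subseteq> map g ` arcs H"
    proof
      fix a assume "a \<in> set ex"
      then show "a \<in> map g ` arcs H" using img gh by (metis image_eqI)
    qed
    show "map g ` arcs H \<subseteq> set ex"
    proof (rule image_subsetI)
      fix b assume b: "b \<in> arcs H"
      have bV: "set b \<subseteq> verts H" "card (set b) = k" using arc b distinct_card[of b] by auto
      have "g ` set b \<subseteq> {..<m}" using g bV(1) by (auto simp: bij_betw_def)
      moreover have "card (g ` set b) = k"
        using card_image[OF inj_on_subset[OF bij_betw_imp_inj_on[OF g] bV(1)]] bV(2) by simp
      ultimately obtain a where a: "a \<in> set ex" "set a = g ` set b" using ex(2) by blast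
      have "h ` g ` set b = set b"
        using bV(1) h by (force simp: g_def image_image bij_betw_def f_inv_into_f subset_iff)
      then have "set (map h a) = set b" using a(2) by simp
      then have "map h a = b" using f img[OF a(1)] b by metis
      then show "map g b \<in> set ex" using gh[OF a(1)] a(1) by simp
    qed
  qed
  then show ?thesis using g unfolding isomorphic_def by auto
qed

lemma isomorphic_trans:
  assumes "isomorphic H K" "isomorphic K L"
  shows "isomorphic H L"
proof -
  obtain g where g: "bij_betw g (verts H) (verts K)" "map g ` arcs H = arcs K"
    using assms(1) unfolding isomorphic_def by blast
  obtain h where h: "bij_betw h (verts K) (verts L)" "map h ` arcs K = arcs L"
    using assms(2) unfolding isomorphic_def by blast
  have "map (h \<circ> g) ` arcs H = arcs L" 
    unfolding g(2)[symmetric] h(2)[symmetric] by (simp add: image_image)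
  then show ?thesis using bij_betw_trans[OF g(1) h(1)] unfolding isomorphic_def by blast
qed

lemma set_circulant: "set (circulant n ss) = {[i, (i + s) mod n] | i s. i < n \<and> s \<in> set ss}"
  by (auto simp: circulant_def)

lemma circulants:
  "T3c = ({..<3}, set (circulant 3 [1]))" "T5c = ({..<5}, set (circulant 5 [1, 2]))"
  "T7c = ({..<7}, set (circulant 7 [1, 2, 4]))"
  by (simp_all add: set_circulant T3c_def T5c_def T7c_def)

lemma H4_arcs_isomorphic: "isomorphic ({..<4}, set H4_arcs) H4" "isomorphic H4 ({..<4}, set H4_arcs)"
proof -
  have four: "{..<4} = {0, 1, 2, 3 :: nat}" by auto
  have "bij_betw (\<lambda>i. i + 1) {..<4} {1, 2, 3, 4 :: nat}"
    unfolding four by (auto simp: bij_betw_def numeral_eq_Suc)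
  then show "isomorphic ({..<4}, set H4_arcs) H4"
    unfolding isomorphic_def
  proof (intro exI conjI)
    show "map (\<lambda>i. i + 1) ` arcs ({..<4}, set H4_arcs) = arcs H4"
      by (simp add: H4_def H4_arcs_def numeral_eq_Suc)
  qed (simp add: H4_def)
  have "bij_betw (\<lambda>i. i - 1) {1, 2, 3, 4} {..<4::nat}" unfolding four by (simp add: bij_betw_def)
  then show "isomorphic H4 ({..<4}, set H4_arcs)"
    unfolding isomorphic_def
  proof (intro exI conjI)
    show "map (\<lambda>i. i - 1) ` arcs H4 = arcs ({..<4}, set H4_arcs)"
      by (simp add: H4_def H4_arcs_def numeral_eq_Suc)
  qed (simp add: H4_def)
qed

section \<open>The exceptional structures have no path\<close>

lemma alt_map:
  assumes "alt d A v W" "inj_on g V" "\<forall>a \<in> A. set a \<subseteq> V" "W \<subseteq> V"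
  shows "alt d (map g ` A) (g v) (g ` W)"
  using assms
proof (induction rule: alt.induct)
  case (alt_empty d A v)
  show ?case by (simp add: alt.alt_empty)
next
  case (alt_step w W a A d v)
  have "alt (\<not> d) (map g ` (A - {a})) (g w) (g ` (W - {w}))"
    using alt_step.IH alt_step.prems by blast
  \<comment> \<open>Distinct arcs must stay distinct after relabelling; otherwise removing the used
    arc would not commute with \<open>map g\<close>.\<close>
  moreover have "inj_on (map g) A"
  proof (rule inj_onI)
    fix b c assume "b \<in> A" "c \<in> A" "map g b = map g c"
    then show "b = c" using alt_step.prems(1,2) by (meson inj_on_subset map_inj_on Un_least)
  qed
  then have "map g ` (A - {a}) = map g ` A - {map g a}"
    using inj_on_image_set_diff[of "map g" A A "{a}"] alt_step.hyps by simp
  moreover have "g ` (W - {w}) = g ` W - {g w}"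
    using inj_on_image_set_diff[of g V W "{w}"] alt_step.prems alt_step.hyps by auto
  moreover have "prec d (map g a) (g v) (g w)"
    using alt_step.hyps(3) by (auto simp: prec_def precedes_in_def split: if_splits) (metis nth_map order.strict_trans)+
  ultimately have "alt (\<not> d) (map g ` A - {map g a}) (g w) (g ` W - {g w})" "prec d (map g a) (g v) (g w)"
    by simp_all
  from alt.alt_step[OF _ _ this(2,1)] alt_step.hyps(1,2) show ?case by simp
qed

text \<open>A recursive form of \<open>precedes_in\<close> without quantifiers, for
  evaluation.\<close>

fun before :: "'a list \<Rightarrow> 'a \<Rightarrow> 'a \<Rightarrow> bool" where
  "before [] x y \<longleftrightarrow> False"
| "before (z # zs) x y \<longleftrightarrow> z = x \<and> List.member zs y \<or> before zs x y"

lemma precedes_in_imp_before: "precedes_in a x y \<Longrightarrow> before a x y"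
proof (induction a)
  case Nil
  then show ?case by (simp add: precedes_in_def)
next
  case (Cons z zs)
  then obtain i j where ij: "i < j" "j < length (z # zs)" "(z # zs) ! i = x" "(z # zs) ! j = y"
    by (auto simp: precedes_in_def)
  then obtain j' where j': "j = Suc j'" by (cases j) auto
  show ?case
  proof (cases i)
    case 0
    then show ?thesis using ij j' by auto
  next
    case (Suc i')
    then have "precedes_in zs x y" using ij j' unfolding precedes_in_def by (intro exI[of _ i'] exI[of _ j']) auto
    then show ?thesis using Cons.IH by simp
  qed
qed

text \<open>Exhaustive search, with the number counting the steps still to be made. Refuting paths
  takes only one implication: an alternating path makes the search succeed.\<close>

fun search :: "nat \<Rightarrow> bool \<Rightarrow> 'a list list \<Rightarrow> 'a \<Rightarrow> 'a list \<Rightarrow> bool" where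
  "search 0 d as v ws \<longleftrightarrow> True"
| "search (Suc n) d as v ws \<longleftrightarrow> list_ex (\<lambda>a. List.member a v \<and> list_ex (\<lambda>w.
     List.member ws w \<and> (if d then before a v w else before a w v) \<and>
     search n (\<not> d) (remove1 a as) w (remove1 w ws)) a) as"

lemma alt_imp_search:
  assumes "alt d (set as) v (set ws)" "distinct as" "distinct ws"
  shows "search (length ws) d as v ws"
  using assms
proof (induction "length ws" arbitrary: d as v ws)
  case 0
  then show ?case by simp
next
  case (Suc n)
  then obtain w a where wa: "w \<in> set ws" "a \<in> set as" "prec d a v w"
    "alt (\<not> d) (set as - {a}) w (set ws - {w})"
    by (auto elim: alt.cases)
  have "n = length (remove1 w ws)" using Suc.hyps(2) wa(1) by (simp add: length_remove1)
  then have "search n (\<not> d) (remove1 a as) w (remove1 w ws)"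
    using Suc.hyps(1)[of "remove1 w ws" "\<not> d" "remove1 a as" w] wa(4) Suc.prems by simp
  moreover have "if d then before a v w else before a w v"
    using wa(3) by (auto simp: prec_def intro: precedes_in_imp_before)
  moreover have "v \<in> set a" "w \<in> set a" using prec_mem[OF wa(3)] by blast+
  ultimately show ?case
    unfolding Suc.hyps(2)[symmetric] search.simps list_ex_iff List.member_iff using wa(1,2) by blast
qed

text \<open>A path gives an origin, the isomorphism carries it to the concrete structure, and there
  the search from that vertex in that direction would have to succeed.\<close>

lemma no_path_if_search_fails:
  assumes iso: "isomorphic H ({..<n}, set as)" and H: "hypertournament k m H"
    and as: "distinct as" "\<forall>a \<in> set as. distinct a"
    and fails: "list_all (\<lambda>v. \<not> search (n - 1) True as v (remove1 v [0..<n]) \<and>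
      \<not> search (n - 1) False as v (remove1 v [0..<n])) [0..<n]"
  shows "\<not> has_antidirected_hamiltonian_path H"
proof
  assume "has_antidirected_hamiltonian_path H"
  have arc: "\<forall>a \<in> arcs H. length a = k \<and> distinct a \<and> set a \<subseteq> verts H"
    using H unfolding hypertournament_def by (elim conjE)
  obtain d v where v: "v \<in> verts H" "alt d (arcs H) v (verts H - {v})"
    using path_imp_origin[OF \<open>has_antidirected_hamiltonian_path H\<close>] arc unfolding origin_def by blast
  obtain g where g: "bij_betw g (verts H) {..<n}" "map g ` arcs H = set as"
    using iso unfolding isomorphic_def by auto
  have "alt d (map g ` arcs H) (g v) (g ` (verts H - {v}))"
    by (rule alt_map[OF v(2) bij_betw_imp_inj_on[OF g(1)]]) (use arc in auto)
  moreover have gv: "g v < n" using g(1) v(1) by (auto simp: bij_betw_def)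
  moreover have "g ` (verts H - {v}) = {..<n} - {g v}"
    using inj_on_image_set_diff[OF bij_betw_imp_inj_on[OF g(1)], of "verts H" "{v}"] v(1)
      bij_betw_imp_surj_on[OF g(1)] by simp
  ultimately have "alt d (set as) (g v) (set (remove1 (g v) [0..<n]))"
    using g(2) by (simp add: atLeast0LessThan)
  then have "search (length (remove1 (g v) [0..<n])) d as (g v) (remove1 (g v) [0..<n])"
    by (rule alt_imp_search) (use as in simp_all)
  then show False using fails gv by (cases d) (auto simp: list_all_iff length_remove1)
qed

lemma pair_cover:
  assumes "\<And>i j. \<lbrakk>i < j; j < n\<rbrakk> \<Longrightarrow> [i, j] \<in> set ex \<or> [j, i] \<in> set ex" "S \<subseteq> {..<n::nat}" "card S = 2"
  shows "\<exists>a \<in> set ex. set a = S"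
proof -
  obtain u v where uv: "S = {u, v}" "u \<noteq> v" using assms(3) by (auto simp: card_2_iff)
  have "set [u, v] = S" "set [v, u] = S" using uv by auto
  moreover have "[u, v] \<in> set ex \<or> [v, u] \<in> set ex"
    using assms(1)[of u v] assms(1)[of v u] uv assms(2) by (cases u v rule: linorder_cases) auto
  ultimately show ?thesis by blast
qed


lemma isomorphic_imp_no_path:
  assumes H: "hypertournament k n H"
    and "isomorphic H H4 \<or> isomorphic H T3c \<or> isomorphic H T5c \<or> isomorphic H T7c"
  shows "\<not> has_antidirected_hamiltonian_path H"
  using assms(2)
proof (elim disjE)
  assume "isomorphic H H4"
  then have "isomorphic H ({..<4}, set H4_arcs)" using H4_arcs_isomorphic(2) by (rule isomorphic_trans)
  then show ?thesis by (rule no_path_if_search_fails[OF _ H]) code_simp+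
next
  assume "isomorphic H T3c"
  then show ?thesis unfolding circulants(1) by (rule no_path_if_search_fails[OF _ H]) code_simp+
next
  assume "isomorphic H T5c"
  then show ?thesis unfolding circulants(2) by (rule no_path_if_search_fails[OF _ H]) code_simp+
next
  assume "isomorphic H T7c"
  then show ?thesis unfolding circulants(3) by (rule no_path_if_search_fails[OF _ H]) code_simp+
qed

section \<open>Assembling the equivalence\<close>

lemma patterned_circulant_imp_isomorphic:
  assumes H: "hypertournament 2 n H" and f: "\<forall>a \<in> arcs H. f (set a) = a"
    and pat: "patterned True m (circulant m ss) (verts H) f"
    and pairs: "list_all (\<lambda>a. length a = 2 \<and> distinct a) (circulant m ss)"
      "list_all (\<lambda>j. list_all (\<lambda>i. List.member (circulant m ss) [i, j] \<or>
        List.member (circulant m ss) [j, i]) [0..<j]) [0..<m]"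
  shows "isomorphic H ({..<m}, set (circulant m ss))"
proof (rule patterned_imp_isomorphic[OF H f pat])
  show "card (set a) = 2" if "a \<in> set (circulant m ss)" for a
    using pairs(1) that distinct_card[of a] by (simp add: list_all_iff)
  show "\<exists>a \<in> set (circulant m ss). set a = S" if "S \<subseteq> {..<m}" "card S = 2" for S
    by (rule pair_cover[OF _ that]) (use pairs(2) in \<open>auto simp: list_all_iff\<close>)
qed

lemma H4_arcs_cover:
  assumes "u \<in> {0, 1, 2, 3}"
  shows "\<exists>a \<in> set H4_arcs. set a = {0, 1, 2, 3} - {u}"
proof -
  consider "u = 0" | "u = 1" | "u = 2" | "u = 3" using assms by blast
  then show ?thesis
  proof cases
    case 1
    then have "set [1, 2, 3] = {0, 1, 2, 3} - {u}" by auto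
    moreover have "[1, 2, 3] \<in> set H4_arcs" by (simp add: H4_arcs_def)
    ultimately show ?thesis by blast
  next
    case 2
    then have "set [2, 3, 0] = {0, 1, 2, 3} - {u}" by auto
    moreover have "[2, 3, 0] \<in> set H4_arcs" by (simp add: H4_arcs_def)
    ultimately show ?thesis by blast
  next
    case 3
    then have "set [3, 0, 1] = {0, 1, 2, 3} - {u}" by auto
    moreover have "[3, 0, 1] \<in> set H4_arcs" by (simp add: H4_arcs_def)
    ultimately show ?thesis by blast
  next
    case 4
    then have "set [0, 1, 2] = {0, 1, 2, 3} - {u}" by auto
    moreover have "[0, 1, 2] \<in> set H4_arcs" by (simp add: H4_arcs_def)
    ultimately show ?thesis by blast
  qed
qed

lemma no_path_imp_isomorphic:
  assumes H: "hypertournament k n H" and k: "2 \<le> k" "k \<le> n - 1"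
    and no: "\<not> has_antidirected_hamiltonian_path H"
  shows "isomorphic H H4 \<or> isomorphic H T3c \<or> isomorphic H T5c \<or> isomorphic H T7c"
proof -
  have n: "card (verts H) = n" using H unfolding hypertournament_def by (elim conjE)
  obtain f where cov: "covers k (verts H) (arcs H) f" and f: "\<forall>a \<in> arcs H. f (set a) = a"
    by (rule hypertournament_covers[OF H])
  have n2: "2 \<le> card (verts H)" using n k by linarith
  have none: "\<not> origin d (arcs H) (verts H) x" if "x \<in> verts H" for d x
    using origin_imp_path[OF _ that n2] no by blast
  obtain X where X: "X \<subseteq> verts H" "card X = 2" using n2 by (rule obtain_subset_with_card_n)
  obtain x y where "X = {x, y}" "x \<noteq> y" using X(2) by (auto simp: card_2_iff)
  then have xy: "x \<in> verts H" "y \<in> verts H" "x \<noteq> y" using X(1) by blast+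
  \<comment> \<open>The pair \<open>x\<close>, \<open>y\<close> serves the last two cases, where one
    of any two vertices is an origin. Four vertices with \<open>k = 3\<close> fall below the range
    of that induction and produce H_4; \<open>4 \<le> k\<close> already forces five
    vertices.\<close>
  consider "k = 2" | "k = 3" "n = 4" | "k = 3" "5 \<le> n" | "4 \<le> k" using k by linarith
  then show ?thesis
  proof cases
    case 1
    have "patterned True 3 (circulant 3 [1]) (verts H) f \<or>
      patterned True 5 (circulant 5 [1, 2]) (verts H) f \<or> patterned True 7 (circulant 7 [1, 2, 4]) (verts H) f"
    proof -
      have "3 \<le> card (verts H)" using n k by linarith
      then show ?thesis using origin_exists_2[OF cov[unfolded 1]] none by blast
    qed
    then show ?thesis
    proof (elim disjE)
      assume "patterned True 3 (circulant 3 [1]) (verts H) f"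
      then have "isomorphic H ({..<3}, set (circulant 3 [1]))"
        by (rule patterned_circulant_imp_isomorphic[OF H[unfolded 1] f]) code_simp+
      then show ?thesis by (simp add: circulants(1))
    next
      assume "patterned True 5 (circulant 5 [1, 2]) (verts H) f"
      then have "isomorphic H ({..<5}, set (circulant 5 [1, 2]))"
        by (rule patterned_circulant_imp_isomorphic[OF H[unfolded 1] f]) code_simp+
      then show ?thesis by (simp add: circulants(2))
    next
      assume "patterned True 7 (circulant 7 [1, 2, 4]) (verts H) f"
      then have "isomorphic H ({..<7}, set (circulant 7 [1, 2, 4]))"
        by (rule patterned_circulant_imp_isomorphic[OF H[unfolded 1] f]) code_simp+
      then show ?thesis by (simp add: circulants(3))
    qed
  next
    case 2
    then have "patterned True 4 H4_arcs (verts H) f"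
      using origin_or_H4[OF cov[unfolded 2(1)], of True] n none by blast
    then have "isomorphic H ({..<4}, set H4_arcs)"
    proof (rule patterned_imp_isomorphic[OF H f])
      show "card (set a) = k" if "a \<in> set H4_arcs" for a using that 2 by (auto simp: H4_arcs_def)
      fix S :: "nat set" assume S: "S \<subseteq> {..<4}" "card S = k"
      then have "card ({..<4} - S) = 1" using 2 by (simp add: card_Diff_subset finite_subset)
      then obtain u where u: "{..<4} - S = {u}" by (rule card_1_singletonE)
      moreover have "{..<4} = {0, 1, 2, 3 :: nat}" by auto
      ultimately have "S = {0, 1, 2, 3} - {u}" "u \<in> {0, 1, 2, 3}" using S(1) by blast+
      then show "\<exists>a \<in> set H4_arcs. set a = S" using H4_arcs_cover by simp
    qed
    then show ?thesis using isomorphic_trans H4_arcs_isomorphic(1) by blast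
  next
    case 3
    then have "5 \<le> card (verts H)" using n by simp
    then show ?thesis using three_uniform[OF cov[unfolded 3(1)], of True] none xy by blast
  next
    case 4
    have "k < card (verts H)" using n k by linarith
    then show ?thesis using large_uniform[OF cov 4, of True] none xy by blast
  qed
qed

theorem theorem2p2:
  fixes H :: "'a vertices_arcs" and k n :: nat
  assumes "hypertournament k n H" and "2 \<le> k" and "k \<le> n - 1"
  shows "has_antidirected_hamiltonian_path H \<longleftrightarrow>
    \<not> (isomorphic H H4 \<or> isomorphic H T3c \<or> isomorphic H T5c \<or> isomorphic H T7c)"
  using isomorphic_imp_no_path[OF assms(1)] no_path_imp_isomorphic[OF assms] by blast

end
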